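(* For every $\varepsilon>0$ there exists $n_0(\varepsilon)$ such that for every $n>n_0(\varepsilon)$ and every integer $t\geq 2$, the number of symmetric chain decompositions of the hypergrid $[t]^n$ is at least $$n^{(1-\varepsilon)t^n}.$$
   Context: The hypergrid $[t]^n$ is the set of vectors $(x_1,\dots,x_n)$ with $x_i\in\{1,\dots,t\}$, ordered coordinatewise: $(x_1,\dots,x_n)\preceq(y_1,\dots,y_n)$ iff $x_i\le y_i$ for all $i$. It is a graded poset with levels $L_0,\dots,L_{(t-1)n}$, where the rank of $x$ is $r(x)=x_1+\dots+x_n-n$ and $L_j$ is the set of elements of rank $j$; $m=(t-1)n$ is the top rank. A chain $x_0\prec x_1\prec\dots\prec x_k$ is symmetric if $r(x_0)+r(x_k)=m$ and $r(x_i)=r(x_0)+i$ for every $i=1,\dots,k$. A symmetric chain decomposition is a partition of $[t]^n$ into symmetric chains. *)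

theory Defs
  imports Complex_Main "HOL-Library.FuncSet" "HOL-Library.Disjoint_Sets"
begin

definition hypergrid :: "nat \<Rightarrow> nat \<Rightarrow> (nat \<Rightarrow> nat) set" where
  "hypergrid t n = {1..n} \<rightarrow>\<^sub>E {1..t}"

definition grid_le :: "nat \<Rightarrow> (nat \<Rightarrow> nat) \<Rightarrow> (nat \<Rightarrow> nat) \<Rightarrow> bool" where
  "grid_le n x y \<longleftrightarrow> (\<forall>i\<in>{1..n}. x i \<le> y i)"

definition grid_less :: "nat \<Rightarrow> (nat \<Rightarrow> nat) \<Rightarrow> (nat \<Rightarrow> nat) \<Rightarrow> bool" where
  "grid_less n x y \<longleftrightarrow> grid_le n x y \<and> x \<noteq> y"

text \<open>On the hypergrid every coordinate is at least 1, so the subtraction does not truncate.\<close>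

definition grid_rank :: "nat \<Rightarrow> (nat \<Rightarrow> nat) \<Rightarrow> nat" where
  "grid_rank n x = (\<Sum>i\<in>{1..n}. x i) - n"

text \<open>A symmetric chain is identified with the set of its elements. One-element chains are
  allowed (\<open>k = 0\<close>); the symmetry condition then puts the element in the middle level.\<close>

definition symmetric_chain :: "nat \<Rightarrow> nat \<Rightarrow> (nat \<Rightarrow> nat) set \<Rightarrow> bool" where
  "symmetric_chain t n C \<longleftrightarrow>
     (\<exists>(k::nat) (x :: nat \<Rightarrow> (nat \<Rightarrow> nat)).
        C = x ` {0..k} \<and>
        (\<forall>i\<in>{0..k}. x i \<in> hypergrid t n) \<and>
        (\<forall>i<k. grid_less n (x i) (x (Suc i))) \<and>
        grid_rank n (x 0) + grid_rank n (x k) = (t - 1) * n \<and>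
        (\<forall>i\<in>{1..k}. grid_rank n (x i) = grid_rank n (x 0) + i))"

definition symmetric_chain_decomposition ::
    "nat \<Rightarrow> nat \<Rightarrow> (nat \<Rightarrow> nat) set set \<Rightarrow> bool" where
  "symmetric_chain_decomposition t n D \<longleftrightarrow>
     partition_on (hypergrid t n) D \<and> (\<forall>C\<in>D. symmetric_chain t n C)"

text \<open>The cardinality in the next definition is that of a finite set.\<close>

lemma finite_symmetric_chain_decompositions:
  "finite {D. symmetric_chain_decomposition t n D}"
proof (rule finite_subset)
  show "{D. symmetric_chain_decomposition t n D} \<subseteq> Pow (Pow (hypergrid t n))"
    by (auto simp: symmetric_chain_decomposition_def partition_on_def)
  show "finite (Pow (Pow (hypergrid t n)))"
    by (simp add: hypergrid_def finite_PiE)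
qed

definition num_scd :: "nat \<Rightarrow> nat \<Rightarrow> nat" where
  "num_scd t n = card {D. symmetric_chain_decomposition t n D}"

end

theory Submission
  imports Defs "HOL-Computational_Algebra.Fundamental_Theorem_Algebra" "HOL-Real_Asymp.Real_Asymp"
begin

text \<open>
  A decomposition is built from the middle levels outwards. Prolonging the chains by the levels \<open>k\<close> and
  \<open>m - k\<close> amounts to choosing two matchings into level \<open>k + 1\<close> with the same image, that is, a perfect
  matching of one auxiliary bipartite graph. Gurvits' capacity argument for permanents gives at least
  \<open>exp (H - N)\<close> perfect matchings if there is a doubly stochastic weight of total entropy \<open>H\<close> supported on
  a graph with \<open>N + N\<close> vertices. Since the numbers \<open>N\<close> add up to at most \<open>2 t^n\<close>, it suffices to find a
  flow from each level to the next which carries the uniform distribution to the uniform distribution and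
  has entropy close to \<open>ln n\<close> at most elements.

  Such a flow is obtained one coordinate at a time: the last coordinate \<open>v\<close> of an element of rank \<open>k\<close> of
  \<open>[t]^j\<close> is raised with a probability that is forced by the rank numbers, and otherwise the rule for
  \<open>[t]^(j-1)\<close> is applied to the other coordinates. Log-concavity of the rank numbers makes this a
  probability, of mean \<open>1/j\<close>, and bounds it by \<open>O(1/j)\<close> for ranks away from both ends. After averaging over
  all orders of the coordinates, each fixed coordinate is therefore raised with probability at most
  \<open>O(ln n / n)\<close>, up to an error that is exponentially small in \<open>j\<close> at stage \<open>j\<close>.
\<close>

section \<open>Perfect matchings and entropy\<close>

text \<open>The factors gained in successive prolongations are multiplied, so the bound for one
  prolongation must not depend on the partial decomposition \<open>D\<close> already built. It does
  not: sending the lowest element of a chain that meets level \<open>k + 1\<close> to its highest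
  element is a bijection onto level \<open>m - k - 1\<close>. Composed with the order reversal of
  the grid, it carries the flow from the lower end to the upper end without changing row sums,
  column sums or entropy, whatever \<open>D\<close> is.

  The loss of \<open>N\<close> in the exponent is a constant per element, negligible against
  \<open>ln n\<close>. A distribution on \<open>n\<close> coordinates with all masses at most
  \<open>n powr (\<eta> - 1)\<close> has entropy at least \<open>(1 - \<eta>) * ln n\<close>, so a
  spare factor \<open>ln n\<close> in the bound on the flow is harmless. Only levels below the
  middle are counted, once for each end of the chains; this reaches almost all of the grid because
  no single level is large.

  All estimates have to be uniform in \<open>t\<close>, which may be far larger than
  \<open>n\<close>. Therefore ranks are compared within windows of \<open>t\<close> consecutive
  values and measured in units of \<open>t\<close>, and only log-concavity, symmetry and crude
  counting are used.\<close>

lemma complex_poly_linear_factors: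
  fixes q :: "complex poly"
  obtains r where "\<And>t. poly q t = lead_coeff q * (\<Prod>i<degree q. t - r i)"
    and "\<And>i. i < degree q \<Longrightarrow> poly q (r i) = 0"
    and "\<And>c. poly q c \<noteq> 0 \<Longrightarrow> poly (pderiv q) c = poly q c * (\<Sum>i<degree q. 1 / (c - r i))"
proof -
  obtain r where r: "smult (lead_coeff q) (\<Prod>i<degree q. [:-r i, 1:]) = q"
    by (rule complex_poly_decompose')
  have val: "poly q t = lead_coeff q * (\<Prod>i<degree q. t - r i)" for t
    by (subst r[symmetric]) (simp add: poly_prod)
  \<comment> \<open>The logarithmic derivative of a product. \<open>mixed_stable\<close> uses the
    sign of its real part, \<open>mixed_exp_bound\<close> its value at 0.\<close>
  have "poly (pderiv q) c = poly q c * (\<Sum>i<degree q. 1 / (c - r i))" if nz: "poly q c \<noteq> 0" for c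
  proof -
    have rnz: "c - r i \<noteq> 0" if "i < degree q" for i
      using nz that unfolding val by auto
    have "poly (pderiv q) c = lead_coeff q * (\<Sum>i<degree q. \<Prod>j\<in>{..<degree q} - {i}. c - r j)"
      by (subst r[symmetric]) (simp add: pderiv_smult pderiv_prod poly_sum poly_prod pderiv_pCons)
    also have "(\<Sum>i<degree q. \<Prod>j\<in>{..<degree q} - {i}. c - r j)
        = (\<Sum>i<degree q. (\<Prod>j<degree q. c - r j) * (1 / (c - r i)))"
    proof (rule sum.cong[OF refl])
      fix i assume i: "i \<in> {..<degree q}"
      have "(\<Prod>j<degree q. c - r j) = (c - r i) * (\<Prod>j\<in>{..<degree q} - {i}. c - r j)"
        using i by (subst prod.remove[of _ i]) auto
      then show "(\<Prod>j\<in>{..<degree q} - {i}. c - r j) = (\<Prod>j<degree q. c - r j) * (1 / (c - r i))"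
        using rnz i by simp
    qed
    also have "lead_coeff q * \<dots> = poly q c * (\<Sum>i<degree q. 1 / (c - r i))"
      by (simp add: val[of c] sum_distrib_left mult.assoc)
    finally show ?thesis .
  qed
  moreover have "poly q (r i) = 0" if "i < degree q" for i
    unfolding val using that by auto
  ultimately show ?thesis using that val by blast
qed

text \<open>\<open>mixed a S K R\<close> is the mixed partial derivative along the columns in \<open>K\<close> of the product of
  the linear forms given by the rows in \<open>R\<close>.\<close>

fun mixed :: "('r \<Rightarrow> 'c \<Rightarrow> 'a::comm_ring_1) \<Rightarrow> 'c set \<Rightarrow> 'c list \<Rightarrow> 'r set \<Rightarrow> ('c \<Rightarrow> 'a) \<Rightarrow> 'a" where
  "mixed a S [] R z = (\<Prod>i\<in>R. \<Sum>s\<in>S. a i s * z s)"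
| "mixed a S (k # K) R z = (\<Sum>i\<in>R. a i k * mixed a S K (R - {i}) z)"

lemma mixed_scale:
  assumes "finite R" "length K \<le> card R"
  shows "mixed a S K R (\<lambda>s. c * z s) = c ^ (card R - length K) * mixed a S K R z"
  using assms
proof (induction K arbitrary: R)
  case Nil
  have "(\<Prod>i\<in>R. \<Sum>s\<in>S. a i s * (c * z s)) = (\<Prod>i\<in>R. c * (\<Sum>s\<in>S. a i s * z s))"
    by (simp add: sum_distrib_left mult.left_commute)
  then show ?case by (simp add: prod.distrib)
next
  case (Cons k K)
  have "mixed a S K (R - {i}) (\<lambda>s. c * z s) = c ^ (card R - length (k # K)) * mixed a S K (R - {i}) z"
    if "i \<in> R" for i
    using Cons.IH[of "R - {i}"] Cons.prems that by (auto simp: card_Diff_singleton)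
  then show ?case by (simp add: sum_distrib_left mult.left_commute)
qed

lemma mixed_of_real:
  "mixed (\<lambda>i s. of_real (a i s)) S K R (\<lambda>s. of_real (x s)) = (of_real (mixed a S K R x) :: complex)"
  by (induction K arbitrary: R) auto

lemma mixed_pos:
  fixes a :: "'r \<Rightarrow> 'c \<Rightarrow> real"
  assumes "\<And>i s. 0 < a i s" "finite S" "finite R" "length K \<le> card R"
    "\<And>s. s \<in> S \<Longrightarrow> 0 \<le> x s" "s0 \<in> S" "0 < x s0"
  shows "0 < mixed a S K R x"
  using assms(3,4)
proof (induction K arbitrary: R)
  case Nil
  have "0 < (\<Sum>s\<in>S. a i s * x s)" for i
    using assms by (intro sum_pos2[of _ s0]) (auto intro!: mult_nonneg_nonneg simp: less_imp_le)
  then show ?case by (auto intro: prod_pos)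
next
  case (Cons k K)
  have "R \<noteq> {}" using Cons.prems by auto
  moreover have "0 < mixed a S K (R - {i}) x" if "i \<in> R" for i
    using Cons.IH[of "R - {i}"] Cons.prems that by (auto simp: card_Diff_singleton)
  ultimately show ?case using Cons.prems assms(1) by (auto intro!: sum_pos)
qed

lemma mixed_deriv:
  fixes a :: "'r \<Rightarrow> 'c \<Rightarrow> 'a::real_normed_field"
  assumes "finite S" "finite R" "k \<in> S"
  shows "((\<lambda>t. mixed a S K R (z(k := t))) has_field_derivative mixed a S (k # K) R (z(k := t))) (at t)"
  using assms(2)
proof (induction K arbitrary: R)
  case Nil
  have lin: "((\<lambda>t. \<Sum>s\<in>S. a i s * (z(k := t)) s) has_field_derivative a i k) (at t)" for i
  proof -
    have "(\<lambda>t. \<Sum>s\<in>S. a i s * (z(k := t)) s) = (\<lambda>t. a i k * t + (\<Sum>s\<in>S - {k}. a i s * z s))"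
      using assms by (auto simp: sum.remove[of S k] intro!: ext sum.cong)
    then show ?thesis by (auto intro!: derivative_eq_intros)
  qed
  have "((\<lambda>t. \<Prod>i\<in>R. \<Sum>s\<in>S. a i s * (z(k := t)) s) has_field_derivative
     (\<Sum>i\<in>R. a i k * (\<Prod>i\<in>R - {i}. \<Sum>s\<in>S. a i s * (z(k := t)) s))) (at t)"
    using has_field_derivative_prod[where A = R, OF lin] by simp
  then show ?case by simp
next
  case (Cons k' K)
  have "((\<lambda>t. \<Sum>i\<in>R. a i k' * mixed a S K (R - {i}) (z(k := t))) has_field_derivative
     (\<Sum>i\<in>R. a i k' * mixed a S (k # K) (R - {i}) (z(k := t)))) (at t)"
    using Cons.prems by (intro DERIV_sum DERIV_cmult Cons.IH finite_Diff)
  \<comment> \<open>The induction hypothesis differentiates along \<open>k\<close> after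
    \<open>k'\<close>. Partial derivatives commute: exchanging the two sums over rows brings
    \<open>k\<close> to the front.\<close>
  moreover have "(\<Sum>i\<in>R. a i k' * mixed a S (k # K) (R - {i}) (z(k := t)))
      = mixed a S (k # k' # K) R (z(k := t))"
  proof -
    let ?f = "\<lambda>i j. a i k' * (a j k * mixed a S K (R - {i} - {j}) (z(k := t)))"
    have "(\<Sum>i\<in>R. a i k' * mixed a S (k # K) (R - {i}) (z(k := t)))
        = (\<Sum>i\<in>R. \<Sum>j\<in>R - {i}. ?f i j)"
      by (simp add: sum_distrib_left)
    also have "\<dots> = (\<Sum>i\<in>R. \<Sum>j | j \<in> R \<and> j \<noteq> i. ?f i j)"
      by (intro sum.cong) auto
    also have "\<dots> = (\<Sum>j\<in>R. \<Sum>i | i \<in> R \<and> j \<noteq> i. ?f i j)"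
      by (rule sum.swap_restrict) (use Cons.prems in auto)
    also have "\<dots> = (\<Sum>j\<in>R. \<Sum>i\<in>R - {j}. a j k * (a i k' * mixed a S K (R - {j} - {i}) (z(k := t))))"
    proof (intro sum.cong refl)
      fix j i
      have "R - {i} - {j} = R - {j} - {i}" by auto
      then show "?f i j = a j k * (a i k' * mixed a S K (R - {j} - {i}) (z(k := t)))"
        by (simp only: mult.left_commute)
    qed auto
    finally show ?thesis by (simp add: sum_distrib_left)
  qed
  ultimately show ?case by (simp del: fun_upd_apply)
qed

text \<open>By homogeneity, the coefficient in the highest possible degree is the value at the unit
  vector of \<open>k\<close>. For positive \<open>a\<close> that value is positive, so
  \<open>mixed_poly_degree\<close> gets the exact degree.\<close>

lemma mixed_poly:
  assumes "finite S" "finite R" "k \<in> S" "length K \<le> card R"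
  shows "\<exists>q. (\<forall>t. poly q t = mixed a S K R (z(k := t))) \<and> degree q \<le> card R - length K
    \<and> coeff q (card R - length K) = mixed a S K R (\<lambda>s. of_bool (s = k))"
  using assms(2,4)
proof (induction K arbitrary: R)
  case Nil
  have lin: "(\<Sum>s\<in>S. a i s * (z(k := t)) s) = poly [:\<Sum>s\<in>S - {k}. a i s * z s, a i k:] t" for i t
    using assms(1,3) by (auto simp: sum.remove[of S k] mult.commute intro!: sum.cong)
  have ind: "(\<Sum>s\<in>S. a i s * of_bool (s = k)) = a i k" for i
    using assms(1,3) by (simp add: sum.remove[of S k] of_bool_def)
  have "degree (\<Prod>i\<in>R. [:\<Sum>s\<in>S - {k}. a i s * z s, a i k:]) \<le> card R \<and>
    coeff (\<Prod>i\<in>R. [:\<Sum>s\<in>S - {k}. a i s * z s, a i k:]) (card R) = (\<Prod>i\<in>R. a i k)"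
    using Nil.prems(1)
  proof (induction R rule: finite_induct)
    case (insert i R)
    let ?l = "[:\<Sum>s\<in>S - {k}. a i s * z s, a i k:]" and ?p = "\<Prod>i\<in>R. [:\<Sum>s\<in>S - {k}. a i s * z s, a i k:]"
    have l: "degree ?l \<le> 1" by (simp)
    have "degree (?l * ?p) \<le> degree ?l + degree ?p" by (rule degree_mult_le)
    also have "\<dots> \<le> 1 + card R" using insert.IH l by (intro add_mono) auto
    finally have "degree (?l * ?p) \<le> 1 + card R" .
    moreover have "coeff (?l * ?p) (Suc (card R)) = a i k * (\<Prod>i\<in>R. a i k)"
      using insert.IH by (simp add: coeff_eq_0)
    ultimately show ?case using insert by simp
  qed simp
  then show ?case
    by (intro exI[of _ "\<Prod>i\<in>R. [:\<Sum>s\<in>S - {k}. a i s * z s, a i k:]"])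
      (simp del: fun_upd_apply add: lin ind poly_prod)
next
  case (Cons k' K)
  have "\<exists>q. (\<forall>t. poly q t = mixed a S K (R - {i}) (z(k := t))) \<and> degree q \<le> card R - length (k' # K)
    \<and> coeff q (card R - length (k' # K)) = mixed a S K (R - {i}) (\<lambda>s. of_bool (s = k))" if "i \<in> R" for i
    using Cons.IH[of "R - {i}"] Cons.prems that by (simp add: card_Diff_singleton del: fun_upd_apply)
  then obtain q where q: "\<And>i t. i \<in> R \<Longrightarrow> poly (q i) t = mixed a S K (R - {i}) (z(k := t))"
    "\<And>i. i \<in> R \<Longrightarrow> degree (q i) \<le> card R - length (k' # K)"
    "\<And>i. i \<in> R \<Longrightarrow> coeff (q i) (card R - length (k' # K)) = mixed a S K (R - {i}) (\<lambda>s. of_bool (s = k))"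
    by metis
  show ?case
    using q Cons.prems
    by (intro exI[of _ "\<Sum>i\<in>R. smult (a i k') (q i)"])
      (auto simp del: fun_upd_apply simp: poly_sum coeff_sum intro!: degree_sum_le order.trans[OF degree_smult_le])
qed

section \<open>Zero-free half spaces and the capacity inequality\<close>

definition half_space :: "'c set \<Rightarrow> ('c \<Rightarrow> complex) \<Rightarrow> bool" where
  "half_space S z \<longleftrightarrow> (\<forall>s\<in>S. 0 \<le> Re (z s)) \<and> (\<exists>s\<in>S. 0 < Re (z s))"

lemma of_real_of_bool_eq: "complex_of_real (of_bool b) = of_bool b"
  by simp

lemma mixed_poly_degree:
  fixes a :: "'r \<Rightarrow> 'c \<Rightarrow> real"
  assumes "\<And>i s. 0 < a i s" "finite S" "finite R" "k \<in> S" "length K \<le> card R"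
  obtains q where "\<And>t. poly q t = mixed (\<lambda>i s. complex_of_real (a i s)) S K R (z(k := t))"
    and "degree q = card R - length K"
proof -
  let ?c = "\<lambda>i s. complex_of_real (a i s)"
  obtain q where q: "\<And>t. poly q t = mixed ?c S K R (z(k := t))" "degree q \<le> card R - length K"
    "coeff q (card R - length K) = mixed ?c S K R (\<lambda>s. of_bool (s = k))"
    using mixed_poly[OF assms(2-5), of ?c z] by blast
  have "0 < mixed a S K R (\<lambda>s. of_bool (s = k))"
    using assms by (intro mixed_pos[where ?s0.0 = k]) auto
  moreover have "mixed ?c S K R (\<lambda>s. of_bool (s = k))
      = of_real (mixed a S K R (\<lambda>s. of_bool (s = k)))"
    using mixed_of_real[of a S K R "\<lambda>s. of_bool (s = k)"] by (simp only: of_real_of_bool_eq)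
  ultimately have "coeff q (card R - length K) \<noteq> 0"
    using q(3) by simp
  then have "degree q = card R - length K"
    using q(2) le_degree by (metis le_antisym)
  then show ?thesis using q that by blast
qed

lemma Re_inverse_pos: "0 < Re w \<Longrightarrow> 0 < Re (1 / w)"
  by (auto simp: Re_divide intro!: divide_pos_pos add_pos_nonneg)

text \<open>A Gauss-Lucas argument. All roots along the line in direction \<open>k\<close> lie
  strictly to the left of \<open>z k\<close>, since otherwise moving coordinate \<open>k\<close> to
  such a root would stay in the half space and contradict the induction hypothesis. Hence every
  summand of the logarithmic derivative at \<open>z k\<close> has positive real part. The half
  planes are closed, with one strict coordinate, because the capacity argument evaluates at points
  whose coordinates in \<open>K\<close> are 0.\<close>

lemma mixed_stable:
  fixes a :: "'r \<Rightarrow> 'c \<Rightarrow> real"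
  assumes "\<And>i s. 0 < a i s" "finite S" "finite R" "length K \<le> card R" "set K \<subseteq> S" "half_space S z"
  shows "mixed (\<lambda>i s. complex_of_real (a i s)) S K R z \<noteq> 0"
  using assms(4-)
proof (induction K arbitrary: z)
  case Nil
  obtain s0 where s0: "s0 \<in> S" "0 < Re (z s0)" "\<And>s. s \<in> S \<Longrightarrow> 0 \<le> Re (z s)"
    using Nil by (auto simp: half_space_def)
  have "0 < Re (\<Sum>s\<in>S. complex_of_real (a i s) * z s)" for i
    using s0 assms(1,2) by (auto intro!: sum_pos2[of _ s0] mult_nonneg_nonneg simp: less_imp_le)
  then have "(\<Sum>s\<in>S. complex_of_real (a i s) * z s) \<noteq> 0" for i
    by (metis less_irrefl zero_complex.sel(1))
  then show ?case using assms(3) by simp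
next
  case (Cons k K)
  let ?c = "\<lambda>i s. complex_of_real (a i s)"
  have k: "k \<in> S" and len: "length K \<le> card R" "0 < card R - length K" using Cons.prems by auto
  obtain q where q: "\<And>t. poly q t = mixed ?c S K R (z(k := t))" "degree q = card R - length K"
    by (rule mixed_poly_degree[where a = a and z = z, OF assms(1-3) k len(1)]) (rule that)
  obtain r where r: "\<And>i. i < degree q \<Longrightarrow> poly q (r i) = 0"
    "\<And>c. poly q c \<noteq> 0 \<Longrightarrow> poly (pderiv q) c = poly q c * (\<Sum>i<degree q. 1 / (c - r i))"
    by (rule complex_poly_linear_factors[of q]) (rule that)
  have Re_r: "Re (r i) < Re (z k)" if "i < degree q" for i
  proof (rule ccontr)
    assume "\<not> Re (r i) < Re (z k)"
    then have *: "Re (z k) \<le> Re (r i)" by simp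
    obtain s0 where s0: "s0 \<in> S" "0 < Re (z s0)" "\<And>s. s \<in> S \<Longrightarrow> 0 \<le> Re (z s)"
      using Cons.prems by (auto simp: half_space_def)
    have "0 < Re ((z(k := r i)) s0)" using s0(2) * by (cases "s0 = k") auto
    moreover have "0 \<le> Re ((z(k := r i)) s)" if "s \<in> S" for s
      using s0(3)[OF that] * by (cases "s = k") auto
    ultimately have "half_space S (z(k := r i))"
      using s0(1) unfolding half_space_def by blast
    then show False using Cons.IH[of "z(k := r i)"] Cons.prems len r(1)[OF that] q(1)
      by (simp del: fun_upd_apply)
  qed
  have nz: "poly q (z k) \<noteq> 0"
    using Cons.IH[of z] Cons.prems len q(1) by simp
  have "0 < Re (\<Sum>i<degree q. 1 / (z k - r i))"
    using Re_r len(2) q(2) unfolding Re_sum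
    by (intro sum_pos) (auto intro!: Re_inverse_pos simp: lessThan_empty_iff)
  then have "(\<Sum>i<degree q. 1 / (z k - r i)) \<noteq> 0"
    by (metis less_irrefl zero_complex.sel(1))
  then have "poly (pderiv q) (z k) \<noteq> 0" using r(2)[OF nz] nz by simp
  moreover have "poly (pderiv q) (z k) = mixed ?c S (k # K) R (z(k := z k))"
  proof (rule DERIV_unique)
    show "((\<lambda>t. poly q t) has_field_derivative poly (pderiv q) (z k)) (at (z k))" by (rule poly_DERIV)
    show "((\<lambda>t. poly q t) has_field_derivative mixed ?c S (k # K) R (z(k := z k))) (at (z k))"
      unfolding q(1) by (rule mixed_deriv[OF assms(2,3) k])
  qed
  ultimately show ?case by simp
qed

text \<open>Roots of the restriction to a coordinate line are negative reals: otherwise a rotation of the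
  argument, harmless by homogeneity, would bring a zero into the half space.\<close>

lemma mixed_exp_bound:
  fixes a :: "'r \<Rightarrow> 'c \<Rightarrow> real"
  assumes "\<And>i s. 0 < a i s" "finite S" "finite R" "length K \<le> card R" "set K \<subseteq> S" "k \<in> S"
    and x: "\<And>s. s \<in> S \<Longrightarrow> 0 \<le> x s" "x k = 0" "s0 \<in> S" "0 < x s0" and "0 \<le> t"
  shows "mixed a S K R (x(k := t))
    \<le> mixed a S K R x * exp (t * (mixed a S (k # K) R x / mixed a S K R x))"
proof -
  let ?c = "\<lambda>i s. complex_of_real (a i s)"
  let ?z = "\<lambda>s. complex_of_real (x s)"
  have upd: "?z(k := complex_of_real u) = (\<lambda>s. complex_of_real ((x(k := u)) s))" for u by auto
  have xk: "x(k := 0) = x" using x(2) by auto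
  obtain q where q: "\<And>t. poly q t = mixed ?c S K R (?z(k := t))" "degree q = card R - length K"
    by (rule mixed_poly_degree[where a = a and z = ?z, OF assms(1-3) \<open>k \<in> S\<close> assms(4)]) (rule that)
  obtain r where r: "\<And>t. poly q t = lead_coeff q * (\<Prod>i<degree q. t - r i)"
    "\<And>i. i < degree q \<Longrightarrow> poly q (r i) = 0"
    "\<And>c. poly q c \<noteq> 0 \<Longrightarrow> poly (pderiv q) c = poly q c * (\<Sum>i<degree q. 1 / (c - r i))"
    by (rule complex_poly_linear_factors[of q]) (rule that)
  have qr: "poly q (of_real u) = of_real (mixed a S K R (x(k := u)))" for u
    unfolding q(1) upd by (rule mixed_of_real)
  have F0: "0 < mixed a S K R x"
    using assms by (intro mixed_pos[where ?s0.0 = s0]) auto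
  have q0: "poly q 0 = of_real (mixed a S K R x)" using qr[of 0] xk by simp
  have real_neg: "Im (r i) = 0 \<and> Re (r i) < 0" if i: "i < degree q" for i
  proof (rule ccontr)
    assume H: "\<not> (Im (r i) = 0 \<and> Re (r i) < 0)"
    \<comment> \<open>In the second case \<open>c\<close> rotates the root onto the imaginary axis,
      \<open>Re (c * r i) = 0\<close>, while \<open>Re c\<close> stays positive because the root is
      not real.\<close>
    define c where "c = (if 0 \<le> Re (r i) then 1 else Complex \<bar>Im (r i)\<bar> (sgn (Im (r i)) * Re (r i)))"
    have c: "0 < Re c" "0 \<le> Re (c * r i)"
      using H by (auto simp: c_def sgn_if)
    have "half_space S (\<lambda>s. c * (?z(k := r i)) s)"
      unfolding half_space_def
    proof (intro conjI ballI bexI[of _ s0])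
      show "0 < Re (c * (?z(k := r i)) s0)" using c x by auto
      show "0 \<le> Re (c * (?z(k := r i)) s)" if "s \<in> S" for s
        using c x(1)[OF that] by auto
    qed (use x in auto)
    then have "mixed ?c S K R (\<lambda>s. c * (?z(k := r i)) s) \<noteq> 0"
      using assms by (intro mixed_stable) auto
    then have "mixed ?c S K R (?z(k := r i)) \<noteq> 0"
      using assms by (subst (asm) mixed_scale) auto
    then show False using r(2)[OF i] q(1) by simp
  qed
  define \<rho> where "\<rho> i = - Re (r i)" for i
  have \<rho>: "0 < \<rho> i" "r i = - complex_of_real (\<rho> i)" if "i < degree q" for i
    using real_neg[OF that] by (auto simp: \<rho>_def complex_eq_iff)
  have "mixed a S K R (x(k := t)) = mixed a S K R x * (\<Prod>i<degree q. 1 + t / \<rho> i)"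
  proof -
    have "of_real (mixed a S K R (x(k := t))) = lead_coeff q * (\<Prod>i<degree q. of_real t - r i)"
      unfolding qr[symmetric] by (rule r(1))
    also have "(\<Prod>i<degree q. of_real t - r i)
        = (\<Prod>i<degree q. (0 - r i) * (1 + of_real t / of_real (\<rho> i)))"
    proof (rule prod.cong[OF refl])
      fix i assume "i \<in> {..<degree q}"
      then have "i < degree q" by simp
      note \<rho>[OF this]
      then show "of_real t - r i = (0 - r i) * (1 + of_real t / of_real (\<rho> i))"
        by (simp add: field_simps)
    qed
    also have "lead_coeff q * \<dots> = poly q 0 * (\<Prod>i<degree q. 1 + of_real t / of_real (\<rho> i))"
      by (subst r(1)) (simp only: prod.distrib mult.assoc)
    also have "\<dots> = of_real (mixed a S K R x * (\<Prod>i<degree q. 1 + t / \<rho> i))"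
      by (simp add: q0)
    finally show ?thesis using of_real_eq_iff by blast
  qed
  moreover have "mixed a S (k # K) R x = mixed a S K R x * (\<Sum>i<degree q. 1 / \<rho> i)"
  proof -
    have "poly (pderiv q) 0 = mixed ?c S (k # K) R (?z(k := 0))"
    proof (rule DERIV_unique)
      show "((\<lambda>t. poly q t) has_field_derivative poly (pderiv q) 0) (at 0)" by (rule poly_DERIV)
      show "((\<lambda>t. poly q t) has_field_derivative mixed ?c S (k # K) R (?z(k := 0))) (at 0)"
        unfolding q(1) by (rule mixed_deriv[OF assms(2,3,6)])
    qed
    also have "?z(k := 0) = ?z" using x(2) by auto
    also have "mixed ?c S (k # K) R ?z = of_real (mixed a S (k # K) R x)" by (rule mixed_of_real)
    finally have "of_real (mixed a S (k # K) R x) = poly q 0 * (\<Sum>i<degree q. 1 / (0 - r i))"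
      using r(3)[of 0] q0 F0 by simp
    also have "(\<Sum>i<degree q. 1 / (0 - r i)) = of_real (\<Sum>i<degree q. 1 / \<rho> i)"
      using \<rho> by (auto intro!: sum.cong)
    also have "poly q 0 * \<dots> = of_real (mixed a S K R x * (\<Sum>i<degree q. 1 / \<rho> i))"
      by (simp add: q0)
    finally show ?thesis using of_real_eq_iff by blast
  qed
  moreover have "(\<Prod>i<degree q. 1 + t / \<rho> i) \<le> exp (t * (\<Sum>i<degree q. 1 / \<rho> i))"
  proof -
    have "(\<Prod>i<degree q. 1 + t / \<rho> i) \<le> (\<Prod>i<degree q. exp (t / \<rho> i))"
      using \<rho> \<open>0 \<le> t\<close> by (intro prod_mono) (auto intro!: exp_ge_add_one_self add_nonneg_nonneg divide_nonneg_pos)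
    then show ?thesis by (simp add: exp_sum sum_distrib_left)
  qed
  ultimately show ?thesis using F0 by simp
qed

text \<open>Gurvits' induction: differentiating along one column and setting its variable to 0 costs
  at most a factor \<open>exp 1\<close>. With \<open>f\<close> and \<open>f'\<close> the value and
  the derivative at 0, the induction hypothesis is a linear lower bound in \<open>t\<close> for a
  function that \<open>mixed_exp_bound\<close> bounds above by
  \<open>f * exp (t * f' / f)\<close>.\<close>

lemma mixed_capacity:
  fixes a :: "'r \<Rightarrow> 'c \<Rightarrow> real"
  assumes "\<And>i s. 0 < a i s" "finite S" "finite R" "card R = card S" "0 \<le> c"
    and cap: "\<And>x. (\<And>s. s \<in> S \<Longrightarrow> 0 < x s) \<Longrightarrow> c * (\<Prod>s\<in>S. x s) \<le> mixed a S [] R x"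
    and "distinct K" "set K \<subseteq> S" "\<And>s. s \<in> S - set K \<Longrightarrow> 0 < x s" "\<And>s. s \<in> set K \<Longrightarrow> x s = 0"
  shows "c * exp (- real (length K)) * (\<Prod>s\<in>S - set K. x s) \<le> mixed a S K R x"
  using assms(7-)
proof (induction K arbitrary: x)
  case Nil
  then show ?case using cap[of x] by simp
next
  case (Cons k K)
  define P where "P = (\<Prod>s\<in>S - set (k # K). x s)"
  have k: "k \<in> S" "k \<notin> set K" "x k = 0" using Cons.prems by auto
  have P: "0 < P" unfolding P_def using Cons.prems by (intro prod_pos) auto
  have IH: "c * exp (- real (length K)) * (t * P) \<le> mixed a S K R (x(k := t))" if "0 < t" for t
  proof -
    have "S - set K = insert k (S - set (k # K))" using k by auto
    then have "(\<Prod>s\<in>S - set K. (x(k := t)) s) = (\<Prod>s\<in>insert k (S - set (k # K)). (x(k := t)) s)"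
      by (simp only:)
    also have "\<dots> = t * (\<Prod>s\<in>S - set (k # K). (x(k := t)) s)"
      using assms(2) by (subst prod.insert) auto
    also have "(\<Prod>s\<in>S - set (k # K). (x(k := t)) s) = P"
      unfolding P_def by (intro prod.cong) auto
    finally have "(\<Prod>s\<in>S - set K. (x(k := t)) s) = t * P" .
    moreover have "c * exp (- real (length K)) * (\<Prod>s\<in>S - set K. (x(k := t)) s) \<le> mixed a S K R (x(k := t))"
      using Cons.prems that by (intro Cons.IH) auto
    ultimately show ?thesis by simp
  qed
  have "card (set (k # K)) \<le> card S" using Cons.prems assms(2) by (intro card_mono) auto
  then have len: "length (k # K) \<le> card R"
    using Cons.prems(1) assms(4) by (simp only: distinct_card)
  show ?case
  proof (cases "S = set (k # K)")
    \<comment> \<open>For the last column all of \<open>x\<close> vanishes, so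
      \<open>mixed_exp_bound\<close> has no positive coordinate to work with. But the function is
      then linear in the single remaining variable, and its derivative is its value at 1.\<close>
    case True
    then have lenR: "card R = Suc (length K)"
      using Cons.prems(1) assms(4) by (simp add: distinct_card)
    have x0: "x s = 0" if "s \<in> S" for s using that True Cons.prems by auto
    have P1: "P = 1" unfolding P_def True by simp
    define f where "f = mixed a S K R (\<lambda>s. of_bool (s = k))"
    have ft: "mixed a S K R ((\<lambda>s. 0)(k := t)) = t * f" for t
    proof -
      have "(\<lambda>s. 0)(k := t) = (\<lambda>s. t * of_bool (s = k))" by auto
      then show ?thesis
        using mixed_scale[of R K a S t "\<lambda>s. of_bool (s = k)"] assms(3) lenR by (simp add: f_def)
    qed
    have cong: "mixed a S L R' x = mixed a S L R' (\<lambda>s. 0)" for L R'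
      using x0 by (induction L arbitrary: R') auto
    have "((\<lambda>t. mixed a S K R ((\<lambda>s. 0)(k := t))) has_field_derivative
        mixed a S (k # K) R ((\<lambda>s. 0)(k := 0))) (at 0)"
      by (rule mixed_deriv[OF assms(2,3) k(1)])
    then have "((\<lambda>t. t * f) has_field_derivative mixed a S (k # K) R (\<lambda>s. 0)) (at 0)"
      unfolding ft by (simp add: fun_upd_idem)
    moreover have "((\<lambda>t. t * f) has_field_derivative f) (at 0)"
      by (auto intro!: derivative_eq_intros)
    ultimately have f: "mixed a S (k # K) R x = f"
      unfolding cong by (rule DERIV_unique)
    have "c * exp (- real (length (k # K))) * P \<le> c * exp (- real (length K)) * (1 * P)"
      using P1 assms(5) by (simp add: mult_left_mono)
    also have "\<dots> \<le> mixed a S K R (x(k := 1))" by (rule IH) simp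
    also have "mixed a S K R (x(k := 1)) = f"
    proof -
      have "mixed a S L R' (x(k := 1)) = mixed a S L R' (\<lambda>s. of_bool (s = k))" for L R'
        using x0 by (induction L arbitrary: R') (auto intro!: prod.cong sum.cong)
      then show ?thesis by (simp add: f_def)
    qed
    finally show ?thesis using f P_def by simp
  next
    case False
    then obtain s0 where s0: "s0 \<in> S" "s0 \<notin> set (k # K)" using Cons.prems by auto
    have xn: "0 \<le> x s" if "s \<in> S" for s
      using Cons.prems(3)[of s] Cons.prems(4)[of s] that by (cases "s \<in> set (k # K)") auto
    have xs0: "0 < x s0" using s0 Cons.prems(3) by auto
    define f f' where "f = mixed a S K R x" and "f' = mixed a S (k # K) R x"
    have f: "0 < f" unfolding f_def
      using assms len xn s0 xs0 by (intro mixed_pos[where ?s0.0 = s0]) auto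
    have f': "0 < f'" unfolding f'_def
      using assms len xn s0 xs0 by (intro mixed_pos[where ?s0.0 = s0]) auto
    \<comment> \<open>This choice minimises \<open>exp (t * f' / f) / t\<close> and makes the
      exponent equal to 1.\<close>
    define t where "t = f / f'"
    have t: "0 < t" using f f' by (simp add: t_def)
    have "c * exp (- real (length K)) * (t * P) \<le> mixed a S K R (x(k := t))" by (rule IH[OF t])
    also have "\<dots> \<le> f * exp (t * (f' / f))"
      unfolding f_def f'_def
      using assms len xn s0 xs0 k t Cons.prems by (intro mixed_exp_bound[where ?s0.0 = s0]) auto
    also have "t * (f' / f) = 1" using f f' by (simp add: t_def)
    also have "f * exp 1 = t * (f' * exp 1)" using f' by (simp add: t_def)
    finally have "c * exp (- real (length K)) * P \<le> f' * exp 1"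
      using t by (simp add: mult.left_commute)
    then have "c * exp (- real (length K)) * P * exp (-1) \<le> f'"
      by (simp add: exp_minus field_simps)
    moreover have "exp (- real (length (k # K))) = exp (- real (length K)) * exp (-1)"
      by (simp flip: exp_add)
    ultimately show ?thesis unfolding f'_def P_def
      by (simp only: mult_ac)
  qed
qed

section \<open>Permanents, entropy and the number of perfect matchings\<close>

definition matchings :: "'r set \<Rightarrow> 'c set \<Rightarrow> ('r \<Rightarrow> 'c \<Rightarrow> bool) \<Rightarrow> ('r \<Rightarrow> 'c) set" where
  "matchings R S P = {\<sigma> \<in> R \<rightarrow>\<^sub>E S. bij_betw \<sigma> R S \<and> (\<forall>i\<in>R. P i (\<sigma> i))}"

lemma finite_matchings: "finite R \<Longrightarrow> finite S \<Longrightarrow> finite (matchings R S P)"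
  unfolding matchings_def by (rule finite_subset[of _ "R \<rightarrow>\<^sub>E S"]) (auto intro: finite_PiE)

text \<open>With as many columns as rows, \<open>mixed\<close> is the permanent of the 0-1 matrix,
  expanded column by column: a matching of the minor without row \<open>i\<close> and column
  \<open>k\<close> is completed by \<open>i \<mapsto> k\<close>, and \<open>i\<close> can be
  recovered as the row sent to \<open>k\<close>.\<close>

lemma mixed_le_card_matchings:
  assumes "finite R" "distinct K" "length K = card R"
  shows "mixed (\<lambda>i s. of_bool (P i s)) S K R x \<le> real (card (matchings R (set K) P))"
  using assms
proof (induction K arbitrary: R)
  case Nil
  then have "R = {}" by simp
  moreover have "matchings {} {} P = {\<lambda>_. undefined}" by (auto simp: matchings_def bij_betw_def)
  ultimately show ?case by simp
next
  case (Cons k K)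
  have "mixed (\<lambda>i s. of_bool (P i s)) S (k # K) R x
      = (\<Sum>i\<in>{i\<in>R. P i k}. mixed (\<lambda>i s. of_bool (P i s)) S K (R - {i}) x)"
    using Cons.prems(1) by (simp add: of_bool_def if_distrib[of "\<lambda>u. u * _"] sum.If_cases Int_def cong: if_cong)
  also have "\<dots> \<le> (\<Sum>i\<in>{i\<in>R. P i k}. real (card (matchings (R - {i}) (set K) P)))"
    using Cons by (intro sum_mono Cons.IH) (auto simp: card_Diff_singleton)
  also have "\<dots> = real (card (SIGMA i:{i\<in>R. P i k}. matchings (R - {i}) (set K) P))"
    using Cons.prems by (subst card_SigmaI) (auto intro: finite_matchings)
  also have "\<dots> \<le> real (card (matchings R (set (k # K)) P))"
  proof (rule of_nat_mono, rule card_inj_on_le)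
    let ?g = "\<lambda>(i, \<sigma>). \<sigma>(i := k)"
    have k: "k \<notin> set K" using Cons.prems by auto
    show "inj_on ?g (SIGMA i:{i\<in>R. P i k}. matchings (R - {i}) (set K) P)"
    proof (rule inj_onI, clarify)
      fix i \<sigma> j \<tau>
      assume A: "i \<in> R" "j \<in> R" "\<sigma> \<in> matchings (R - {i}) (set K) P" "\<tau> \<in> matchings (R - {j}) (set K) P"
        and eq: "\<sigma>(i := k) = \<tau>(j := k)"
      have ij: "i = j"
      proof (rule ccontr)
        assume "i \<noteq> j"
        then have "\<tau> i = k" using fun_cong[OF eq, of i] by simp
        moreover have "\<tau> i \<in> set K" using A \<open>i \<noteq> j\<close> by (auto simp: matchings_def PiE_iff)
        ultimately show False using k by simp
      qed
      have "\<sigma> u = \<tau> u" for u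
      proof (cases "u = i")
        case True
        then show ?thesis using A ij by (auto simp: matchings_def PiE_iff extensional_def)
      next
        case False
        then show ?thesis using fun_cong[OF eq, of u] ij by simp
      qed
      then show "i = j \<and> \<sigma> = \<tau>" using ij by auto
    qed
    show "?g ` (SIGMA i:{i\<in>R. P i k}. matchings (R - {i}) (set K) P) \<subseteq> matchings R (set (k # K)) P"
    proof clarify
      fix i \<sigma> assume i: "i \<in> R" "P i k" and \<sigma>: "\<sigma> \<in> matchings (R - {i}) (set K) P"
      have bij: "bij_betw \<sigma> (R - {i}) (set K)" using \<sigma> by (simp add: matchings_def)
      have "bij_betw (\<sigma>(i := k)) (R - {i}) (set K)"
        using bij by (subst bij_betw_cong[where g = \<sigma>]) auto
      then have "bij_betw (\<sigma>(i := k)) (insert i (R - {i})) (insert k (set K))"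
        using notIn_Un_bij_betw[of i "R - {i}" "\<sigma>(i := k)" "set K"] k
        by (simp del: insert_Diff_single)
      moreover have "insert i (R - {i}) = R" using i by auto
      ultimately have "bij_betw (\<sigma>(i := k)) R (set (k # K))" by simp
      then show "\<sigma>(i := k) \<in> matchings R (set (k # K)) P"
        using \<sigma> i by (auto simp: matchings_def PiE_iff extensional_def)
    qed
    show "finite (matchings R (set (k # K)) P)" using Cons.prems by (auto intro: finite_matchings)
  qed
  finally show ?case .
qed

text \<open>This is the weighted AM-GM inequality, applied to each row.\<close>

lemma entropy_capacity:
  fixes w :: "'r \<Rightarrow> 'c \<Rightarrow> real"
  assumes "finite R" "finite S" and nonneg: "\<And>i s. i \<in> R \<Longrightarrow> s \<in> S \<Longrightarrow> 0 \<le> w i s"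
    and row: "\<And>i. i \<in> R \<Longrightarrow> (\<Sum>s\<in>S. w i s) = 1"
    and col: "\<And>s. s \<in> S \<Longrightarrow> (\<Sum>i\<in>R. w i s) = 1"
    and x: "\<And>s. s \<in> S \<Longrightarrow> 0 < x s"
  shows "exp (\<Sum>i\<in>R. \<Sum>s\<in>S. - (w i s * ln (w i s))) * (\<Prod>s\<in>S. x s)
    \<le> (\<Prod>i\<in>R. \<Sum>s\<in>S. of_bool (0 < w i s) * x s)"
proof -
  have row_bound: "exp (\<Sum>s\<in>S. w i s * ln (x s) - w i s * ln (w i s)) \<le> (\<Sum>s\<in>S. of_bool (0 < w i s) * x s)"
    if i: "i \<in> R" for i
  proof -
    define T where "T = (\<Sum>s\<in>S. of_bool (0 < w i s) * x s)"
    obtain s where s: "s \<in> S" "0 < w i s"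
    proof -
      have "\<exists>s\<in>S. w i s \<noteq> 0" using row[OF i] by (metis sum.neutral zero_neq_one)
      then show ?thesis using nonneg[OF i] that by fastforce
    qed
    have T: "0 < T" unfolding T_def
      using s x assms(2) by (intro sum_pos2[of _ s]) (auto simp: less_imp_le)
    \<comment> \<open>Each term is \<open>ln u \<le> u - 1\<close> at
      \<open>u = x s / (w i s * T)\<close>, multiplied by \<open>w i s\<close>. The right-hand sides
      sum to 0 because \<open>w\<close> has row sum 1 and \<open>T\<close> is the total of the
      admissible \<open>x s\<close>.\<close>
    have "(\<Sum>s\<in>S. w i s * ln (x s) - w i s * ln (w i s) - w i s * ln T)
        \<le> (\<Sum>s\<in>S. of_bool (0 < w i s) * x s / T - w i s)"
    proof (rule sum_mono)
      fix s assume s: "s \<in> S"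
      show "w i s * ln (x s) - w i s * ln (w i s) - w i s * ln T \<le> of_bool (0 < w i s) * x s / T - w i s"
      proof (cases "0 < w i s")
        case True
        have "w i s * ln (x s) - w i s * ln (w i s) - w i s * ln T = w i s * ln (x s / (w i s * T))"
          using True T x[OF s] by (simp add: ln_div ln_mult algebra_simps)
        also have "\<dots> \<le> w i s * (x s / (w i s * T) - 1)"
          using True T x[OF s] by (intro mult_left_mono ln_le_minus_one) auto
        also have "\<dots> = x s / T - w i s" using True T by (simp add: field_simps)
        finally show ?thesis using True by simp
      next
        case False
        then show ?thesis using nonneg[OF i s] by simp
      qed
    qed
    also have "\<dots> = 0"
      using T row[OF i] by (simp add: sum_subtractf T_def flip: sum_divide_distrib)
    finally have "(\<Sum>s\<in>S. w i s * ln (x s) - w i s * ln (w i s)) \<le> ln T"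
      using row[OF i] by (simp add: sum_subtractf flip: sum_distrib_right)
    then show ?thesis using T unfolding T_def[symmetric] by (simp add: ln_ge_iff)
  qed
  have "(\<Prod>s\<in>S. x s) = exp (\<Sum>s\<in>S. (\<Sum>i\<in>R. w i s) * ln (x s))"
    using x assms(2) by (simp add: exp_sum col)
  also have "(\<Sum>s\<in>S. (\<Sum>i\<in>R. w i s) * ln (x s)) = (\<Sum>i\<in>R. \<Sum>s\<in>S. w i s * ln (x s))"
    by (subst sum.swap) (simp add: sum_distrib_right)
  finally have "exp (\<Sum>i\<in>R. \<Sum>s\<in>S. - (w i s * ln (w i s))) * (\<Prod>s\<in>S. x s)
      = (\<Prod>i\<in>R. exp (\<Sum>s\<in>S. w i s * ln (x s) - w i s * ln (w i s)))"
    using assms(1) by (simp flip: exp_add exp_sum sum.distrib)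
  also have "\<dots> \<le> (\<Prod>i\<in>R. \<Sum>s\<in>S. of_bool (0 < w i s) * x s)"
    using row_bound by (intro prod_mono) auto
  finally show ?thesis .
qed

text \<open>\<open>entropy_capacity\<close> says that the 0-1 support matrix has capacity at least
  \<open>exp\<close> of the entropy. The capacity inequality requires strictly positive entries, so
  \<open>\<delta>\<close> is added to each of them and tends to 0 at the end; \<open>mixed\<close>
  depends continuously on the entries.\<close>

theorem card_matchings_entropy:
  fixes w :: "'r \<Rightarrow> 'c \<Rightarrow> real"
  assumes "finite R" "finite S" "card R = card S"
    and nonneg: "\<And>i s. i \<in> R \<Longrightarrow> s \<in> S \<Longrightarrow> 0 \<le> w i s"
    and row: "\<And>i. i \<in> R \<Longrightarrow> (\<Sum>s\<in>S. w i s) = 1"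
    and col: "\<And>s. s \<in> S \<Longrightarrow> (\<Sum>i\<in>R. w i s) = 1"
  shows "exp ((\<Sum>i\<in>R. \<Sum>s\<in>S. - (w i s * ln (w i s))) - real (card R))
    \<le> real (card (matchings R S (\<lambda>i s. 0 < w i s)))"
proof -
  obtain K where K: "set K = S" "distinct K" using finite_distinct_list[OF assms(2)] by blast
  have len: "length K = card R" using K assms(3) distinct_card by fastforce
  define c where "c = exp (\<Sum>i\<in>R. \<Sum>s\<in>S. - (w i s * ln (w i s)))"
  define a where "a \<delta> i s = of_bool (0 < w i s) + \<delta>" for \<delta> :: real and i s
  have lower: "c * exp (- real (card R)) \<le> mixed (a \<delta>) S K R (\<lambda>s. 0)" if "0 < \<delta>" for \<delta>
  proof -
    have "c * exp (- real (length K)) * (\<Prod>s\<in>S - set K. (\<lambda>s. 0) s) \<le> mixed (a \<delta>) S K R (\<lambda>s. 0)"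
    proof (rule mixed_capacity)
      show "0 < a \<delta> i s" for i s using that by (simp add: a_def)
      fix x :: "'c \<Rightarrow> real" assume x: "\<And>s. s \<in> S \<Longrightarrow> 0 < x s"
      have "c * (\<Prod>s\<in>S. x s) \<le> (\<Prod>i\<in>R. \<Sum>s\<in>S. of_bool (0 < w i s) * x s)"
        unfolding c_def using assms x by (intro entropy_capacity) auto
      also have "\<dots> \<le> (\<Prod>i\<in>R. \<Sum>s\<in>S. a \<delta> i s * x s)"
        using x that by (intro prod_mono conjI sum_mono sum_nonneg mult_right_mono)
          (auto simp: a_def less_imp_le)
      finally show "c * (\<Prod>s\<in>S. x s) \<le> mixed (a \<delta>) S [] R x" by simp
    qed (use assms K in \<open>auto simp: c_def\<close>)
    then show ?thesis using K len by simp
  qed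
  have lim: "((\<lambda>\<delta>. mixed (a \<delta>) S L R' (\<lambda>s. 0)) \<longlongrightarrow> mixed (a 0) S L R' (\<lambda>s. 0)) (at_right 0)" for L R'
  proof (induction L arbitrary: R')
    case (Cons k L)
    have "((\<lambda>\<delta>. a \<delta> i k) \<longlongrightarrow> a 0 i k) (at_right 0)" for i
      unfolding a_def by (intro tendsto_intros)
    then show ?case using Cons by (auto intro!: tendsto_sum tendsto_mult)
  qed simp
  have "c * exp (- real (card R)) \<le> mixed (a 0) S K R (\<lambda>s. 0)"
    using lim[of K R] by (rule tendsto_lowerbound)
      (auto simp: eventually_at_right_less intro: eventually_mono[OF eventually_at_right_less] lower)
  also have "mixed (a 0) S K R (\<lambda>s. 0) \<le> real (card (matchings R S (\<lambda>i s. 0 < w i s)))"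
    using mixed_le_card_matchings[OF assms(1) K(2) len, of "\<lambda>i s. 0 < w i s" S "\<lambda>s. 0"] K(1)
    unfolding a_def by simp
  finally show ?thesis by (simp add: c_def exp_diff exp_minus field_simps)
qed

section \<open>Rank numbers and the flow in the last coordinate\<close>

text \<open>For nonnegative sequences the form with two indices, unlike the condition on
  \<open>g k ^ 2\<close> alone, excludes internal zeros, and iterating it compares any two pairs of
  indices with equal sum (\<open>log_concaveD\<close>).\<close>

definition log_concave :: "(int \<Rightarrow> real) \<Rightarrow> bool" where
  "log_concave g \<longleftrightarrow> (\<forall>a b. a \<le> b \<longrightarrow> g (a - 1) * g (b + 1) \<le> g a * g b)"

lemma log_concaveD:
  assumes "log_concave g" "p \<le> q" "p \<le> r" "p + s = q + r"
  shows "g p * g s \<le> g q * g r"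
proof -
  have *: "g (a - int d) * g (b + int d) \<le> g a * g b" if "a \<le> b" for a b d
  proof (induction d)
    case (Suc d)
    have "g (a - int d - 1) * g (b + int d + 1) \<le> g (a - int d) * g (b + int d)"
      using assms(1) that unfolding log_concave_def by (simp del: of_nat_Suc)
    with Suc show ?case by (simp add: algebra_simps)
  qed simp
  have s: "s = q + r - p" using assms(4) by simp
  show ?thesis
  proof (cases "q \<le> r")
    case True
    then show ?thesis using *[of q r "nat (q - p)"] assms unfolding s by (simp add: algebra_simps)
  next
    case False
    then show ?thesis using *[of r q "nat (r - p)"] assms unfolding s by (simp add: algebra_simps)
  qed
qed

lemma window_sum_step:
  fixes g :: "int \<Rightarrow> real"
  shows "(\<Sum>u<t. g (k + 1 - int u)) = (\<Sum>u<t. g (k - int u)) + g (k + 1) - g (k + 1 - int t)"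
  using sum_lessThan_telescope[of "\<lambda>u. g (k + 1 - int u)" t] by (simp add: sum_subtractf)

lemma log_concave_window_sum:
  assumes "log_concave g"
  shows "log_concave (\<lambda>k. \<Sum>u<t. g (k - int u))"
  unfolding log_concave_def
proof (intro allI impI)
  fix a b :: int assume ab: "a \<le> b"
  let ?h = "\<lambda>k. \<Sum>u<t. g (k - int u)"
  \<comment> \<open>Telescoping \<open>?h (a - 1)\<close> and \<open>?h b\<close> turns
    \<open>?h a * ?h b - ?h (a - 1) * ?h (b + 1)\<close> into these two sums, and every term is one
    instance of log-concavity of \<open>g\<close>.\<close>
  have "0 \<le> (\<Sum>u<t. g a * g (b + 1 - int u) - g (a - int u) * g (b + 1))
      + (\<Sum>u<t. g (a - int u) * g (b + 1 - int t) - g (a - int t) * g (b + 1 - int u))"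
    using ab by (intro add_nonneg_nonneg sum_nonneg)
      (auto simp: intro!: log_concaveD[OF assms])
  also have "\<dots> = (g a - g (a - int t)) * ?h (b + 1) + ?h a * (g (b + 1 - int t) - g (b + 1))"
    by (simp add: sum_subtractf algebra_simps sum_distrib_left sum_distrib_right)
  also have "\<dots> = ?h a * ?h b - ?h (a - 1) * ?h (b + 1)"
  proof -
    have 1: "?h (a - 1) = ?h a + g (a - int t) - g a" using window_sum_step[of g "a - 1" t] by simp
    have 2: "?h b = ?h (b + 1) + g (b + 1 - int t) - g (b + 1)" using window_sum_step[of g b t] by simp
    show ?thesis unfolding 1 2 by (simp only: algebra_simps)
  qed
  finally show "?h (a - 1) * ?h (b + 1) \<le> ?h a * ?h b" by simp
qed

text \<open>Coordinates outside \<open>S\<close> are ignored, so a recursion that deletes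
  coordinates can keep the same vector. Integer values avoid truncated subtraction.\<close>

definition coord_rank :: "nat set \<Rightarrow> (nat \<Rightarrow> nat) \<Rightarrow> int" where
  "coord_rank S x = (\<Sum>i\<in>S. int (x i) - 1)"

lemma coord_rank_cong: "(\<And>i. i \<in> S \<Longrightarrow> x i = y i) \<Longrightarrow> coord_rank S x = coord_rank S y"
  by (simp add: coord_rank_def)

lemma coord_rank_remove:
  "finite S \<Longrightarrow> l \<in> S \<Longrightarrow> coord_rank S x = (int (x l) - 1) + coord_rank (S - {l}) x"
  by (simp add: coord_rank_def sum.remove)

lemma sum_PiE_insert:
  assumes "finite S" "l \<notin> S"
  shows "(\<Sum>x\<in>insert l S \<rightarrow>\<^sub>E T. F x) = (\<Sum>v\<in>T. \<Sum>x\<in>S \<rightarrow>\<^sub>E T. F (x(l := v)))"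
proof -
  have "(\<Sum>x\<in>insert l S \<rightarrow>\<^sub>E T. F x)
      = (\<Sum>(v, x)\<in>T \<times> (S \<rightarrow>\<^sub>E T). F (x(l := v)))"
    unfolding PiE_insert_eq
    using inj_combinator[OF assms(2), of "\<lambda>_. T"]
    by (subst sum.reindex) (auto simp: case_prod_unfold intro!: sum.cong)
  then show ?thesis by (simp add: sum.cartesian_product)
qed

text \<open>Any number above \<open>48 ^ 48\<close> serves in \<open>window_ratio_up\<close>, where
  \<open>C ^ L \<le> 48 ^ j\<close> with \<open>j \<le> 48 * L\<close> has to be
  contradicted.\<close>

definition window_const :: real where
  "window_const = 49 ^ 48"

lemma window_const_pos: "0 < window_const"
  by (simp add: window_const_def)

section \<open>Rank numbers of the hypergrid and the last coordinate\<close>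

locale grid =
  fixes t :: nat
  assumes t2: "2 \<le> t"
begin

fun level_size :: "nat \<Rightarrow> int \<Rightarrow> real" where
  "level_size 0 k = of_bool (k = 0)"
| "level_size (Suc j) k = (\<Sum>u<t. level_size j (k - int u))"

lemma level_size_nonneg: "0 \<le> level_size j k"
  by (induction j arbitrary: k) (auto intro: sum_nonneg)

lemma log_concave_level_size: "log_concave (level_size j)"
proof (induction j)
  case 0
  show ?case by (auto simp: log_concave_def)
next
  case (Suc j)
  then show ?case using log_concave_window_sum[of "level_size j" t] by (simp add: log_concave_def)
qed

lemma level_size_outside:
  "k < 0 \<or> (int t - 1) * int j < k \<Longrightarrow> level_size j k = 0"
proof (induction j arbitrary: k)
  case (Suc j)
  have "level_size j (k - int u) = 0" if "u < t" for u
    using Suc that by (intro Suc.IH) (auto simp: algebra_simps)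
  then show ?case by simp
qed auto

lemma level_size_pos:
  "0 \<le> k \<Longrightarrow> k \<le> (int t - 1) * int j \<Longrightarrow> 0 < level_size j k"
proof (induction j arbitrary: k)
  case (Suc j)
  define u where "u = nat (min k (int t - 1))"
  have u: "u < t" "int u \<le> k" using t2 Suc.prems by (auto simp: u_def)
  moreover have "k - int u \<le> (int t - 1) * int j"
  proof (cases "k \<le> int t - 1")
    case True
    then have "k - int u = 0" using Suc.prems by (simp add: u_def)
    then show ?thesis using t2 by simp
  next
    case False
    then show ?thesis using Suc.prems t2 by (auto simp: u_def algebra_simps)
  qed
  ultimately have "0 < level_size j (k - int u)" by (intro Suc.IH) auto
  then show ?case using u by (auto intro!: sum_pos2[of _ u] level_size_nonneg)
qed simp

lemma level_size_sym: "level_size j ((int t - 1) * int j - k) = level_size j k"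
proof (induction j arbitrary: k)
  case (Suc j)
  have "level_size (Suc j) ((int t - 1) * int (Suc j) - k)
      = (\<Sum>u<t. level_size j ((int t - 1) * int j - (k - int (t - Suc u))))"
    by (auto intro!: sum.cong arg_cong[of _ _ "level_size j"] simp: algebra_simps of_nat_diff)
  also have "\<dots> = (\<Sum>u<t. level_size j (k - int (t - Suc u)))" by (simp add: Suc.IH)
  also have "\<dots> = level_size (Suc j) k"
    using sum.nat_diff_reindex[of "\<lambda>u. level_size j (k - int u)" t] by simp
  finally show ?case .
qed simp

declare level_size.simps(2) [simp del]

text \<open>The pairs \<open>k\<close>, \<open>?m - k\<close> and \<open>k'\<close>,
  \<open>?m - k'\<close> have the same sum, the second pair being the inner one; by symmetry both
  products are squares.\<close>

lemma level_size_mono: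
  assumes "k \<le> k'" "k + k' \<le> (int t - 1) * int j"
  shows "level_size j k \<le> level_size j k'"
proof -
  let ?m = "(int t - 1) * int j"
  have "level_size j k * level_size j (?m - k) \<le> level_size j k' * level_size j (?m - k')"
    using assms by (intro log_concaveD[OF log_concave_level_size]) auto
  then have "(level_size j k)\<^sup>2 \<le> (level_size j k')\<^sup>2"
    by (simp add: level_size_sym power2_eq_square)
  then show ?thesis using level_size_nonneg power2_le_imp_le by blast
qed

lemma card_level_PiE:
  "finite S \<Longrightarrow> (\<Sum>x\<in>S \<rightarrow>\<^sub>E {1..t}. of_bool (coord_rank S x = k)) = level_size (card S) k"
proof (induction S arbitrary: k rule: finite_induct)
  case empty
  show ?case by (simp add: coord_rank_def)
next
  case (insert l S)
  have rk: "coord_rank (insert l S) (x(l := v)) = int v - 1 + coord_rank S x" for x v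
    using insert.hyps by (auto simp: coord_rank_def intro!: sum.cong)
  have "(\<Sum>x\<in>insert l S \<rightarrow>\<^sub>E {1..t}. of_bool (coord_rank (insert l S) x = k))
      = (\<Sum>v\<in>{1..t}. \<Sum>x\<in>S \<rightarrow>\<^sub>E {1..t}. of_bool (coord_rank S x = k - (int v - 1)) :: real)"
    using insert.hyps by (auto simp: sum_PiE_insert rk algebra_simps intro!: sum.cong)
  also have "\<dots> = (\<Sum>v\<in>{1..t}. level_size (card S) (k - (int v - 1)))"
    by (simp only: insert.IH)
  also have "\<dots> = (\<Sum>u<t. level_size (card S) (k - int u))"
    by (rule sum.reindex_bij_witness[of _ Suc "\<lambda>v. v - 1"]) auto
  finally show ?case using insert.hyps by (simp add: level_size.simps)
qed

lemma sum_level_size: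
  assumes "finite K"
  shows "(\<Sum>k\<in>K. level_size j k) = real (card {x \<in> {..<j} \<rightarrow>\<^sub>E {1..t}. coord_rank {..<j} x \<in> K})"
proof -
  have "(\<Sum>k\<in>K. level_size j k) = (\<Sum>x\<in>{..<j} \<rightarrow>\<^sub>E {1..t}. \<Sum>k\<in>K. of_bool (coord_rank {..<j} x = k))"
    using card_level_PiE[of "{..<j}"] by (subst sum.swap) simp
  also have "\<dots> = (\<Sum>x\<in>{..<j} \<rightarrow>\<^sub>E {1..t}. of_bool (coord_rank {..<j} x \<in> K))"
    using assms by (simp add: of_bool_def)
  finally show ?thesis by (simp add: of_bool_def Int_def finite_PiE flip: sum.inter_filter)
qed

lemma sum_level_size_le:
  assumes "finite K"
  shows "(\<Sum>k\<in>K. level_size j k) \<le> real t ^ j"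
proof -
  have "card {x \<in> {..<j} \<rightarrow>\<^sub>E {1..t}. coord_rank {..<j} x \<in> K} \<le> card ({..<j} \<rightarrow>\<^sub>E {1..t})"
    by (intro card_mono) (auto intro: finite_PiE)
  then show ?thesis unfolding sum_level_size[OF assms] by (simp add: card_PiE flip: of_nat_power)
qed

text \<open>The box of points with all coordinates at most \<open>h\<close> has \<open>h ^ j\<close>
  elements and lies within these ranks.\<close>

lemma low_mass:
  assumes "h \<le> t"
  shows "real h ^ j \<le> (\<Sum>k\<in>{0..(int h - 1) * int j}. level_size j k)"
proof -
  have "({..<j} \<rightarrow>\<^sub>E {1..h}) \<subseteq> {x \<in> {..<j} \<rightarrow>\<^sub>E {1..t}. coord_rank {..<j} x \<in> {0..(int h - 1) * int j}}"
  proof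
    fix x assume x: "x \<in> {..<j} \<rightarrow>\<^sub>E {1..h}"
    have b: "0 \<le> int (x i) - 1 \<and> int (x i) - 1 \<le> int h - 1" if "i < j" for i
      using PiE_mem[OF x, of i] that by auto
    have "0 \<le> coord_rank {..<j} x" unfolding coord_rank_def using b by (intro sum_nonneg) auto
    moreover have "coord_rank {..<j} x \<le> (\<Sum>i<j. int h - 1)"
      unfolding coord_rank_def using b by (intro sum_mono) auto
    ultimately show "x \<in> {x \<in> {..<j} \<rightarrow>\<^sub>E {1..t}. coord_rank {..<j} x \<in> {0..(int h - 1) * int j}}"
      using x assms by (fastforce simp: PiE_iff mult.commute)
  qed
  then have "card ({..<j} \<rightarrow>\<^sub>E {1..h}) \<le> card {x \<in> {..<j} \<rightarrow>\<^sub>E {1..t}. coord_rank {..<j} x \<in> {0..(int h - 1) * int j}}"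
    by (intro card_mono finite_subset[OF _ finite_PiE[of "{..<j}" "\<lambda>_. {1..t}"]]) auto
  then show ?thesis by (simp add: sum_level_size card_PiE flip: of_nat_power)
qed

text \<open>By symmetry the last coordinate carries the fraction \<open>1 / (j + 1)\<close> of the rank on average.\<close>

lemma level_size_mean:
  "real (Suc j) * (\<Sum>u<t. real u * level_size j (k - int u)) = of_int k * level_size (Suc j) k"
proof (induction j arbitrary: k)
  case 0
  have "(\<Sum>u<t. real u * of_bool (k - int u = 0)) = (\<Sum>u<t. of_int k * of_bool (k - int u = 0))"
    by (intro sum.cong) auto
  then show ?case
    by (simp only: level_size.simps sum_distrib_left of_nat_Suc of_nat_0 add.right_neutral mult_1_left)
next
  case (Suc j)
  let ?M = "\<lambda>j k. \<Sum>u<t. real u * level_size j (k - int u)"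
  have swap: "(\<Sum>u<t. ?M j (k - int u)) = ?M (Suc j) k"
    by (simp add: level_size.simps(2) sum_distrib_left) (subst sum.swap, simp add: algebra_simps)
  have "of_int k * level_size (Suc (Suc j)) k
      = (\<Sum>u<t. of_int (k - int u) * level_size (Suc j) (k - int u)) + ?M (Suc j) k"
    by (simp only: level_size.simps(2)[of "Suc j"] sum_distrib_left flip: sum.distrib)
       (simp add: algebra_simps)
  also have "\<dots> = real (Suc j) * (\<Sum>u<t. ?M j (k - int u)) + ?M (Suc j) k"
    by (simp only: Suc.IH[symmetric] sum_distrib_left)
  also have "\<dots> = real (Suc (Suc j)) * ?M (Suc j) k"
    unfolding swap by (simp add: algebra_simps)
  finally show ?case by simp
qed

text \<open>Push the uniform distribution on rank \<open>k\<close> of \<open>[t]\<^sup>j\<^sup>+\<^sup>1\<close> forward to rank \<open>k + 1\<close>. The last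
  coordinate minus 1 has distribution \<open>last_frac\<close>, so the mass that raises it from \<open>y\<close> to \<open>y + 1\<close> is the
  difference \<open>last_flow j k y\<close> of two distribution functions.\<close>

definition last_frac :: "nat \<Rightarrow> int \<Rightarrow> nat \<Rightarrow> real" where
  "last_frac j k u = level_size j (k - int u) / level_size (Suc j) k"

definition last_flow :: "nat \<Rightarrow> int \<Rightarrow> nat \<Rightarrow> real" where
  "last_flow j k y = (\<Sum>u<y. last_frac j k u - last_frac j (k + 1) u)"

lemma last_frac_nonneg: "0 \<le> last_frac j k u"
  by (simp add: last_frac_def level_size_nonneg)

lemma sum_last_frac:
  assumes "0 \<le> k" "k \<le> (int t - 1) * int (Suc j)"
  shows "(\<Sum>u<t. last_frac j k u) = 1"
  using level_size_pos[OF assms] by (simp add: last_frac_def level_size.simps(2) flip: sum_divide_distrib)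

text \<open>Log-concavity, term by term: when the rank grows from \<open>k\<close> to
  \<open>k + 1\<close>, weight moves towards larger values of the last coordinate. This monotone
  likelihood ratio gives both the sign and the concavity of \<open>last_flow\<close>.\<close>

lemma ratio_mono:
  assumes "\<And>u u'. u \<in> X \<Longrightarrow> u' \<in> Y \<Longrightarrow> u \<le> u'"
  shows "(\<Sum>u\<in>X. level_size j (k + 1 - int u)) * (\<Sum>u\<in>Y. level_size j (k - int u))
    \<le> (\<Sum>u\<in>X. level_size j (k - int u)) * (\<Sum>u\<in>Y. level_size j (k + 1 - int u))"
  unfolding sum_product
  using assms by (intro sum_mono) (subst mult.commute, auto intro!: log_concaveD[OF log_concave_level_size])

context
  fixes j :: nat and k :: int
  assumes k0: "0 \<le> k" and k1: "k < (int t - 1) * int (Suc j)"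
begin

abbreviation "Tl y \<equiv> (\<Sum>u<y. level_size j (k - int u))"
abbreviation "Tl' y \<equiv> (\<Sum>u<y. level_size j (k + 1 - int u))"
abbreviation "Tu y \<equiv> (\<Sum>u\<in>{y..<t}. level_size j (k - int u))"
abbreviation "Tu' y \<equiv> (\<Sum>u\<in>{y..<t}. level_size j (k + 1 - int u))"

lemma size_k: "0 < level_size (Suc j) k" and size_k1: "0 < level_size (Suc j) (k + 1)"
  using k0 k1 by (intro level_size_pos; simp)+

lemma size_split:
  assumes "y \<le> t"
  shows "level_size (Suc j) k = Tl y + Tu y" "level_size (Suc j) (k + 1) = Tl' y + Tu' y"
proof -
  have *: "{..<t} = {..<y} \<union> {y..<t}" using assms by auto
  show "level_size (Suc j) k = Tl y + Tu y" "level_size (Suc j) (k + 1) = Tl' y + Tu' y"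
    unfolding level_size.simps * by (subst sum.union_disjoint; auto)+
qed

lemma last_flow_lower: "last_flow j k y = Tl y / level_size (Suc j) k - Tl' y / level_size (Suc j) (k + 1)"
  by (simp add: last_flow_def last_frac_def sum_subtractf sum_divide_distrib)

lemma last_flow_upper:
  assumes "y \<le> t"
  shows "last_flow j k y = Tu' y / level_size (Suc j) (k + 1) - Tu y / level_size (Suc j) k"
  unfolding last_flow_lower using size_k size_k1 size_split[OF assms]
  by (simp add: field_simps)

lemma last_flow_0: "last_flow j k 0 = 0"
  by (simp add: last_flow_def)

lemma last_flow_t: "last_flow j k t = 0"
  by (simp add: last_flow_upper)

lemma last_flow_nonneg:
  assumes "y \<le> t"
  shows "0 \<le> last_flow j k y"
proof -
  have "Tl' y * Tu y \<le> Tl y * Tu' y" by (rule ratio_mono) auto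
  then have "Tl' y * level_size (Suc j) k \<le> Tl y * level_size (Suc j) (k + 1)"
    unfolding size_split[OF assms] by (simp add: algebra_simps)
  then show ?thesis unfolding last_flow_lower using size_k size_k1 by (simp add: field_simps)
qed

text \<open>The rank of the other coordinates also grows stochastically with \<open>k\<close>: the
  probability of a last coordinate below \<open>v\<close> at rank \<open>k\<close> is at most that
  of one below \<open>v + 1\<close> at rank \<open>k + 1\<close>. Together with
  \<open>last_flow_nonneg\<close> this makes \<open>step_prob\<close> a probability.\<close>

lemma last_flow_le_frac:
  assumes "v < t"
  shows "last_flow j k (Suc v) \<le> last_frac j k v"
proof -
  let ?g = "level_size j"
  have Tl': "Tl' (Suc v) = ?g (k + 1) + Tl v"
    by (subst sum.lessThan_Suc_shift) (simp add: algebra_simps)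
  have "Tl v \<le> level_size (Suc j) k"
    using size_split(1)[of v] assms level_size_nonneg by (simp add: sum_nonneg)
  then have "Tl v * ?g (k + 1) \<le> ?g (k + 1) * level_size (Suc j) k"
    by (subst mult.commute) (rule mult_left_mono[OF _ level_size_nonneg])
  moreover have eq: "level_size (Suc j) (k + 1) = level_size (Suc j) k + ?g (k + 1) - ?g (k + 1 - int t)"
    using window_sum_step[of ?g k t] by (simp add: level_size.simps(2))
  moreover have "0 \<le> Tl v * ?g (k + 1 - int t)" by (intro mult_nonneg_nonneg sum_nonneg level_size_nonneg)
  ultimately have "Tl v * level_size (Suc j) (k + 1) \<le> Tl' (Suc v) * level_size (Suc j) k"
    unfolding Tl' eq by (simp add: algebra_simps)
  then have "Tl v / level_size (Suc j) k \<le> Tl' (Suc v) / level_size (Suc j) (k + 1)"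
    using size_k size_k1 by (simp add: field_simps)
  then show ?thesis
    unfolding last_flow_lower last_frac_def by (simp add: add_divide_distrib)
qed

text \<open>Here the other coordinates are at their top, so smaller values of the last coordinate do
  not occur at rank \<open>k\<close>, nor values up to \<open>v\<close> at rank
  \<open>k + 1\<close>. All the mass has to raise the last coordinate.\<close>

lemma last_flow_full:
  assumes "v < t" "k - int v = (int t - 1) * int j"
  shows "last_flow j k (Suc v) = last_frac j k v"
proof -
  have "Tl' (Suc v) = 0" using assms by (intro sum.neutral) (auto intro!: level_size_outside)
  moreover have "Tl v = 0" using assms by (intro sum.neutral) (auto intro!: level_size_outside)
  ultimately show ?thesis
    unfolding last_flow_lower last_frac_def by simp
qed

text \<open>Summation by parts: the total flow is the growth of the mean of the last coordinate, and
  by \<open>level_size_mean\<close> that mean is the rank divided by \<open>Suc j\<close>.\<close>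

lemma sum_last_flow: "(\<Sum>v<t. last_flow j k (Suc v)) = 1 / real (Suc j)"
proof -
  have mean: "(\<Sum>u<t. real u * last_frac j l u) = of_int l / real (Suc j)"
    if "0 < level_size (Suc j) l" for l
  proof -
    have "(\<Sum>u<t. real u * last_frac j l u) = (\<Sum>u<t. real u * level_size j (l - int u)) / level_size (Suc j) l"
      by (simp add: last_frac_def sum_divide_distrib)
    also have "\<dots> = of_int l / real (Suc j)"
      using level_size_mean[of j l] that by (simp add: field_simps)
    finally show ?thesis .
  qed
  have "(\<Sum>v<n. \<Sum>u<Suc v. f u) = (\<Sum>u<n. (real n - real u) * f u)" for n and f :: "nat \<Rightarrow> real"
    by (induction n) (simp_all add: algebra_simps sum.distrib sum_subtractf)
  then have "(\<Sum>v<t. last_flow j k (Suc v)) = (\<Sum>u<t. (real t - real u) * (last_frac j k u - last_frac j (k + 1) u))"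
    unfolding last_flow_def by blast
  also have "\<dots> = real t * ((\<Sum>u<t. last_frac j k u) - (\<Sum>u<t. last_frac j (k + 1) u))
      - ((\<Sum>u<t. real u * last_frac j k u) - (\<Sum>u<t. real u * last_frac j (k + 1) u))"
    by (simp add: algebra_simps sum.distrib sum_subtractf sum_distrib_left)
  also have "\<dots> = 1 / real (Suc j)"
    using k0 k1 size_k size_k1 by (simp add: sum_last_frac mean diff_divide_distrib[symmetric])
  finally show ?thesis .
qed

text \<open>Log-concavity makes \<open>last_flow\<close> concave as a function of the cumulative distribution of the last
  coordinate. If that distribution is uniform up to a factor \<open>C\<close>, the flow cannot exceed a multiple of
  its average, which is known.\<close>

lemma last_flow_bound:
  assumes C: "\<And>u u'. u < t \<Longrightarrow> u' < t \<Longrightarrow> level_size j (k - int u) \<le> C * level_size j (k - int u')"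
    and v: "v < t" and pos: "0 < level_size j (k - int v)"
  shows "last_flow j k (Suc v) \<le> 2 * C ^ 3 / real (Suc j) * last_frac j k v"
proof -
  let ?g = "\<lambda>u. level_size j (k - int u)" and ?G = "last_flow j k" and ?y = "Suc v"
  define a where "a = ?g v"
  have a: "0 < a" using pos by (simp add: a_def)
  have "a \<le> C * a" unfolding a_def using C v by blast
  then have C1: "1 \<le> C" using a by simp
  have ub: "?g u \<le> C * a" if "u < t" for u unfolding a_def using C that v by blast
  have lb: "a / C \<le> ?g u" if "u < t" for u
    using C[OF v that] C1 unfolding a_def by (simp add: field_simps)
  have C0: "0 < C" using C1 by simp
  have G0: "0 \<le> ?G ?y" using v by (intro last_flow_nonneg) auto
  \<comment> \<open>By \<open>ratio_mono\<close>, \<open>?G y' / Tl y'\<close> is at least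
    \<open>?G ?y / Tl ?y\<close>. Near-uniformity replaces the sums by the numbers of their terms at
    the cost of \<open>C\<close> for each of the two sums. \<open>high\<close> is the same argument
    for upper sums.\<close>
  have low: "?G ?y * (real y' / (C\<^sup>2 * real ?y)) \<le> ?G y'" if y': "y' \<le> ?y" for y'
  proof -
    have split: "{..<?y} = {..<y'} \<union> {y'..<?y}" using y' by auto
    have "Tl' y' * (\<Sum>u\<in>{y'..<?y}. ?g u) \<le> Tl y' * (\<Sum>u\<in>{y'..<?y}. level_size j (k + 1 - int u))"
      by (rule ratio_mono) auto
    then have "Tl' y' * Tl ?y \<le> Tl y' * Tl' ?y"
      unfolding split by (subst (1 2) sum.union_disjoint) (auto simp: algebra_simps)
    then have "(Tl' y' * Tl ?y) / level_size (Suc j) (k + 1) \<le> (Tl y' * Tl' ?y) / level_size (Suc j) (k + 1)"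
      using size_k1 by (simp add: divide_right_mono)
    then have key: "?G ?y * Tl y' \<le> ?G y' * Tl ?y"
      unfolding last_flow_lower by (simp add: algebra_simps del: sum.lessThan_Suc)
    have T1: "real y' * (a / C) \<le> Tl y'"
      using sum_mono[of "{..<y'}" "\<lambda>_. a / C" ?g] lb y' v by simp
    have T2: "Tl ?y \<le> real ?y * (C * a)"
      using sum_mono[of "{..<?y}" ?g "\<lambda>_. C * a"] ub v by (simp del: sum.lessThan_Suc)
    have "?G ?y * (real y' * (a / C)) \<le> ?G ?y * Tl y'" by (rule mult_left_mono[OF T1 G0])
    also note key
    also have "?G y' * Tl ?y \<le> ?G y' * (real ?y * (C * a))"
      using y' v by (intro mult_left_mono[OF T2] last_flow_nonneg) auto
    finally have "?G ?y * (real y' * (a / C)) \<le> ?G y' * (real ?y * (C * a))" .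
    moreover have "0 < a / C * (C\<^sup>2 * real ?y)" using a C0 by simp
    ultimately show ?thesis using a C0 by (simp add: pos_divide_le_eq power2_eq_square del: of_nat_Suc) (simp add: field_simps)
  qed
  have y_less: "?y < t" if "?G ?y \<noteq> 0" using v that last_flow_t by (cases "?y = t") auto
  have high: "?G ?y * (real (t - y') / (C\<^sup>2 * real (t - ?y))) \<le> ?G y'" if yt: "?y < t" and y': "?y \<le> y'" "y' \<le> t" for y'
  proof -
    have split: "{?y..<t} = {?y..<y'} \<union> {y'..<t}" using y' by auto
    have "(\<Sum>u\<in>{?y..<y'}. level_size j (k + 1 - int u)) * Tu y' \<le> (\<Sum>u\<in>{?y..<y'}. ?g u) * Tu' y'"
      by (rule ratio_mono) auto
    then have "Tu' ?y * Tu y' \<le> Tu ?y * Tu' y'"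
      unfolding split by (subst (1 2) sum.union_disjoint) (auto simp: algebra_simps)
    then have "(Tu' ?y * Tu y') / level_size (Suc j) (k + 1) \<le> (Tu ?y * Tu' y') / level_size (Suc j) (k + 1)"
      using size_k1 by (simp add: divide_right_mono)
    then have key: "?G ?y * Tu y' \<le> ?G y' * Tu ?y"
      using y' v by (simp add: last_flow_upper algebra_simps)
    have T1: "real (t - y') * (a / C) \<le> Tu y'"
      using sum_mono[of "{y'..<t}" "\<lambda>_. a / C" ?g] lb by simp
    have T2: "Tu ?y \<le> real (t - ?y) * (C * a)"
      using sum_mono[of "{?y..<t}" ?g "\<lambda>_. C * a"] ub by simp
    have "?G ?y * (real (t - y') * (a / C)) \<le> ?G ?y * Tu y'" by (rule mult_left_mono[OF T1 G0])
    also note key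
    also have "?G y' * Tu ?y \<le> ?G y' * (real (t - ?y) * (C * a))"
      using y' v by (intro mult_left_mono[OF T2] last_flow_nonneg) auto
    finally have "?G ?y * (real (t - y') * (a / C)) \<le> ?G y' * (real (t - ?y) * (C * a))" .
    moreover have "0 < real (t - ?y)" using yt by simp
    ultimately show ?thesis using a C0 by (simp add: pos_divide_le_eq power2_eq_square del: of_nat_Suc of_nat_diff) (simp add: field_simps del: of_nat_Suc of_nat_diff)
  qed
  have gauss: "(\<Sum>i<n. real i) = real n * (real n - 1) / 2" for n
    by (induction n) (auto simp: field_simps)
  show ?thesis
  proof (cases "?G ?y = 0")
    case True
    then show ?thesis using C0 last_frac_nonneg by simp
  next
    case False
    then have yt: "?y < t" by (rule y_less)
    have "(\<Sum>i<t. ?G (Suc i)) = (\<Sum>i<?y. ?G (Suc i)) + (\<Sum>i\<in>{?y..<t}. ?G (Suc i))"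
    proof -
      have *: "{..<t} = {..<?y} \<union> {?y..<t}" using v by auto
      show ?thesis unfolding * by (rule sum.union_disjoint) auto
    qed
    moreover have "?G ?y * ((real ?y + 1) / (2 * C\<^sup>2)) \<le> (\<Sum>i<?y. ?G (Suc i))"
    proof -
      have "(\<Sum>i<?y. ?G ?y * (real (Suc i) / (C\<^sup>2 * real ?y))) \<le> (\<Sum>i<?y. ?G (Suc i))"
        by (intro sum_mono low) auto
      moreover have "(\<Sum>i<?y. ?G ?y * (real (Suc i) / (C\<^sup>2 * real ?y))) = ?G ?y * ((\<Sum>i<?y. real (Suc i)) / (C\<^sup>2 * real ?y))"
        by (simp only: sum_distrib_left sum_divide_distrib)
      moreover have "(\<Sum>i<?y. real (Suc i)) = real ?y * (real ?y + 1) / 2"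
        using gauss[of "Suc ?y"] by (simp only: sum.lessThan_Suc_shift) simp
      moreover have "real ?y * (real ?y + 1) / 2 / (C\<^sup>2 * real ?y) = (real ?y + 1) / (2 * C\<^sup>2)"
        using C0 by (simp add: field_simps del: of_nat_Suc)
      ultimately show ?thesis by (simp only:)
    qed
    moreover have "?G ?y * ((real t - real ?y - 1) / (2 * C\<^sup>2)) \<le> (\<Sum>i\<in>{?y..<t}. ?G (Suc i))"
    proof -
      have "(\<Sum>i\<in>{?y..<t}. ?G ?y * (real (t - Suc i) / (C\<^sup>2 * real (t - ?y)))) \<le> (\<Sum>i\<in>{?y..<t}. ?G (Suc i))"
        using yt by (intro sum_mono high) auto
      moreover have "(\<Sum>i\<in>{?y..<t}. ?G ?y * (real (t - Suc i) / (C\<^sup>2 * real (t - ?y))))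
          = ?G ?y * ((\<Sum>i\<in>{?y..<t}. real (t - Suc i)) / (C\<^sup>2 * real (t - ?y)))"
        by (simp only: sum_distrib_left sum_divide_distrib)
      moreover have "(\<Sum>i\<in>{?y..<t}. real (t - Suc i)) = (\<Sum>i<t - ?y. real i)"
        by (rule sum.reindex_bij_witness[of _ "\<lambda>i. t - Suc i" "\<lambda>i. t - Suc i"]) auto
      moreover have "(\<Sum>i<t - ?y. real i) / (C\<^sup>2 * real (t - ?y)) = (real t - real ?y - 1) / (2 * C\<^sup>2)"
      proof -
        have "real t - real ?y = real (t - ?y)" "0 < real (t - ?y)" using yt by auto
        then show ?thesis unfolding gauss using C0 by (simp only:) (simp add: field_simps del: of_nat_diff)
      qed
      ultimately show ?thesis by (simp only:)
    qed
    \<comment> \<open>The two linear lower bounds enclose triangles with apex \<open>?G ?y\<close>.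
      In their total area the terms \<open>+ 1\<close> and \<open>- 1\<close> cancel, which leaves
      exactly \<open>t / (2 * C\<^sup>2)\<close>.\<close>
    ultimately have "?G ?y * ((real ?y + 1) / (2 * C\<^sup>2)) + ?G ?y * ((real t - real ?y - 1) / (2 * C\<^sup>2)) \<le> 1 / real (Suc j)"
      using sum_last_flow by linarith
    moreover have "?G ?y * ((real ?y + 1) / (2 * C\<^sup>2)) + ?G ?y * ((real t - real ?y - 1) / (2 * C\<^sup>2))
        = ?G ?y * (real t / (2 * C\<^sup>2))"
      by (simp only: add_divide_distrib diff_divide_distrib algebra_simps)
    ultimately have G: "?G ?y \<le> 2 * C\<^sup>2 / real (Suc j) / real t"
      using C0 t2 by (simp add: field_simps del: of_nat_Suc)
    \<comment> \<open>The third factor \<open>C\<close>: \<open>last_frac j k v\<close> is one of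
      \<open>t\<close> masses that agree up to \<open>C\<close>, so it is at least
      \<open>1 / (t * C)\<close>.\<close>
    have "level_size (Suc j) k \<le> real t * (C * a)"
      unfolding level_size.simps using sum_mono[of "{..<t}" ?g "\<lambda>_. C * a"] ub by simp
    then have "1 / (real t * C) \<le> last_frac j k v"
      unfolding last_frac_def a_def[symmetric] using size_k a C0 t2 by (simp add: field_simps)
    then have "2 * C ^ 3 / real (Suc j) * (1 / (real t * C)) \<le> 2 * C ^ 3 / real (Suc j) * last_frac j k v"
      using C0 by (intro mult_left_mono) auto
    moreover have "2 * C ^ 3 / real (Suc j) * (1 / (real t * C)) = 2 * C\<^sup>2 / real (Suc j) / real t"
      using C0 by (simp add: power2_eq_square power3_eq_cube)
    ultimately show ?thesis using G by linarith
  qed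
qed

end

text \<open>The constant 16 is large enough for \<open>exp (1 / 16) * (7 / 8) < 1\<close>, which makes the tails
  exponentially small.\<close>

definition bulk :: "nat \<Rightarrow> int \<Rightarrow> bool" where
  "bulk s k \<longleftrightarrow> int t * int s \<le> 16 * k \<and> int t * int s \<le> 16 * ((int t - 1) * int s - k)"

text \<open>If two values in a window of length \<open>t\<close> differed by a larger factor, log-concavity would force an
  exponential decay below the window that leaves too little room for the \<open>h ^ j\<close> points with all
  coordinates at most \<open>h \<approx> t / 48\<close>.\<close>

lemma window_ratio_up:
  assumes j: "48 \<le> j" and k: "int t * int (Suc j) \<le> 16 * k" and i: "k - int t < i'" "i' \<le> i" "i \<le> k"
  shows "level_size j i \<le> window_const * level_size j i'"
proof (rule ccontr)
  let ?g = "level_size j" and ?C = window_const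
  assume "\<not> ?thesis"
  then have gi: "?C * ?g i' < ?g i" by simp
  then have gi0: "0 < ?g i"
    using level_size_nonneg[of j i'] window_const_pos
    by (metis mult_nonneg_nonneg less_imp_le le_less_trans)
  define d where "d = i - i'"
  have d: "0 \<le> d" "d \<le> int t - 1" using i by (auto simp: d_def)
  \<comment> \<open>By log-concavity the growth factor over a distance \<open>d\<close> only
    increases further down, so it exceeds \<open>?C\<close> everywhere below
    \<open>i'\<close>.\<close>
  have step: "?C * ?g x \<le> ?g (x + d)" if "x \<le> i'" for x
  proof -
    have "?g x * ?g i \<le> ?g (x + d) * ?g i'"
      using that d by (intro log_concaveD[OF log_concave_level_size]) (auto simp: d_def)
    then have "?C * (?g x * ?g i) \<le> ?C * (?g (x + d) * ?g i')"
      using window_const_pos by (intro mult_left_mono) auto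
    also have "\<dots> = ?g (x + d) * (?C * ?g i')" by simp
    also have "\<dots> \<le> ?g (x + d) * ?g i"
      using gi by (intro mult_left_mono level_size_nonneg) auto
    finally have "(?C * ?g x) * ?g i \<le> ?g (x + d) * ?g i" by simp
    then show ?thesis using gi0 by (rule mult_right_le_imp_le)
  qed
  have iter: "x + int L * d \<le> i' + d \<Longrightarrow> ?C ^ L * ?g x \<le> ?g (x + int L * d)" for L x
  proof (induction L)
    case (Suc L)
    have x: "x + int L * d \<le> i'" using Suc.prems by (simp add: algebra_simps)
    then have "?C ^ L * ?g x \<le> ?g (x + int L * d)" using Suc.IH d by simp
    then have "?C * (?C ^ L * ?g x) \<le> ?C * ?g (x + int L * d)"
      using window_const_pos by (intro mult_left_mono) auto
    also have "\<dots> \<le> ?g (x + int L * d + d)" by (rule step[OF x])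
    finally show ?case by (simp add: algebra_simps)
  qed simp
  \<comment> \<open>The budget is \<open>1/48 + 1/24 = 1/16\<close> in units of
    \<open>t * j\<close>: the box of side \<open>h\<close> reaches up to \<open>1/48\<close>, and
    \<open>L\<close> steps of length less than \<open>t\<close> take another \<open>1/24\<close>.
    Hence all of them stay below \<open>k\<close>, which is at least \<open>1/16\<close>.\<close>
  define h where "h = (t + 47) div 48"
  define L where "L = j div 24"
  have h: "t \<le> 48 * h" "48 * h \<le> t + 47" "h \<le> t" "1 \<le> h" using t2 by (auto simp: h_def)
  have L: "24 * L \<le> j" "j \<le> 48 * L" "2 \<le> L" using j by (auto simp: L_def)
  have room: "x + int L * d \<le> i' + d" if x: "x \<in> {0..(int h - 1) * int j}" for x
  proof -
    have 1: "48 * ((int h - 1) * int j) \<le> (int t - 1) * int j"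
      using mult_right_mono[of "48 * (int h - 1)" "int t - 1" "int j"] h by (simp add: algebra_simps)
    have 2: "(int L - 1) * d \<le> (int L - 1) * (int t - 1)"
      using d L by (intro mult_left_mono) auto
    have 3: "24 * (int L - 1) * (int t - 1) \<le> (int j - 24) * (int t - 1)"
      using L t2 by (intro mult_right_mono) auto
    have 4: "48 * ((int L - 1) * (int t - 1)) \<le> 2 * (int j * int t) - 2 * int j - 48 * (int t - 1)"
      using 3 by (simp add: algebra_simps)
    have "48 * (x + (int L - 1) * d) \<le> 48 * (k - (int t - 1))"
      using 1 2 4 x k by (simp add: algebra_simps)
    then have "x + (int L - 1) * d \<le> i'" using i by simp
    then show ?thesis by (simp add: algebra_simps)
  qed
  \<comment> \<open>Shifting the box by \<open>L * d\<close> multiplies its mass by at least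
    \<open>?C ^ L\<close>, yet the shifted ranks are distinct and together hold at most
    \<open>t ^ j\<close> points.\<close>
  have "real h ^ j * ?C ^ L \<le> (\<Sum>x\<in>{0..(int h - 1) * int j}. ?g x) * ?C ^ L"
    using window_const_pos by (intro mult_right_mono low_mass h) auto
  also have "\<dots> \<le> (\<Sum>x\<in>{0..(int h - 1) * int j}. ?g (x + int L * d))"
    unfolding sum_distrib_right using iter room by (intro sum_mono) (simp add: mult.commute)
  also have "\<dots> = (\<Sum>x\<in>(\<lambda>x. x + int L * d) ` {0..(int h - 1) * int j}. ?g x)"
    by (subst sum.reindex) (auto intro: inj_onI)
  also have "\<dots> \<le> real t ^ j" by (intro sum_level_size_le) auto
  also have "\<dots> \<le> (48 * real h) ^ j" using h by (intro power_mono) auto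
  also have "\<dots> = real h ^ j * 48 ^ j" by (simp add: power_mult_distrib)
  finally have "?C ^ L \<le> 48 ^ j" using h by simp
  also have "(48::real) ^ j \<le> 48 ^ (48 * L)" using L by (intro power_increasing) auto
  also have "\<dots> = (48 ^ 48) ^ L" by (rule power_mult)
  also have "\<dots> < (49 ^ 48) ^ L" using L by (intro power_strict_mono) auto
  finally show False by (simp add: window_const_def)
qed

lemma window_ratio:
  assumes j: "48 \<le> j" and k: "bulk (Suc j) k" and u: "u < t" "u' < t"
  shows "level_size j (k - int u) \<le> window_const * level_size j (k - int u')"
proof (cases "u \<le> u'")
  case True
  then show ?thesis using j k u unfolding bulk_def by (intro window_ratio_up[where k = k]) auto
next
  case False
  let ?m = "(int t - 1) * int j"
  \<comment> \<open>Reflecting the ranks reverses the window; the other half of \<open>bulk\<close>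
    supplies the hypothesis.\<close>
  have "level_size j (?m - (k - int u)) \<le> window_const * level_size j (?m - (k - int u'))"
    using j k u False unfolding bulk_def
    by (intro window_ratio_up[where k = "(int t - 1) * int (Suc j) - k"]) (auto simp: algebra_simps)
  then show ?thesis by (simp only: level_size_sym)
qed

text \<open>The conditional probability of raising the last coordinate when its value is
  \<open>y\<close>. Values start at 1 but \<open>last_frac\<close> is indexed from 0, hence
  \<open>y - 1\<close>; for a value that does not occur the quotient is 0 by convention.\<close>

definition step_prob :: "nat \<Rightarrow> int \<Rightarrow> nat \<Rightarrow> real" where
  "step_prob j k y = last_flow j k y / last_frac j k (y - 1)"

lemma step_prob_range:
  assumes "0 \<le> k" "k < (int t - 1) * int (Suc j)" "y \<in> {1..t}"
  shows "0 \<le> step_prob j k y" "step_prob j k y \<le> 1"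
proof -
  show "0 \<le> step_prob j k y"
    unfolding step_prob_def using assms
    by (intro divide_nonneg_nonneg last_flow_nonneg last_frac_nonneg) auto
  have "last_flow j k (Suc (y - 1)) \<le> last_frac j k (y - 1)"
    using assms by (intro last_flow_le_frac) auto
  then show "step_prob j k y \<le> 1"
    unfolding step_prob_def using assms last_frac_nonneg[of j k "y - 1"] by (auto simp: divide_le_eq)
qed

lemma step_prob_bulk:
  assumes j: "48 \<le> j" and k: "bulk (Suc j) k" and y: "y \<in> {1..t}"
  shows "step_prob j k y \<le> 2 * window_const ^ 3 / real (Suc j)"
proof (cases "level_size j (k - int (y - 1)) = 0")
  case True
  then show ?thesis using window_const_pos by (simp add: step_prob_def last_frac_def)
next
  case False
  have ts: "0 < int t * int (Suc j)" using t2 by simp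
  have k': "0 \<le> k" "k < (int t - 1) * int (Suc j)"
    using k less_le_trans[OF ts] unfolding bulk_def by fastforce+
  have pos: "0 < level_size j (k - int (y - 1))" using False level_size_nonneg[of j] by (simp add: less_le)
  have "last_flow j k (Suc (y - 1)) \<le> 2 * window_const ^ 3 / real (Suc j) * last_frac j k (y - 1)"
    using y by (intro last_flow_bound k' pos window_ratio j k) auto
  moreover have "0 < last_frac j k (y - 1)"
    using pos size_k[OF k'] by (simp add: last_frac_def)
  ultimately show ?thesis using y by (simp add: step_prob_def divide_le_eq)
qed

section \<open>Exponential tails outside the bulk\<close>

lemma exp_weight_sum: "(\<Sum>v\<in>{1..t}. exp (- ((real v - 1) / real t))) \<le> 7 / 8 * real t"
proof -
  have half: "exp (- y) \<le> 1 - y / 2" if "0 \<le> y" "y \<le> 1" for y :: real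
  proof -
    have "1 \<le> (1 - y / 2) * (1 + y)"
      using that mult_right_mono[of y 1 y] by (simp add: algebra_simps power2_eq_square)
    also have "\<dots> \<le> (1 - y / 2) * exp y"
      using that exp_ge_add_one_self[of y] by (intro mult_left_mono) auto
    finally show ?thesis by (simp add: exp_minus field_simps)
  qed
  have "(\<Sum>v\<in>{1..t}. exp (- ((real v - 1) / real t))) \<le> (\<Sum>v\<in>{1..t}. 1 - (real v - 1) / real t / 2)"
    using t2 by (intro sum_mono half) (auto simp: divide_simps)
  also have "\<dots> = real t - (\<Sum>v\<in>{1..t}. real v - 1) / (2 * real t)"
    by (subst sum_subtractf) (simp add: sum_divide_distrib sum_subtractf diff_divide_distrib mult.commute)
  also have "(\<Sum>v\<in>{1..t}. real v - 1) = real t * (real t - 1) / 2"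
    by (induction t) (auto simp: field_simps)
  \<comment> \<open>The left-hand side is \<open>3/4 * t + 1/4\<close>; the factor
    \<open>7/8\<close> is what \<open>t = 2\<close> requires.\<close>
  also have "real t - real t * (real t - 1) / 2 / (2 * real t) \<le> 7 / 8 * real t"
    using t2 by (simp add: field_simps)
  finally show ?thesis .
qed

lemma exp_one_sixteenth: "exp (1 / 16 :: real) \<le> 16 / 15"
  using exp_ge_add_one_self[of "- 1 / 16"] by (simp add: exp_minus field_simps)

text \<open>Markov's inequality for the exponential moment: each coordinate contributes a factor
  \<open>exp (1/16) * 7/8\<close>, at most \<open>16/15 * 7/8 = 14/15\<close>. The function
  \<open>c\<close> is general so that both tails are covered, by \<open>v - 1\<close> and
  \<open>t - v\<close>.\<close>

lemma exp_tail:
  assumes "finite S" and c: "(\<Sum>v\<in>{1..t}. exp (- (c v / real t))) \<le> 7 / 8 * real t"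
  shows "(\<Sum>x\<in>S \<rightarrow>\<^sub>E {1..t}. of_bool (16 * (\<Sum>i\<in>S. c (x i)) < real t * real (card S)))
    \<le> (14 / 15) ^ card S * real t ^ card S"
proof -
  have "(\<Sum>x\<in>S \<rightarrow>\<^sub>E {1..t}. of_bool (16 * (\<Sum>i\<in>S. c (x i)) < real t * real (card S)))
      \<le> (\<Sum>x\<in>S \<rightarrow>\<^sub>E {1..t}. exp (1 / 16) ^ card S * (\<Prod>i\<in>S. exp (- (c (x i) / real t))))"
  proof (rule sum_mono)
    fix x
    have "exp (1 / 16) ^ card S * (\<Prod>i\<in>S. exp (- (c (x i) / real t)))
        = exp (real (card S) / 16 - (\<Sum>i\<in>S. c (x i)) / real t)"
      using assms(1) by (simp add: exp_of_nat_mult[symmetric] exp_sum[symmetric] sum_negf sum_divide_distrib flip: exp_add)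
    moreover have "1 \<le> exp (real (card S) / 16 - (\<Sum>i\<in>S. c (x i)) / real t)"
      if "16 * (\<Sum>i\<in>S. c (x i)) < real t * real (card S)"
      using that t2 by (simp add: field_simps)
    ultimately show "of_bool (16 * (\<Sum>i\<in>S. c (x i)) < real t * real (card S))
        \<le> exp (1 / 16) ^ card S * (\<Prod>i\<in>S. exp (- (c (x i) / real t)))"
      by (simp add: of_bool_def)
  qed
  also have "\<dots> = exp (1 / 16) ^ card S * (\<Sum>v\<in>{1..t}. exp (- (c v / real t))) ^ card S"
    using prod_sum_PiE[OF assms(1), of "\<lambda>_. {1..t}" "\<lambda>_ v. exp (- (c v / real t))"]
    by (simp add: sum_distrib_left)
  also have "\<dots> \<le> (16 / 15) ^ card S * (7 / 8 * real t) ^ card S"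
    by (intro mult_mono power_mono exp_one_sixteenth c) (auto intro!: zero_le_power sum_nonneg)
  also have "\<dots> = (14 / 15) ^ card S * real t ^ card S"
    by (simp flip: power_mult_distrib)
  finally show ?thesis .
qed

lemma tail_mass:
  assumes "finite S"
  shows "(\<Sum>x\<in>S \<rightarrow>\<^sub>E {1..t}. of_bool (\<not> bulk (card S) (coord_rank S x)))
    \<le> 2 * (14 / 15) ^ card S * real t ^ card S"
proof -
  let ?c = "\<lambda>v. real v - 1" and ?c' = "\<lambda>v. real t - real v"
  have rk: "of_int (coord_rank S x) = (\<Sum>i\<in>S. ?c (x i))" for x
    by (simp add: coord_rank_def)
  have rk': "of_int ((int t - 1) * int (card S) - coord_rank S x) = (\<Sum>i\<in>S. ?c' (x i))" for x
    by (simp add: coord_rank_def sum_subtractf algebra_simps)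
  have split: "of_bool (\<not> bulk (card S) (coord_rank S x))
      \<le> of_bool (16 * (\<Sum>i\<in>S. ?c (x i)) < real t * real (card S))
        + (of_bool (16 * (\<Sum>i\<in>S. ?c' (x i)) < real t * real (card S)) :: real)" for x
  proof -
    have "\<not> bulk (card S) (coord_rank S x) \<longleftrightarrow>
        16 * (\<Sum>i\<in>S. ?c (x i)) < real t * real (card S) \<or> 16 * (\<Sum>i\<in>S. ?c' (x i)) < real t * real (card S)"
      unfolding bulk_def rk[symmetric] rk'[symmetric] not_le de_Morgan_conj
      by (simp only: of_int_less_iff[where 'a = real, symmetric]) simp
    then show ?thesis by (auto simp: of_bool_def)
  qed
  have rev: "(\<Sum>v\<in>{1..t}. exp (- (?c' v / real t))) = (\<Sum>v\<in>{1..t}. exp (- (?c v / real t)))"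
    by (rule sum.reindex_bij_witness[of _ "\<lambda>v. t + 1 - v" "\<lambda>v. t + 1 - v"]) (auto simp: of_nat_diff)
  have "(\<Sum>x\<in>S \<rightarrow>\<^sub>E {1..t}. of_bool (\<not> bulk (card S) (coord_rank S x)))
      \<le> (\<Sum>x\<in>S \<rightarrow>\<^sub>E {1..t}. of_bool (16 * (\<Sum>i\<in>S. ?c (x i)) < real t * real (card S)))
        + (\<Sum>x\<in>S \<rightarrow>\<^sub>E {1..t}. of_bool (16 * (\<Sum>i\<in>S. ?c' (x i)) < real t * real (card S)) :: real)"
    unfolding sum.distrib[symmetric] by (intro sum_mono split)
  also have "\<dots> \<le> (14 / 15) ^ card S * real t ^ card S + (14 / 15) ^ card S * real t ^ card S"
    by (intro add_mono exp_tail assms) (use exp_weight_sum rev in auto)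
  also have "\<dots> = 2 * (14 / 15) ^ card S * real t ^ card S" by simp
  finally show ?thesis .
qed

end

section \<open>The symmetrised flow\<close>

context grid
begin

text \<open>Deleting the coordinates in random order and deciding at each stage whether the deleted
  coordinate is the one to be raised. The case distinction makes the flow vanish at the top element.\<close>

fun sym_flow :: "nat \<Rightarrow> nat set \<Rightarrow> (nat \<Rightarrow> nat) \<Rightarrow> nat \<Rightarrow> real" where
  "sym_flow 0 S x i = 0"
| "sym_flow (Suc j) S x i = (if coord_rank S x < (int t - 1) * int (Suc j) then
     (\<Sum>l\<in>S. if l = i then step_prob j (coord_rank S x) (x l)
        else (1 - step_prob j (coord_rank S x) (x l)) * sym_flow j (S - {l}) x i) / real (Suc j) else 0)"

declare sym_flow.simps(2) [simp del]

section \<open>Row sums and column sums of the symmetrised flow\<close>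

lemma coord_rank_range:
  assumes "\<And>i. i \<in> S \<Longrightarrow> x i \<in> {1..t}"
  shows "0 \<le> coord_rank S x" "coord_rank S x \<le> (int t - 1) * int (card S)"
proof -
  have b: "0 \<le> int (x i) - 1 \<and> int (x i) - 1 \<le> int t - 1" if "i \<in> S" for i
    using assms[OF that] by auto
  show "0 \<le> coord_rank S x" unfolding coord_rank_def using b by (intro sum_nonneg) auto
  have "coord_rank S x \<le> (\<Sum>i\<in>S. int t - 1)"
    unfolding coord_rank_def using b by (intro sum_mono) auto
  then show "coord_rank S x \<le> (int t - 1) * int (card S)" by (simp add: mult.commute)
qed

lemma sym_flow_nonneg:
  assumes "finite S" "card S = s" "\<And>i. i \<in> S \<Longrightarrow> x i \<in> {1..t}"
  shows "0 \<le> sym_flow s S x i"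
  using assms
proof (induction s arbitrary: S)
  case (Suc j)
  show ?case
  proof (cases "coord_rank S x < (int t - 1) * int (Suc j)")
    case True
    have *: "0 \<le> (if l = i then step_prob j (coord_rank S x) (x l)
        else (1 - step_prob j (coord_rank S x) (x l)) * sym_flow j (S - {l}) x i)" if l: "l \<in> S" for l
    proof -
      have "0 \<le> sym_flow j (S - {l}) x i" using Suc.prems l by (intro Suc.IH) auto
      then show ?thesis
        using step_prob_range[OF coord_rank_range(1) True, of "x l"] Suc.prems(3) l by auto
    qed
    show ?thesis unfolding sym_flow.simps using True
      by (simp only: if_True) (intro divide_nonneg_nonneg sum_nonneg *, simp_all)
  qed (simp add: sym_flow.simps)
qed simp

lemma sum_sym_flow_swap:
  assumes "finite S"
  shows "(\<Sum>i\<in>S. \<Sum>l\<in>S. if l = i then p l else q l * r l i)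
    = (\<Sum>l\<in>S. p l + q l * (\<Sum>i\<in>S - {l}. r l i :: real))"
proof (subst sum.swap, rule sum.cong[OF refl])
  fix l assume l: "l \<in> S"
  have "(\<Sum>i\<in>S. if l = i then p l else q l * r l i) = p l + (\<Sum>i\<in>S - {l}. if l = i then p l else q l * r l i)"
    using assms l by (subst sum.remove[of _ l]) auto
  also have "(\<Sum>i\<in>S - {l}. if l = i then p l else q l * r l i) = (\<Sum>i\<in>S - {l}. q l * r l i)"
    by (intro sum.cong) auto
  finally show "(\<Sum>i\<in>S. if l = i then p l else q l * r l i) = p l + q l * (\<Sum>i\<in>S - {l}. r l i)"
    by (simp add: sum_distrib_left)
qed

text \<open>For every deleted coordinate \<open>l\<close> the total is
  \<open>p + (1 - p) * 1\<close>, where \<open>p\<close> is the probability of raising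
  \<open>l\<close>.\<close>

lemma sum_sym_flow:
  assumes "finite S" "card S = s" "\<And>i. i \<in> S \<Longrightarrow> x i \<in> {1..t}"
    and "coord_rank S x < (int t - 1) * int s"
  shows "(\<Sum>i\<in>S. sym_flow s S x i) = 1"
  using assms
proof (induction s arbitrary: S)
  case 0
  then show ?case by (simp add: coord_rank_def)
next
  case (Suc j)
  let ?k = "coord_rank S x"
  note k = coord_rank_range(1)[of S x, OF Suc.prems(3)] Suc.prems(4)
  have "step_prob j ?k (x l) + (1 - step_prob j ?k (x l)) * (\<Sum>i\<in>S - {l}. sym_flow j (S - {l}) x i) = 1"
    if l: "l \<in> S" for l
  proof (cases "coord_rank (S - {l}) x < (int t - 1) * int j")
    case True
    then have "(\<Sum>i\<in>S - {l}. sym_flow j (S - {l}) x i) = 1"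
      using Suc.prems l by (intro Suc.IH) auto
    then show ?thesis by simp
  next
    \<comment> \<open>The remaining coordinates are at their top, where the recursive flow vanishes.
      By \<open>last_flow_full\<close> coordinate \<open>l\<close> is then raised with probability
      1.\<close>
    case False
    have xl: "x l \<in> {1..t}" using Suc.prems l by auto
    have "coord_rank (S - {l}) x \<le> (int t - 1) * int (card (S - {l}))"
      using Suc.prems by (intro coord_rank_range) auto
    then have full: "coord_rank (S - {l}) x = (int t - 1) * int j"
      using False Suc.prems l by (simp add: card_Diff_singleton)
    then have kv: "?k - int (x l - 1) = (int t - 1) * int j"
      using coord_rank_remove[OF Suc.prems(1) l, of x] xl by (auto simp: of_nat_diff)
    have "last_flow j ?k (Suc (x l - 1)) = last_frac j ?k (x l - 1)"
      using xl by (intro last_flow_full k kv) auto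
    moreover have "0 < last_frac j ?k (x l - 1)"
      unfolding last_frac_def kv by (intro divide_pos_pos size_k[OF k] level_size_pos) (use t2 in auto)
    ultimately have "step_prob j ?k (x l) = 1" using xl by (simp add: step_prob_def)
    then show ?thesis by simp
  qed
  then show ?case
    using Suc.prems by (simp add: sym_flow.simps sum_sym_flow_swap flip: sum_divide_distrib)
qed

lemma sym_flow_top:
  assumes "finite S" "card S = s" "\<And>i. i \<in> S \<Longrightarrow> x i \<in> {1..t}" "i \<in> S" "x i = t"
  shows "sym_flow s S x i = 0"
  using assms
proof (induction s arbitrary: S)
  case (Suc j)
  show ?case
  proof (cases "coord_rank S x < (int t - 1) * int (Suc j)")
    case True
    have "(if l = i then step_prob j (coord_rank S x) (x l)
        else (1 - step_prob j (coord_rank S x) (x l)) * sym_flow j (S - {l}) x i) = 0" if l: "l \<in> S" for l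
    proof (cases "l = i")
      case True
      then show ?thesis using Suc.prems last_flow_t[OF coord_rank_range(1)] \<open>coord_rank S x < _\<close>
        by (simp add: step_prob_def)
    next
      case False
      then have "sym_flow j (S - {l}) x i = 0" using Suc.prems l by (intro Suc.IH) auto
      then show ?thesis using False by simp
    qed
    then show ?thesis using True by (auto simp: sym_flow.simps intro!: sum.neutral)
  qed (simp add: sym_flow.simps)
qed simp

text \<open>Conservation of mass at the 0-based value \<open>v\<close> in rank \<open>k + 1\<close>:
  what is raised from \<open>v - 1\<close> and what stays at \<open>v\<close> add up to
  \<open>last_frac j (k + 1) v\<close>. The equation is scaled to the form that the induction in
  \<open>sym_flow_in\<close> produces.\<close>

lemma step_prob_balance:
  assumes k: "0 \<le> k" "k < (int t - 1) * int (Suc j)" and v: "v < t" and pos: "0 < level_size j (k + 1 - int v)"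
  shows "(if v = 0 then 0 else step_prob j k v)
      + (1 - step_prob j k (Suc v)) * (level_size j (k - int v) / level_size j (k + 1 - int v))
    = level_size (Suc j) k / level_size (Suc j) (k + 1)"
proof -
  let ?N = "level_size (Suc j) k" and ?N' = "level_size (Suc j) (k + 1)" and ?g = "level_size j (k + 1 - int v)"
  have N: "0 < ?N" "0 < ?N'" using size_k[OF k] size_k1[OF k] .
  have 1: "(if v = 0 then 0 else step_prob j k v) = last_flow j k v * (?N / ?g)"
  proof (cases "v = 0")
    case False
    then have eq: "k - int (v - 1) = k + 1 - int v" by (simp add: of_nat_diff)
    show ?thesis unfolding step_prob_def last_frac_def eq using False by simp
  qed (simp add: last_flow_0[OF k])
  have 2: "(1 - step_prob j k (Suc v)) * (level_size j (k - int v) / ?g)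
      = (last_frac j k v - last_flow j k (Suc v)) * (?N / ?g)"
  proof (cases "level_size j (k - int v) = 0")
    case True
    then have "last_frac j k v = 0" by (simp add: last_frac_def)
    moreover have "last_flow j k (Suc v) = 0"
      using last_flow_le_frac[OF k v] last_flow_nonneg[OF k, of "Suc v"] v calculation by simp
    ultimately show ?thesis using True by simp
  next
    case False
    then have f: "0 < last_frac j k v"
      using N level_size_nonneg[of j "k - int v"] unfolding last_frac_def by (intro divide_pos_pos) auto
    have g: "level_size j (k - int v) = last_frac j k v * ?N" using N by (simp add: last_frac_def)
    have p: "1 - step_prob j k (Suc v) = (last_frac j k v - last_flow j k (Suc v)) / last_frac j k v"
      using f by (simp add: step_prob_def diff_divide_distrib)
    show ?thesis unfolding g p using f by simp
  qed
  have "last_flow j k v + (last_frac j k v - last_flow j k (Suc v)) = last_frac j (k + 1) v"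
    by (simp add: last_flow_def)
  then have "last_flow j k v * (?N / ?g) + (last_frac j k v - last_flow j k (Suc v)) * (?N / ?g)
      = last_frac j (k + 1) v * (?N / ?g)"
    by (simp only: distrib_right[symmetric])
  also have "\<dots> = ?N / ?N'" using pos by (simp add: last_frac_def)
  finally show ?thesis unfolding 1 2 .
qed

lemma coord_rank_lower:
  assumes "finite S" "i \<in> S" "2 \<le> y i"
  shows "coord_rank S (y(i := y i - 1)) = coord_rank S y - 1"
proof -
  have "coord_rank (S - {i}) (y(i := y i - 1)) = coord_rank (S - {i}) y"
    by (rule coord_rank_cong) auto
  then show ?thesis
    using assms coord_rank_remove[OF assms(1,2), of "y(i := y i - 1)"] coord_rank_remove[OF assms(1,2), of y]
    by (simp add: of_nat_diff)
qed

text \<open>The inflow is the same at every element of rank \<open>k + 1\<close>, so the flow maps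
  the uniform distribution to the uniform one. For each deleted coordinate \<open>l\<close>
  separately, the induction hypothesis and \<open>step_prob_balance\<close> give this value, and the
  average over \<open>l\<close> keeps it.\<close>

lemma sym_flow_in:
  assumes "finite S" "card S = s" "\<And>i. i \<in> S \<Longrightarrow> y i \<in> {1..t}" "coord_rank S y = k + 1"
  shows "(\<Sum>i\<in>{i\<in>S. 2 \<le> y i}. sym_flow s S (y(i := y i - 1)) i) = level_size s k / level_size s (k + 1)"
  using assms
proof (induction s arbitrary: S k)
  case 0
  then have "S = {}" "k = - 1" by (auto simp: coord_rank_def)
  then show ?case by simp
next
  case (Suc j)
  have k1: "- 1 \<le> k" "k < (int t - 1) * int (Suc j)"
    using coord_rank_range[of S y, OF Suc.prems(3)] Suc.prems by auto
  show ?case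
  \<comment> \<open>The bottom element has no lower neighbours and receives nothing. The case cannot
    be left out, since the induction hypothesis is applied at \<open>k - int v\<close>, which may be
    \<open>- 1\<close>.\<close>
  proof (cases "k = - 1")
    case True
    have "y i = 1" if "i \<in> S" for i
    proof -
      have "(\<Sum>i\<in>S. int (y i) - 1) = 0" using Suc.prems True by (simp add: coord_rank_def)
      moreover have "0 \<le> int (y i) - 1" if "i \<in> S" for i using Suc.prems(3)[OF that] by auto
      ultimately have "\<forall>i\<in>S. int (y i) - 1 = 0" using Suc.prems(1) by (subst (asm) sum_nonneg_eq_0_iff) auto
      then show ?thesis using that by auto
    qed
    then have empty: "{i\<in>S. 2 \<le> y i} = {}" by auto
    show ?thesis unfolding empty using True level_size_outside[of "- 1"] by simp
  next
    case False
    then have k: "0 \<le> k" "k < (int t - 1) * int (Suc j)" using k1 by auto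
    let ?S = "{i\<in>S. 2 \<le> y i}" and ?p = "step_prob j k"
    let ?T = "\<lambda>i l. if l = i then ?p (y l - 1) else (1 - ?p (y l)) * sym_flow j (S - {l}) (y(i := y i - 1)) i"
    let ?rhs = "level_size (Suc j) k / level_size (Suc j) (k + 1)"
    have fl: "sym_flow (Suc j) S (y(i := y i - 1)) i = (\<Sum>l\<in>S. if l = i then ?p (y l - 1)
        else (1 - ?p (y l)) * sym_flow j (S - {l}) (y(i := y i - 1)) i) / real (Suc j)" if i: "i \<in> ?S" for i
      using coord_rank_lower[of S i y] i Suc.prems k by (auto simp: sym_flow.simps intro!: sum.cong)
    have "(\<Sum>i\<in>?S. ?T i l) = ?rhs"
      if l: "l \<in> S" for l
    proof -
      define v where "v = y l - 1"
      have v: "v < t" "y l = Suc v" using Suc.prems(3)[OF l] by (auto simp: v_def)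
      have rk: "coord_rank (S - {l}) y = k - int v + 1"
        using coord_rank_remove[OF Suc.prems(1) l, of y] Suc.prems(4) v by simp
      have "0 \<le> coord_rank (S - {l}) y" "coord_rank (S - {l}) y \<le> (int t - 1) * int (card (S - {l}))"
        using Suc.prems by (intro coord_rank_range; auto)+
      then have pos: "0 < level_size j (k + 1 - int v)"
        using rk Suc.prems l by (intro level_size_pos) (auto simp: card_Diff_singleton)
      have IH: "(\<Sum>i\<in>{i\<in>S - {l}. 2 \<le> y i}. sym_flow j (S - {l}) (y(i := y i - 1)) i)
          = level_size j (k - int v) / level_size j (k - int v + 1)"
        using Suc.prems l rk by (intro Suc.IH) auto
      have S': "?S - {l} = {i\<in>S - {l}. 2 \<le> y i}" by auto
      have "(\<Sum>i\<in>?S. ?T i l)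
          = (if v = 0 then 0 else ?p v)
            + (\<Sum>i\<in>?S - {l}. ?T i l)"
      proof (cases "v = 0")
        case True
        then have "l \<notin> ?S" using v by auto
        then show ?thesis using True by simp
      next
        case False
        then have "l \<in> ?S" using v l by auto
        then show ?thesis using False Suc.prems(1) v by (subst sum.remove[of _ l]) auto
      qed
      also have "(\<Sum>i\<in>?S - {l}. ?T i l)
          = (1 - ?p (Suc v)) * (\<Sum>i\<in>?S - {l}. sym_flow j (S - {l}) (y(i := y i - 1)) i)"
        unfolding sum_distrib_left using v by (intro sum.cong) auto
      also have "(\<Sum>i\<in>?S - {l}. sym_flow j (S - {l}) (y(i := y i - 1)) i)
          = level_size j (k - int v) / level_size j (k + 1 - int v)"
        unfolding S' IH by (simp add: algebra_simps)
      also have "(if v = 0 then 0 else ?p v) + (1 - ?p (Suc v)) * (level_size j (k - int v) / level_size j (k + 1 - int v)) = ?rhs"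
        by (rule step_prob_balance[OF k v(1) pos])
      finally show ?thesis .
    qed
    then have "(\<Sum>l\<in>S. \<Sum>i\<in>?S. ?T i l)
        = real (Suc j) * ?rhs"
      using Suc.prems(2) by simp
    then have "(\<Sum>i\<in>?S. \<Sum>l\<in>S. ?T i l)
        = real (Suc j) * ?rhs"
      by (subst sum.swap)
    moreover have "(\<Sum>i\<in>?S. sym_flow (Suc j) S (y(i := y i - 1)) i)
        = (\<Sum>i\<in>?S. \<Sum>l\<in>S. ?T i l) / real (Suc j)"
      by (subst sum_divide_distrib) (rule sum.cong[OF refl], rule fl)
    ultimately show ?thesis by (simp del: fun_upd_apply)
  qed
qed

text \<open>The last \<open>j0\<close> stages, with few coordinates left, get the trivial bound 1:
  \<open>step_prob_bulk\<close> requires \<open>48 \<le> j\<close>, and the tails are small only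
  from a large \<open>j0\<close> on.\<close>

definition stage_bound :: "nat \<Rightarrow> nat \<Rightarrow> real" where
  "stage_bound j0 j = (if j < j0 then 1 else 2 * window_const ^ 3 / real (Suc j))"

text \<open>The contribution of the stages at which the remaining rank is outside the bulk.\<close>

fun flow_err :: "nat \<Rightarrow> nat \<Rightarrow> nat set \<Rightarrow> (nat \<Rightarrow> nat) \<Rightarrow> nat \<Rightarrow> real" where
  "flow_err j0 0 S x i = 0"
| "flow_err j0 (Suc j) S x i = (of_bool (j0 \<le> j \<and> \<not> bulk (Suc j) (coord_rank S x))
     + (\<Sum>l\<in>S - {i}. flow_err j0 j (S - {l}) x i)) / real (Suc j)"

declare flow_err.simps(2) [simp del]

lemma flow_err_nonneg: "0 \<le> flow_err j0 s S x i"
  by (induction s arbitrary: S) (auto simp: flow_err.simps intro!: divide_nonneg_nonneg add_nonneg_nonneg sum_nonneg)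

text \<open>In a random deletion order, coordinate \<open>i\<close> is deleted at each stage with
  the same probability \<open>1 / s\<close>. Accordingly the bound \<open>?D / j\<close> of the
  smaller face, weighted by \<open>j / (j + 1)\<close>, and the new stage bound, weighted by
  \<open>1 / (j + 1)\<close>, combine to an average again.\<close>

lemma sym_flow_le:
  assumes "finite S" "card S = s" "\<And>i. i \<in> S \<Longrightarrow> x i \<in> {1..t}" "i \<in> S" "48 \<le> j0"
  shows "sym_flow s S x i \<le> (\<Sum>j<s. stage_bound j0 j) / real s + flow_err j0 s S x i"
  using assms(1-4)
proof (induction s arbitrary: S)
  case (Suc j)
  let ?k = "coord_rank S x" and ?D = "\<Sum>j<j. stage_bound j0 j"
  let ?b = "of_bool (j0 \<le> j \<and> \<not> bulk (Suc j) ?k) :: real"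
  let ?T = "\<lambda>l. if l = i then step_prob j ?k (x l) else (1 - step_prob j ?k (x l)) * sym_flow j (S - {l}) x i"
  have D0: "0 \<le> stage_bound j0 j" for j using window_const_pos by (simp add: stage_bound_def)
  show ?case
  proof (cases "?k < (int t - 1) * int (Suc j)")
    case True
    have "0 \<le> ?k" using Suc.prems(3) by (rule coord_rank_range(1))
    note p = step_prob_range[OF this True]
    have pi: "step_prob j ?k (x i) \<le> stage_bound j0 j + ?b"
    proof (cases "j < j0 \<or> \<not> bulk (Suc j) ?k")
      case True
      then have "1 \<le> stage_bound j0 j + ?b" using D0[of j] by (auto simp: stage_bound_def)
      then show ?thesis using p(2)[OF Suc.prems(3)[OF Suc.prems(4)]] by linarith
    next
      case False
      then show ?thesis
        using step_prob_bulk[of j ?k "x i"] assms(5) Suc.prems(3)[OF Suc.prems(4)] by (auto simp: stage_bound_def)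
    qed
    have "(\<Sum>l\<in>S - {i}. (1 - step_prob j ?k (x l)) * sym_flow j (S - {l}) x i)
        \<le> (\<Sum>l\<in>S - {i}. ?D / real j + flow_err j0 j (S - {l}) x i)"
    proof (rule sum_mono)
      fix l assume l: "l \<in> S - {i}"
      have "(1 - step_prob j ?k (x l)) * sym_flow j (S - {l}) x i \<le> 1 * sym_flow j (S - {l}) x i"
        using p(1)[of "x l"] Suc.prems l by (intro mult_right_mono sym_flow_nonneg) auto
      also have "\<dots> \<le> ?D / real j + flow_err j0 j (S - {l}) x i"
        using Suc.prems l by (simp only: mult_1_left) (intro Suc.IH; auto)
      finally show "(1 - step_prob j ?k (x l)) * sym_flow j (S - {l}) x i \<le> ?D / real j + flow_err j0 j (S - {l}) x i" .
    qed
    also have "\<dots> = ?D + (\<Sum>l\<in>S - {i}. flow_err j0 j (S - {l}) x i)"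
      using Suc.prems by (simp add: sum.distrib card_Diff_singleton)
    finally have rest: "(\<Sum>l\<in>S - {i}. (1 - step_prob j ?k (x l)) * sym_flow j (S - {l}) x i)
        \<le> ?D + (\<Sum>l\<in>S - {i}. flow_err j0 j (S - {l}) x i)" .
    have "(\<Sum>l\<in>S. ?T l)
        = step_prob j ?k (x i) + (\<Sum>l\<in>S - {i}. ?T l)"
      using Suc.prems by (subst sum.remove[of _ i]) auto
    also have "(\<Sum>l\<in>S - {i}. ?T l)
        = (\<Sum>l\<in>S - {i}. (1 - step_prob j ?k (x l)) * sym_flow j (S - {l}) x i)"
      by (intro sum.cong) auto
    finally have "(\<Sum>l\<in>S. ?T l)
        \<le> (\<Sum>j<Suc j. stage_bound j0 j) + (?b + (\<Sum>l\<in>S - {i}. flow_err j0 j (S - {l}) x i))"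
      using pi rest by simp
    then have "(\<Sum>l\<in>S. ?T l) / real (Suc j)
        \<le> ((\<Sum>j<Suc j. stage_bound j0 j) + (?b + (\<Sum>l\<in>S - {i}. flow_err j0 j (S - {l}) x i))) / real (Suc j)"
      by (rule divide_right_mono) simp
    then show ?thesis
      unfolding sym_flow.simps flow_err.simps add_divide_distrib using True by (simp only: if_True)
  next
    case False
    then show ?thesis using D0 flow_err_nonneg[of j0 "Suc j" S x i]
      by (simp add: sym_flow.simps sum_nonneg del: sum.lessThan_Suc)
  qed
qed simp

lemma flow_err_cong:
  assumes "\<And>i. i \<in> S \<Longrightarrow> x i = y i"
  shows "flow_err j0 s S x i = flow_err j0 s S y i"
  using assms
proof (induction s arbitrary: S)
  case (Suc j)
  have "flow_err j0 j (S - {l}) x i = flow_err j0 j (S - {l}) y i" for l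
    using Suc.prems by (intro Suc.IH) auto
  then show ?case using Suc.prems coord_rank_cong[of S x y] by (simp add: flow_err.simps)
qed simp

text \<open>\<open>flow_err\<close> on \<open>S - {l}\<close> ignores coordinate \<open>l\<close>,
  so summing over that coordinate only contributes a factor \<open>t\<close> and leaves a uniform
  element of the smaller face. \<open>tail_mass\<close> then applies at each stage.\<close>

lemma sum_flow_err:
  assumes "finite S" "card S = s"
  shows "(\<Sum>x\<in>S \<rightarrow>\<^sub>E {1..t}. \<Sum>i\<in>S. flow_err j0 s S x i)
    \<le> real t ^ s * (\<Sum>j\<in>{j0..<s}. 2 * (14 / 15) ^ Suc j)"
  using assms
proof (induction s arbitrary: S)
  case (Suc j)
  let ?b = "\<lambda>x. of_bool (j0 \<le> j \<and> \<not> bulk (Suc j) (coord_rank S x)) :: real"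
  let ?B = "\<Sum>j\<in>{j0..<j}. 2 * (14 / 15) ^ Suc j :: real"
  have row: "(\<Sum>i\<in>S. flow_err j0 (Suc j) S x i)
      = ?b x + (\<Sum>l\<in>S. \<Sum>i\<in>S - {l}. flow_err j0 j (S - {l}) x i) / real (Suc j)" for x
  proof -
    have "(\<Sum>i\<in>S. \<Sum>l\<in>S - {i}. flow_err j0 j (S - {l}) x i)
        = (\<Sum>i\<in>S. \<Sum>l | l \<in> S \<and> l \<noteq> i. flow_err j0 j (S - {l}) x i)"
      by (intro sum.cong) auto
    also have "\<dots> = (\<Sum>l\<in>S. \<Sum>i | i \<in> S \<and> l \<noteq> i. flow_err j0 j (S - {l}) x i)"
      by (rule sum.swap_restrict) (use Suc.prems in auto)
    also have "\<dots> = (\<Sum>l\<in>S. \<Sum>i\<in>S - {l}. flow_err j0 j (S - {l}) x i)"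
      by (intro sum.cong) auto
    finally show ?thesis
      using Suc.prems by (simp add: flow_err.simps sum.distrib flip: sum_divide_distrib)
        (simp add: add_divide_distrib del: of_nat_Suc)
  qed
  have inner: "(\<Sum>x\<in>S \<rightarrow>\<^sub>E {1..t}. \<Sum>i\<in>S - {l}. flow_err j0 j (S - {l}) x i) \<le> real t ^ Suc j * ?B"
    if l: "l \<in> S" for l
  proof -
    have "(\<Sum>x\<in>S \<rightarrow>\<^sub>E {1..t}. \<Sum>i\<in>S - {l}. flow_err j0 j (S - {l}) x i)
        = (\<Sum>v\<in>{1..t}. \<Sum>x\<in>S - {l} \<rightarrow>\<^sub>E {1..t}. \<Sum>i\<in>S - {l}. flow_err j0 j (S - {l}) (x(l := v)) i)"
      using sum_PiE_insert[of "S - {l}" l "\<lambda>x. \<Sum>i\<in>S - {l}. flow_err j0 j (S - {l}) x i" "{1..t}"] Suc.prems l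
      by (simp add: insert_absorb)
    also have "\<dots> = real t * (\<Sum>x\<in>S - {l} \<rightarrow>\<^sub>E {1..t}. \<Sum>i\<in>S - {l}. flow_err j0 j (S - {l}) x i)"
    proof -
      have "flow_err j0 j (S - {l}) (x(l := v)) i = flow_err j0 j (S - {l}) x i" for x v i
        by (rule flow_err_cong) auto
      then show ?thesis by simp
    qed
    also have "\<dots> \<le> real t * (real t ^ j * ?B)"
      using Suc.prems l by (intro mult_left_mono Suc.IH) auto
    finally show ?thesis by simp
  qed
  have "(\<Sum>x\<in>S \<rightarrow>\<^sub>E {1..t}. \<Sum>i\<in>S. flow_err j0 (Suc j) S x i)
      = (\<Sum>x\<in>S \<rightarrow>\<^sub>E {1..t}. ?b x)
        + (\<Sum>l\<in>S. \<Sum>x\<in>S \<rightarrow>\<^sub>E {1..t}. \<Sum>i\<in>S - {l}. flow_err j0 j (S - {l}) x i) / real (Suc j)"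
    unfolding row sum.distrib by (subst (2) sum.swap) (simp only: sum_divide_distrib)
  also have "\<dots> \<le> (if j0 \<le> j then 2 * (14 / 15) ^ Suc j * real t ^ Suc j else 0)
        + (\<Sum>l\<in>S. real t ^ Suc j * ?B) / real (Suc j)"
  proof (intro add_mono divide_right_mono sum_mono inner)
    show "(\<Sum>x\<in>S \<rightarrow>\<^sub>E {1..t}. ?b x) \<le> (if j0 \<le> j then 2 * (14 / 15) ^ Suc j * real t ^ Suc j else 0)"
      using tail_mass[OF Suc.prems(1)] Suc.prems(2) by simp
  qed auto
  also have "(\<Sum>l\<in>S. real t ^ Suc j * ?B) / real (Suc j) = real t ^ Suc j * ?B"
    using Suc.prems by simp
  also have "(if j0 \<le> j then 2 * (14 / 15) ^ Suc j * real t ^ Suc j else 0) + real t ^ Suc j * ?B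
      = real t ^ Suc j * (\<Sum>j\<in>{j0..<Suc j}. 2 * (14 / 15) ^ Suc j)"
    by (simp add: algebra_simps)
  finally show ?case .
qed simp

text \<open>Masses \<open>w \<le> \<delta>\<close> satisfy
  \<open>- (w * ln w) \<ge> w * ln (1 / \<delta>)\<close>. A mass above \<open>\<delta>\<close> is
  more than twice the stage average, so more than half of it is error and \<open>w - 2 * e\<close>
  is not positive; such coordinates are given up.\<close>

lemma sym_flow_entropy:
  assumes "finite S" "card S = n" "\<And>i. i \<in> S \<Longrightarrow> x i \<in> {1..t}"
    and "coord_rank S x < (int t - 1) * int n" "48 \<le> j0"
    and \<delta>: "0 < \<delta>" "\<delta> \<le> 1" "2 * ((\<Sum>j<n. stage_bound j0 j) / real n) \<le> \<delta>"
  shows "ln (1 / \<delta>) * (1 - 2 * (\<Sum>i\<in>S. flow_err j0 n S x i))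
    \<le> (\<Sum>i\<in>S. - (sym_flow n S x i * ln (sym_flow n S x i)))"
proof -
  let ?w = "sym_flow n S x" and ?e = "flow_err j0 n S x"
  have w0: "0 \<le> ?w i" for i using assms by (intro sym_flow_nonneg) auto
  have w1: "?w i \<le> 1" if "i \<in> S" for i
    using member_le_sum[of i S ?w] that w0 assms(1) sum_sym_flow[OF assms(1-4)] by auto
  have lnd: "0 \<le> ln (1 / \<delta>)" using \<delta> by simp
  have "(\<Sum>i\<in>S. ln (1 / \<delta>) * (?w i - 2 * ?e i)) \<le> (\<Sum>i\<in>S. - (?w i * ln (?w i)))"
  proof (rule sum_mono)
    fix i assume i: "i \<in> S"
    show "ln (1 / \<delta>) * (?w i - 2 * ?e i) \<le> - (?w i * ln (?w i))"
    proof (cases "?w i \<le> \<delta>")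
      case True
      have "ln (1 / \<delta>) * (?w i - 2 * ?e i) \<le> ln (1 / \<delta>) * ?w i"
        using lnd flow_err_nonneg[of j0 n S x i] by (intro mult_left_mono) auto
      also have "\<dots> \<le> - (?w i * ln (?w i))"
      proof (cases "?w i = 0")
        case False
        then have "0 < ?w i" using w0[of i] by simp
        then have "ln (?w i) \<le> ln \<delta>" using True by simp
        from mult_left_mono[OF this w0[of i]] show ?thesis using \<delta> by (simp add: ln_div mult.commute)
      qed simp
      finally show ?thesis .
    next
      case False
      have "?w i \<le> (\<Sum>j<n. stage_bound j0 j) / real n + ?e i"
        using assms i by (intro sym_flow_le) auto
      then have "?w i - 2 * ?e i \<le> 0" using False \<delta>(3) by linarith
      then have "ln (1 / \<delta>) * (?w i - 2 * ?e i) \<le> 0" using lnd by (rule mult_nonneg_nonpos[rotated])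
      also have "0 \<le> - (?w i * ln (?w i))"
        using w0[of i] w1[OF i] False \<delta>(1) by (simp add: mult_nonneg_nonpos)
      finally show ?thesis .
    qed
  qed
  then show ?thesis
    using sum_sym_flow[OF assms(1-4)] by (simp add: sum_subtractf flip: sum_distrib_left)
qed

end

text \<open>A doubly stochastic matrix with rows \<open>A\<close>, \<open>B\<close> and columns \<open>B\<close>, \<open>C\<close>, where an unused element of \<open>B\<close>
  is matched to its own copy, turns a pair of matchings with a common image into one matching.\<close>

lemma card_double_matchings:
  fixes w :: "'a \<Rightarrow> 'b \<Rightarrow> real" and w' :: "'c \<Rightarrow> 'b \<Rightarrow> real"
  assumes fin: "finite A" "finite B" "finite C" and card: "card A = card C"
    and nonneg: "\<And>a b. a \<in> A \<Longrightarrow> b \<in> B \<Longrightarrow> 0 \<le> w a b" "\<And>c b. c \<in> C \<Longrightarrow> b \<in> B \<Longrightarrow> 0 \<le> w' c b"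
    and row: "\<And>a. a \<in> A \<Longrightarrow> (\<Sum>b\<in>B. w a b) = 1" "\<And>c. c \<in> C \<Longrightarrow> (\<Sum>b\<in>B. w' c b) = 1"
    and col: "\<And>b. b \<in> B \<Longrightarrow> (\<Sum>a\<in>A. w a b) = \<nu>" "\<And>b. b \<in> B \<Longrightarrow> (\<Sum>c\<in>C. w' c b) = \<nu>"
    and \<nu>: "0 \<le> \<nu>" "\<nu> \<le> 1"
  shows "exp ((\<Sum>a\<in>A. \<Sum>b\<in>B. - (w a b * ln (w a b))) + (\<Sum>c\<in>C. \<Sum>b\<in>B. - (w' c b * ln (w' c b)))
      - real (card A + card B))
    \<le> real (card {(f, h). f \<in> A \<rightarrow>\<^sub>E B \<and> h \<in> C \<rightarrow>\<^sub>E B \<and> inj_on f A \<and> inj_on h C \<and> f ` A = h ` C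
        \<and> (\<forall>a\<in>A. 0 < w a (f a)) \<and> (\<forall>c\<in>C. 0 < w' c (h c))})"
proof -
  let ?R = "A <+> B" and ?S = "B <+> C"
  let ?P = "{(f, h). f \<in> A \<rightarrow>\<^sub>E B \<and> h \<in> C \<rightarrow>\<^sub>E B \<and> inj_on f A \<and> inj_on h C \<and> f ` A = h ` C
        \<and> (\<forall>a\<in>A. 0 < w a (f a)) \<and> (\<forall>c\<in>C. 0 < w' c (h c))}"
  \<comment> \<open>Column \<open>Inl b\<close> receives \<open>\<nu>\<close> from \<open>A\<close>
    and \<open>1 - \<nu>\<close> from the copy of \<open>b\<close>; row \<open>Inr b\<close> is
    completed by the mass \<open>\<nu>\<close> of the column sum of \<open>w'\<close>. The diagonal
    entries can only add entropy.\<close>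
  define W :: "'a + 'b \<Rightarrow> 'b + 'c \<Rightarrow> real" where "W r s = (case r of
      Inl a \<Rightarrow> (case s of Inl b \<Rightarrow> w a b | Inr c \<Rightarrow> 0)
    | Inr b \<Rightarrow> (case s of Inl b' \<Rightarrow> if b = b' then 1 - \<nu> else 0 | Inr c \<Rightarrow> w' c b))" for r s
  let ?Mt = "matchings ?R ?S (\<lambda>r s. 0 < W r s)"
  have W[simp]: "W (Inl a) (Inl b) = w a b" "W (Inl a) (Inr c) = 0"
    "W (Inr b) (Inl b') = (if b = b' then 1 - \<nu> else 0)" "W (Inr b) (Inr c) = w' c b" for a b b' c
    by (simp_all add: W_def)
  have "exp ((\<Sum>r\<in>?R. \<Sum>s\<in>?S. - (W r s * ln (W r s))) - real (card ?R)) \<le> real (card (matchings ?R ?S (\<lambda>r s. 0 < W r s)))"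
  proof (rule card_matchings_entropy)
    show "card ?R = card ?S" using fin card by (simp add: card_Plus)
    show "0 \<le> W r s" if "r \<in> ?R" "s \<in> ?S" for r s
      using that nonneg \<nu> by (auto split: if_splits)
    show "(\<Sum>s\<in>?S. W r s) = 1" if "r \<in> ?R" for r
      using that row col fin by (auto simp: sum.Plus)
    show "(\<Sum>r\<in>?R. W r s) = 1" if "s \<in> ?S" for s
      using that row col fin by (auto simp: sum.Plus)
  qed (use fin in auto)
  moreover have "(\<Sum>a\<in>A. \<Sum>b\<in>B. - (w a b * ln (w a b))) + (\<Sum>c\<in>C. \<Sum>b\<in>B. - (w' c b * ln (w' c b)))
      \<le> (\<Sum>r\<in>?R. \<Sum>s\<in>?S. - (W r s * ln (W r s)))"
  proof -
    have "(\<Sum>s\<in>?S. - (W (Inl a) s * ln (W (Inl a) s))) = (\<Sum>b\<in>B. - (w a b * ln (w a b)))" for a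
      using fin by (simp add: sum.Plus)
    moreover have "(\<Sum>c\<in>C. - (w' c b * ln (w' c b))) \<le> (\<Sum>s\<in>?S. - (W (Inr b) s * ln (W (Inr b) s)))" if "b \<in> B" for b
    proof -
      have "(1 - \<nu>) * ln (1 - \<nu>) \<le> 0"
        using \<nu> by (cases "\<nu> = 1") (auto intro!: mult_nonneg_nonpos)
      then have "0 \<le> (\<Sum>b'\<in>B. - (W (Inr b) (Inl b') * ln (W (Inr b) (Inl b'))))"
        by (intro sum_nonneg) auto
      then show ?thesis using fin by (simp add: sum.Plus)
    qed
    then have "(\<Sum>b\<in>B. \<Sum>c\<in>C. - (w' c b * ln (w' c b))) \<le> (\<Sum>b\<in>B. \<Sum>s\<in>?S. - (W (Inr b) s * ln (W (Inr b) s)))"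
      by (rule sum_mono)
    then have "(\<Sum>c\<in>C. \<Sum>b\<in>B. - (w' c b * ln (w' c b))) \<le> (\<Sum>b\<in>B. \<Sum>s\<in>?S. - (W (Inr b) s * ln (W (Inr b) s)))"
      by (subst sum.swap)
    ultimately show ?thesis
      using fin by (subst sum.Plus) simp_all
  qed
  moreover have "card ?Mt \<le> card ?P"
  proof (rule card_inj_on_le)
    define F where "F \<sigma> = restrict (\<lambda>a. projl (\<sigma> (Inl a))) A" for \<sigma> :: "'a + 'b \<Rightarrow> 'b + 'c"
    define H where "H \<sigma> = restrict (\<lambda>c. projr (inv_into ?R \<sigma> (Inr c))) C" for \<sigma> :: "'a + 'b \<Rightarrow> 'b + 'c"
    have FH: "\<sigma> (Inl a) = Inl (F \<sigma> a) \<and> F \<sigma> a \<in> B \<and> 0 < w a (F \<sigma> a)" if "\<sigma> \<in> ?Mt" "a \<in> A" for \<sigma> a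
    proof -
      have "\<sigma> (Inl a) \<in> ?S" "0 < W (Inl a) (\<sigma> (Inl a))"
        using that unfolding matchings_def by (auto dest!: PiE_mem[of _ _ _ "Inl a"])
      then show ?thesis using that(2) by (cases "\<sigma> (Inl a)") (auto simp: F_def)
    qed
    have HF: "\<sigma> (Inr (H \<sigma> c)) = Inr c \<and> H \<sigma> c \<in> B \<and> 0 < w' c (H \<sigma> c)" if "\<sigma> \<in> ?Mt" "c \<in> C" for \<sigma> c
    proof -
      have "bij_betw \<sigma> ?R ?S" using that by (simp add: matchings_def)
      then have im: "Inr c \<in> \<sigma> ` ?R" using that(2) by (auto simp: bij_betw_def)
      define r where "r = inv_into ?R \<sigma> (Inr c)"
      have r: "r \<in> ?R" "\<sigma> r = Inr c"
        unfolding r_def using inv_into_into[OF im] f_inv_into_f[OF im] by auto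
      have "0 < W r (\<sigma> r)" using that(1) r(1) unfolding matchings_def by blast
      then have "0 < W r (Inr c)" using r(2) by simp
      then show ?thesis using r that(2) by (cases r) (auto simp: H_def r_def[symmetric])
    qed
    \<comment> \<open>A copy of \<open>b\<close> is matched to \<open>b\<close> itself or to some
      \<open>c\<close>, in which case \<open>b\<close> is a value of \<open>H\<close>. Both images
      are therefore the set of those \<open>b\<close> that are not matched to their own
      copy.\<close>
    have Inr_cases: "\<sigma> (Inr b) = Inl b \<or> (\<exists>c\<in>C. H \<sigma> c = b)"
      if \<sigma>: "\<sigma> \<in> ?Mt" and b: "b \<in> B" for \<sigma> b
    proof -
      have s: "\<sigma> (Inr b) \<in> ?S" "0 < W (Inr b) (\<sigma> (Inr b))"
        using \<sigma> b unfolding matchings_def by (auto dest!: PiE_mem[of _ _ _ "Inr b"])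
      show ?thesis
      proof (cases "\<sigma> (Inr b)")
        case (Inl b')
        then show ?thesis using s by (auto split: if_splits)
      next
        case (Inr c)
        then have c: "c \<in> C" using s by auto
        have "\<sigma> (Inr (H \<sigma> c)) = \<sigma> (Inr b)" "H \<sigma> c \<in> B" using HF[OF \<sigma> c] Inr by auto
        moreover have "inj_on \<sigma> ?R" using \<sigma> by (simp add: matchings_def bij_betw_def)
        ultimately have "Inr (H \<sigma> c) = (Inr b :: 'a + 'b)" using b by (auto dest!: inj_onD)
        then show ?thesis using c by auto
      qed
    qed
    show "inj_on (\<lambda>\<sigma>. (F \<sigma>, H \<sigma>)) ?Mt"
    proof (rule inj_onI)
      fix \<sigma> \<tau> assume \<sigma>: "\<sigma> \<in> ?Mt" and \<tau>: "\<tau> \<in> ?Mt"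
        and eq: "(F \<sigma>, H \<sigma>) = (F \<tau>, H \<tau>)"
      show "\<sigma> = \<tau>"
      proof (rule PiE_ext)
        show "\<sigma> \<in> ?R \<rightarrow>\<^sub>E ?S" "\<tau> \<in> ?R \<rightarrow>\<^sub>E ?S" using \<sigma> \<tau> by (auto simp: matchings_def)
        fix r assume "r \<in> ?R"
        then show "\<sigma> r = \<tau> r"
        proof (rule PlusE)
          fix a assume "a \<in> A" "r = Inl a"
          then show ?thesis using FH[OF \<sigma>] FH[OF \<tau>] eq by simp
        next
          fix b assume b: "b \<in> B" "r = Inr b"
          show ?thesis
          proof (cases "\<exists>c\<in>C. H \<sigma> c = b")
            case True
            then show ?thesis using HF[OF \<sigma>] HF[OF \<tau>] eq b by auto
          next
            case False
            then show ?thesis using Inr_cases[OF \<sigma> b(1)] Inr_cases[OF \<tau> b(1)] eq b by auto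
          qed
        qed
      qed
    qed
    show "(\<lambda>\<sigma>. (F \<sigma>, H \<sigma>)) ` ?Mt \<subseteq> ?P"
    proof (clarify, intro conjI)
      fix \<sigma> assume \<sigma>: "\<sigma> \<in> ?Mt"
      then have inj: "inj_on \<sigma> ?R" and im: "\<sigma> ` ?R = ?S" by (auto simp: matchings_def bij_betw_def)
      show "F \<sigma> \<in> A \<rightarrow>\<^sub>E B" using FH[OF \<sigma>] by (auto simp: PiE_iff F_def)
      show "H \<sigma> \<in> C \<rightarrow>\<^sub>E B" using HF[OF \<sigma>] by (auto simp: PiE_iff H_def)
      show "inj_on (F \<sigma>) A"
      proof (rule inj_onI)
        fix a a' assume "a \<in> A" "a' \<in> A" "F \<sigma> a = F \<sigma> a'"
        then have "\<sigma> (Inl a) = \<sigma> (Inl a')" using FH[OF \<sigma>] by simp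
        then show "a = a'" using inj \<open>a \<in> A\<close> \<open>a' \<in> A\<close> by (auto dest!: inj_onD)
      qed
      show "inj_on (H \<sigma>) C" using HF[OF \<sigma>] by (metis inj_onI sum.inject(2))
      show "F \<sigma> ` A = H \<sigma> ` C"
      proof (intro equalityI subsetI)
        fix b assume "b \<in> F \<sigma> ` A"
        then obtain a where a: "a \<in> A" "b = F \<sigma> a" by auto
        then have b: "b \<in> B" "\<sigma> (Inl a) = Inl b" using FH[OF \<sigma> a(1)] by auto
        have "\<sigma> (Inr b) \<noteq> Inl b"
        proof
          assume "\<sigma> (Inr b) = Inl b"
          then have "\<sigma> (Inr b) = \<sigma> (Inl a)" using b by simp
          then show False using inj_onD[OF inj, of "Inr b" "Inl a"] a b by auto
        qed
        then show "b \<in> H \<sigma> ` C" using Inr_cases[OF \<sigma> b(1)] by auto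
      next
        fix b assume "b \<in> H \<sigma> ` C"
        then obtain c where c: "c \<in> C" "b = H \<sigma> c" by auto
        then have b: "b \<in> B" "\<sigma> (Inr b) = Inr c" using HF[OF \<sigma> c(1)] by auto
        then have "Inl b \<in> \<sigma> ` ?R" unfolding im by auto
        then obtain r where r: "r \<in> ?R" "\<sigma> r = Inl b" by (elim imageE) simp
        show "b \<in> F \<sigma> ` A"
        proof (cases r)
          case (Inl a)
          then show ?thesis using r FH[OF \<sigma>, of a] by auto
        next
          case (Inr b')
          have "0 < W r (\<sigma> r)" using \<sigma> r(1) unfolding matchings_def by blast
          then have "0 < W (Inr b') (Inl b)" using r(2) Inr by simp
          then have "b' = b" by (auto split: if_splits)
          then show ?thesis using Inr r b by simp
        qed
      qed
      show "\<forall>a\<in>A. 0 < w a (F \<sigma> a)" using FH[OF \<sigma>] by blast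
      show "\<forall>c\<in>C. 0 < w' c (H \<sigma> c)" using HF[OF \<sigma>] by blast
    qed
    show "finite ?P"
      by (rule finite_subset[of _ "(A \<rightarrow>\<^sub>E B) \<times> (C \<rightarrow>\<^sub>E B)"]) (use fin in \<open>auto intro!: finite_PiE\<close>)
  qed
  ultimately have "exp ((\<Sum>a\<in>A. \<Sum>b\<in>B. - (w a b * ln (w a b))) + (\<Sum>c\<in>C. \<Sum>b\<in>B. - (w' c b * ln (w' c b))) - real (card ?R))
      \<le> real (card ?P)"
    by (meson diff_right_mono exp_le_cancel_iff of_nat_mono order_trans)
  then show ?thesis using fin by (simp only: card_Plus)
qed

section \<open>Symmetric chains in terms of ranks\<close>

lemma grid_le_trans: "grid_le n x y \<Longrightarrow> grid_le n y z \<Longrightarrow> grid_le n x z"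
  unfolding grid_le_def using le_trans by blast

lemma grid_le_refl: "grid_le n x x"
  by (simp add: grid_le_def)

text \<open>Replaces the enumeration of a chain by a condition on the set, so that elements can be
  added at both ends without renumbering.\<close>

lemma symmetric_chain_iff:
  "symmetric_chain t n C \<longleftrightarrow> C \<subseteq> hypergrid t n
    \<and> (\<exists>r. 2 * r \<le> (t - 1) * n \<and> bij_betw (grid_rank n) C {r..(t - 1) * n - r})
    \<and> (\<forall>x\<in>C. \<forall>y\<in>C. grid_rank n x \<le> grid_rank n y \<longrightarrow> grid_le n x y)"
  (is "?L \<longleftrightarrow> ?R")
proof
  let ?m = "(t - 1) * n"
  assume ?L
  then obtain k x where C: "C = x ` {0..k}" and mem: "\<forall>i\<in>{0..k}. x i \<in> hypergrid t n"
    and less: "\<forall>i<k. grid_less n (x i) (x (Suc i))" and sym: "grid_rank n (x 0) + grid_rank n (x k) = ?m"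
    and rank: "\<forall>i\<in>{1..k}. grid_rank n (x i) = grid_rank n (x 0) + i"
    unfolding symmetric_chain_def by blast
  define r where "r = grid_rank n (x 0)"
  have rk: "grid_rank n (x i) = r + i" if "i \<le> k" for i
    using rank that by (cases "i = 0") (auto simp: r_def)
  have m: "?m = 2 * r + k" using sym rk[of k] by (simp add: r_def)
  have "bij_betw (grid_rank n) C {r..?m - r}"
    unfolding bij_betw_def
  proof
    show "inj_on (grid_rank n) C" unfolding C using rk by (auto intro!: inj_onI)
    have "grid_rank n ` C = (\<lambda>i. r + i) ` {0..k}" unfolding C image_image using rk by (intro image_cong) auto
    also have "\<dots> = {r..?m - r}" unfolding m by (simp add: image_add_atLeastAtMost add.commute)
    finally show "grid_rank n ` C = {r..?m - r}" .
  qed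
  moreover have le: "grid_le n (x i) (x j)" if "i \<le> j" "j \<le> k" for i j
    using that
  proof (induction j rule: dec_induct)
    case (step j)
    then have "grid_le n (x j) (x (Suc j))" using less by (auto simp: grid_less_def)
    then show ?case using step grid_le_trans by (meson Suc_leD)
  qed (rule grid_le_refl)
  moreover have "\<forall>x\<in>C. \<forall>y\<in>C. grid_rank n x \<le> grid_rank n y \<longrightarrow> grid_le n x y"
    unfolding C using rk le by auto
  moreover have "C \<subseteq> hypergrid t n" using C mem by auto
  ultimately show ?R using m by (intro conjI exI[of _ r]) auto
next
  let ?m = "(t - 1) * n"
  assume ?R
  then obtain r where sub: "C \<subseteq> hypergrid t n" and r: "2 * r \<le> ?m" and bij: "bij_betw (grid_rank n) C {r..?m - r}"
    and le: "\<And>x y. x \<in> C \<Longrightarrow> y \<in> C \<Longrightarrow> grid_rank n x \<le> grid_rank n y \<Longrightarrow> grid_le n x y" by blast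
  define k where "k = ?m - 2 * r"
  define x where "x i = inv_into C (grid_rank n) (r + i)" for i
  have im: "grid_rank n ` C = {r..?m - r}" using bij by (simp add: bij_betw_def)
  have x: "x i \<in> C \<and> grid_rank n (x i) = r + i" if "i \<le> k" for i
  proof -
    have *: "r + i \<in> grid_rank n ` C" unfolding im using that r by (auto simp: k_def)
    show ?thesis unfolding x_def using inv_into_into[OF *] f_inv_into_f[OF *] by auto
  qed
  have "C = x ` {0..k}"
  proof (intro equalityI subsetI)
    fix y assume y: "y \<in> C"
    then have ry: "grid_rank n y \<in> {r..?m - r}" using im by auto
    then have "x (grid_rank n y - r) = y"
      unfolding x_def using bij y by (auto simp: bij_betw_def inv_into_f_f)
    then show "y \<in> x ` {0..k}" using ry r by (intro image_eqI[of _ _ "grid_rank n y - r"]) (auto simp: k_def)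
  qed (use x in auto)
  moreover have "grid_less n (x i) (x (Suc i))" if "i < k" for i
    using x[of i] x[of "Suc i"] that le[of "x i" "x (Suc i)"] unfolding grid_less_def by force
  moreover have "grid_rank n (x 0) + grid_rank n (x k) = ?m" using x[of 0] x[of k] r by (simp add: k_def)
  ultimately show ?L unfolding symmetric_chain_def
    using x sub by (intro exI[of _ k] exI[of _ x]) auto
qed

section \<open>Prolonging symmetric chains\<close>

definition level :: "nat \<Rightarrow> nat \<Rightarrow> nat \<Rightarrow> (nat \<Rightarrow> nat) set" where
  "level t n k = {x \<in> hypergrid t n. grid_rank n x = k}"

definition band :: "nat \<Rightarrow> nat \<Rightarrow> nat \<Rightarrow> (nat \<Rightarrow> nat) set" where
  "band t n k = {x \<in> hypergrid t n. k \<le> grid_rank n x \<and> grid_rank n x + k \<le> (t - 1) * n}"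

definition partial_scds :: "nat \<Rightarrow> nat \<Rightarrow> nat \<Rightarrow> (nat \<Rightarrow> nat) set set set" where
  "partial_scds t n k = {D. partition_on (band t n k) D \<and> (\<forall>C\<in>D. symmetric_chain t n C)}"

text \<open>The maps \<open>f\<close> and \<open>h\<close> send a new lowest element and a new highest element to the old lowest element of
  the chain that they prolong; a chain has to be prolonged at both ends or not at all.\<close>

definition outer_pairs :: "nat \<Rightarrow> nat \<Rightarrow> nat \<Rightarrow> (nat \<Rightarrow> nat) set set
    \<Rightarrow> (((nat \<Rightarrow> nat) \<Rightarrow> nat \<Rightarrow> nat) \<times> ((nat \<Rightarrow> nat) \<Rightarrow> nat \<Rightarrow> nat)) set" where
  "outer_pairs t n k D = {(f, h). f \<in> level t n k \<rightarrow>\<^sub>E level t n (Suc k)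
     \<and> h \<in> level t n ((t - 1) * n - k) \<rightarrow>\<^sub>E level t n (Suc k)
     \<and> inj_on f (level t n k) \<and> inj_on h (level t n ((t - 1) * n - k))
     \<and> f ` level t n k = h ` level t n ((t - 1) * n - k)
     \<and> (\<forall>a\<in>level t n k. grid_le n a (f a))
     \<and> (\<forall>c\<in>level t n ((t - 1) * n - k). \<forall>C\<in>D. h c \<in> C \<longrightarrow> (\<forall>y\<in>C. grid_le n y c))}"

definition extend_chain where
  "extend_chain t n k f h C =
     C \<union> {a \<in> level t n k. f a \<in> C} \<union> {c \<in> level t n ((t - 1) * n - k). h c \<in> C}"

lemma finite_hypergrid: "finite (hypergrid t n)"
  by (simp add: hypergrid_def finite_PiE)

lemma finite_level: "finite (level t n k)"
  using finite_hypergrid by (simp add: level_def)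

lemma finite_partial_scds: "finite (partial_scds t n k)"
proof (rule finite_subset)
  show "partial_scds t n k \<subseteq> Pow (Pow (hypergrid t n))"
    by (auto simp: partial_scds_def partition_on_def band_def)
qed (simp add: finite_hypergrid)

lemma coord_rank_hypergrid:
  assumes "x \<in> hypergrid t n"
  shows "int (grid_rank n x) = coord_rank {1..n} x"
proof -
  have "1 \<le> x i" if "i \<in> {1..n}" for i using assms that by (auto simp: hypergrid_def)
  then have "n \<le> (\<Sum>i\<in>{1..n}. x i)" using sum_mono[of "{1..n}" "\<lambda>_. 1" x] by simp
  then show ?thesis by (simp add: grid_rank_def coord_rank_def sum_subtractf of_nat_diff)
qed

section \<open>One prolongation step\<close>

context
  fixes t n k :: nat and D :: "(nat \<Rightarrow> nat) set set"
  assumes k: "2 * Suc k \<le> (t - 1) * n" and D: "D \<in> partial_scds t n (Suc k)"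
begin

abbreviation "m \<equiv> (t - 1) * n"

text \<open>The ranks of the chain form an interval symmetric about the middle. The band bounds it
  at both ends, and by symmetry an element on one outermost level forces the other end too.\<close>

lemma chain_ranks:
  assumes C: "C \<in> D" and b: "b \<in> C" "grid_rank n b = Suc k \<or> grid_rank n b = m - Suc k"
  shows "bij_betw (grid_rank n) C {Suc k..m - Suc k}"
proof -
  have "symmetric_chain t n C" and sub: "C \<subseteq> band t n (Suc k)"
    using C D by (auto simp: partial_scds_def partition_on_def)
  then obtain r where r: "2 * r \<le> m" "bij_betw (grid_rank n) C {r..m - r}"
    unfolding symmetric_chain_iff by blast
  have "r \<in> grid_rank n ` C" using r by (auto simp: bij_betw_def)
  then have "Suc k \<le> r" using sub by (auto simp: band_def)
  moreover have "grid_rank n b \<in> {r..m - r}" using bij_betw_apply[OF r(2) b(1)] .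
  ultimately have "r = Suc k" using b(2) k by auto
  then show ?thesis using r by simp
qed

lemma chain_le:
  assumes "C \<in> D" "x \<in> C" "y \<in> C" "grid_rank n x \<le> grid_rank n y"
  shows "grid_le n x y"
  using assms D by (auto simp: partial_scds_def symmetric_chain_iff)

lemma chain_eq:
  assumes "C \<in> D" "C' \<in> D" "x \<in> C" "x \<in> C'"
  shows "C = C'"
  using assms D by (auto simp: partial_scds_def partition_on_def disjoint_def)

lemma chain_sub: "C \<in> D \<Longrightarrow> C \<subseteq> band t n (Suc k)"
  using D by (auto simp: partial_scds_def partition_on_def)

lemma chain_cover: "x \<in> band t n (Suc k) \<Longrightarrow> \<exists>C\<in>D. x \<in> C"
  using D by (auto simp: partial_scds_def partition_on_def)

lemma level_Suc_band: "level t n (Suc k) \<subseteq> band t n (Suc k)" "level t n (m - Suc k) \<subseteq> band t n (Suc k)"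
  using k by (auto simp: level_def band_def)

lemma chain_unique:
  assumes "C \<in> D" "b \<in> C" "b' \<in> C" "grid_rank n b = Suc k \<or> grid_rank n b = m - Suc k"
    "grid_rank n b' = grid_rank n b"
  shows "b' = b"
  using chain_ranks[OF assms(1,2,4)] assms by (auto simp: bij_betw_def dest: inj_onD)

definition chain_top :: "(nat \<Rightarrow> nat) \<Rightarrow> nat \<Rightarrow> nat" where
  "chain_top b = (SOME y. y \<in> level t n (m - Suc k) \<and> (\<exists>C\<in>D. b \<in> C \<and> y \<in> C))"

lemma chain_top:
  assumes "b \<in> level t n (Suc k)"
  shows "chain_top b \<in> level t n (m - Suc k) \<and> (\<exists>C\<in>D. b \<in> C \<and> chain_top b \<in> C)"
proof -
  obtain C where C: "C \<in> D" "b \<in> C" using chain_cover level_Suc_band assms by blast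
  then have "bij_betw (grid_rank n) C {Suc k..m - Suc k}"
    using assms by (intro chain_ranks[of C b]) (auto simp: level_def)
  then have "grid_rank n ` C = {Suc k..m - Suc k}" by (simp add: bij_betw_def)
  moreover have "m - Suc k \<in> {Suc k..m - Suc k}" using k by auto
  ultimately obtain y where "y \<in> C" "grid_rank n y = m - Suc k" by (metis imageE)
  then have "y \<in> level t n (m - Suc k) \<and> (\<exists>C\<in>D. b \<in> C \<and> y \<in> C)"
    using C chain_sub[OF C(1)] by (auto simp: level_def band_def)
  then show ?thesis
    using someI[of "\<lambda>y. y \<in> level t n (m - Suc k) \<and> (\<exists>C\<in>D. b \<in> C \<and> y \<in> C)"]
    unfolding chain_top_def by blast
qed

lemma chain_le_top:
  assumes "b \<in> level t n (Suc k)" "C \<in> D" "b \<in> C" "y \<in> C"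
  shows "grid_le n y (chain_top b)"
proof -
  obtain C' where C': "C' \<in> D" "b \<in> C'" "chain_top b \<in> C'" using chain_top[OF assms(1)] by blast
  then have "C' = C" using chain_eq assms by blast
  moreover have "grid_rank n y \<le> m - Suc k"
    using chain_sub[OF assms(2)] assms(4) by (auto simp: band_def)
  ultimately show ?thesis using chain_le C' assms chain_top[OF assms(1)] by (auto simp: level_def)
qed

text \<open>This relabelling moves weights between the upper levels down to level
  \<open>Suc k\<close>, where \<open>f\<close> and \<open>h\<close> have a common target, and
  preserves all sums over that level.\<close>

lemma bij_betw_chain_top: "bij_betw chain_top (level t n (Suc k)) (level t n (m - Suc k))"
  unfolding bij_betw_def
proof
  show "inj_on chain_top (level t n (Suc k))"
  proof (rule inj_onI)
    fix b b' assume b: "b \<in> level t n (Suc k)" "b' \<in> level t n (Suc k)" and eq: "chain_top b = chain_top b'"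
    then obtain C C' where "C \<in> D" "b \<in> C" "chain_top b \<in> C" "C' \<in> D" "b' \<in> C'" "chain_top b' \<in> C'"
      using chain_top by meson
    then show "b = b'" using chain_eq eq chain_unique[of C b' b] b by (auto simp: level_def)
  qed
  show "chain_top ` level t n (Suc k) = level t n (m - Suc k)"
  proof (intro equalityI subsetI)
    fix y assume y: "y \<in> level t n (m - Suc k)"
    obtain C where C: "C \<in> D" "y \<in> C" using chain_cover level_Suc_band y by blast
    then have "bij_betw (grid_rank n) C {Suc k..m - Suc k}"
      using y by (intro chain_ranks[of C y]) (auto simp: level_def)
    then have "grid_rank n ` C = {Suc k..m - Suc k}" by (simp add: bij_betw_def)
    moreover have "Suc k \<in> {Suc k..m - Suc k}" using k by auto
    ultimately obtain b where b: "b \<in> C" "grid_rank n b = Suc k" by (metis imageE)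
    then have bl: "b \<in> level t n (Suc k)" using chain_sub[OF C(1)] by (auto simp: level_def band_def)
    obtain C' where C': "C' \<in> D" "b \<in> C'" "chain_top b \<in> C'" using chain_top[OF bl] by blast
    then have "C' = C" using chain_eq C b by blast
    then have "chain_top b = y"
      using C C' y chain_top[OF bl] by (intro chain_unique[of C]) (auto simp: level_def)
    then show "y \<in> chain_top ` level t n (Suc k)" using bl by auto
  qed (use chain_top in auto)
qed

lemma band_split: "band t n k = band t n (Suc k) \<union> level t n k \<union> level t n (m - k)"
  using k by (auto simp: band_def level_def)

lemma extend_chain_band:
  assumes "C \<in> D"
  shows "extend_chain t n k f h C \<inter> band t n (Suc k) = C"
  using chain_sub[OF assms] k by (auto simp: extend_chain_def level_def band_def)

lemma extend_chain_eq:
  assumes fh: "(f, h) \<in> outer_pairs t n k D" and C: "C \<in> D" "C' \<in> D"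
    and x: "x \<in> extend_chain t n k f h C" "x \<in> extend_chain t n k f h C'"
  shows "C = C'"
proof -
  consider "x \<in> band t n (Suc k)" | "x \<in> level t n k" | "x \<in> level t n (m - k)"
    using x chain_sub[OF C(1)] by (auto simp: extend_chain_def)
  then show ?thesis
  proof cases
    case 1
    then have "x \<in> C" "x \<in> C'"
      using x extend_chain_band[OF C(1), of f h] extend_chain_band[OF C(2), of f h] by auto
    then show ?thesis using chain_eq C by blast
  next
    case 2
    then have "x \<notin> band t n (Suc k)" "x \<notin> level t n (m - k)" using k by (auto simp: band_def level_def)
    then have "f x \<in> C" "f x \<in> C'" using x chain_sub C by (auto simp: extend_chain_def)
    then show ?thesis using chain_eq C by blast
  next
    case 3
    then have "x \<notin> band t n (Suc k)" "x \<notin> level t n k" using k by (auto simp: band_def level_def)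
    then have "h x \<in> C" "h x \<in> C'" using x chain_sub C by (auto simp: extend_chain_def)
    then show ?thesis using chain_eq C by blast
  qed
qed

text \<open>A chain has at most one element on level \<open>Suc k\<close>, and \<open>f\<close> and
  \<open>h\<close> are injective with equal images. So it gains either nothing or exactly one
  element at each end.\<close>

lemma symmetric_chain_extend:
  assumes fh: "(f, h) \<in> outer_pairs t n k D" and C: "C \<in> D"
  shows "symmetric_chain t n (extend_chain t n k f h C)"
proof (cases "\<exists>b\<in>C. b \<in> f ` level t n k")
  case False
  have eq: "f ` level t n k = h ` level t n (m - k)" using fh by (auto simp: outer_pairs_def)
  have "{a \<in> level t n k. f a \<in> C} = {}" using False by blast
  moreover have "{c \<in> level t n (m - k). h c \<in> C} = {}" using False eq by blast
  ultimately have "extend_chain t n k f h C = C" unfolding extend_chain_def by blast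
  then show ?thesis using C D by (auto simp: partial_scds_def)
next
  case True
  obtain a where a: "a \<in> level t n k" "f a \<in> C" using True by auto
  then have "f a \<in> h ` level t n (m - k)" using fh by (auto simp: outer_pairs_def)
  then obtain c where c: "c \<in> level t n (m - k)" "h c = f a" by auto
  have fl: "f a' \<in> level t n (Suc k)" if "a' \<in> level t n k" for a' using fh that by (auto simp: outer_pairs_def)
  have hl: "h c' \<in> level t n (Suc k)" if "c' \<in> level t n (m - k)" for c' using fh that by (auto simp: outer_pairs_def)
  have rk: "grid_rank n a = k" "grid_rank n c = m - k" "grid_rank n (f a) = Suc k"
    using a c fl[OF a(1)] by (auto simp: level_def)
  have "a' = a" if "a' \<in> level t n k" "f a' \<in> C" for a'
  proof -
    have "f a' = f a" using chain_unique[OF C a(2) that(2)] fl[OF that(1)] rk by (auto simp: level_def)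
    then show ?thesis using fh that a by (auto simp: outer_pairs_def dest: inj_onD)
  qed
  then have A: "{a \<in> level t n k. f a \<in> C} = {a}" using a by blast
  have "c' = c" if "c' \<in> level t n (m - k)" "h c' \<in> C" for c'
  proof -
    have "h c' = h c" using chain_unique[OF C a(2) that(2)] hl[OF that(1)] rk c by (auto simp: level_def)
    moreover have "inj_on h (level t n (m - k))" using fh by (simp add: outer_pairs_def)
    ultimately show ?thesis using that c by (blast dest: inj_onD)
  qed
  moreover have "h c \<in> C" using a c by simp
  ultimately have B: "{c \<in> level t n (m - k). h c \<in> C} = {c}" using c(1) by blast
  have E: "extend_chain t n k f h C = insert a (insert c C)"
    unfolding extend_chain_def A B by blast
  have bij: "bij_betw (grid_rank n) C {Suc k..m - Suc k}"
    using chain_ranks[OF C a(2)] rk by simp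
  then have im: "grid_rank n ` C = {Suc k..m - Suc k}" by (simp add: bij_betw_def)
  have rC: "Suc k \<le> grid_rank n y \<and> grid_rank n y \<le> m - Suc k" if "y \<in> C" for y
    using im that by auto
  have ab: "grid_le n a y" if "y \<in> C" for y
  proof -
    have "grid_le n a (f a)" using fh a by (auto simp: outer_pairs_def)
    moreover have "grid_le n (f a) y" using chain_le[OF C a(2) that] rC[OF that] rk by simp
    ultimately show ?thesis by (rule grid_le_trans)
  qed
  have bc: "grid_le n y c" if "y \<in> C" for y
    using fh C c a that unfolding outer_pairs_def by fastforce
  have ac: "grid_le n a c" using ab[OF a(2)] bc[OF a(2)] by (rule grid_le_trans)
  have "bij_betw (grid_rank n) (insert a (insert c C)) {k..m - k}"
    unfolding bij_betw_def
  proof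
    show "inj_on (grid_rank n) (insert a (insert c C))"
    proof -
      have "inj_on (grid_rank n) C" using bij by (simp add: bij_betw_def)
      moreover have "k \<notin> grid_rank n ` C" "m - k \<notin> grid_rank n ` C" "k \<noteq> m - k"
        unfolding im using k by auto
      moreover have "grid_rank n ` (insert c C - {a}) \<subseteq> insert (m - k) (grid_rank n ` C)"
        using rk(2) by blast
      moreover have "grid_rank n ` (C - {c}) \<subseteq> grid_rank n ` C" by blast
      ultimately show ?thesis unfolding inj_on_insert rk by blast
    qed
    show "grid_rank n ` insert a (insert c C) = {k..m - k}"
      unfolding image_insert im rk using k by auto
  qed
  moreover have "insert a (insert c C) \<subseteq> hypergrid t n"
    using a c chain_sub[OF C] by (auto simp: level_def band_def)
  moreover have "grid_le n x y"
    if xy: "x \<in> insert a (insert c C)" "y \<in> insert a (insert c C)" "grid_rank n x \<le> grid_rank n y" for x y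
  proof -
    have km: "k < m - k" using k by simp
    consider "x = a" | "x = c" | "x \<in> C" using xy(1) by blast
    then show ?thesis
    proof cases
      case 1
      then show ?thesis using xy(2) ab ac grid_le_refl by blast
    next
      case 2
      then have "\<not> y \<in> C" "y \<noteq> a" using xy(3) rC[of y] rk km k by auto
      then show ?thesis using 2 xy(2) grid_le_refl by blast
    next
      case 3
      then have "y \<noteq> a" using xy(3) rC[of x] rk by auto
      then show ?thesis using 3 xy(2,3) bc chain_le[OF C] by blast
    qed
  qed
  ultimately show ?thesis unfolding E symmetric_chain_iff
    using k by (intro conjI exI[of _ k] ballI impI) simp_all
qed

lemma extend_in_partial_scds:
  assumes fh: "(f, h) \<in> outer_pairs t n k D"
  shows "extend_chain t n k f h ` D \<in> partial_scds t n k"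
  unfolding partial_scds_def
proof (intro CollectI conjI)
  show "\<forall>C\<in>extend_chain t n k f h ` D. symmetric_chain t n C"
    using symmetric_chain_extend[OF fh] by auto
  show "partition_on (band t n k) (extend_chain t n k f h ` D)"
  proof (rule partition_onI)
    show "\<Union> (extend_chain t n k f h ` D) = band t n k"
    proof (intro equalityI subsetI)
      fix x assume "x \<in> \<Union> (extend_chain t n k f h ` D)"
      then show "x \<in> band t n k" using chain_sub unfolding band_split by (auto simp: extend_chain_def)
    next
      fix x assume "x \<in> band t n k"
      then consider "x \<in> band t n (Suc k)" | "x \<in> level t n k" | "x \<in> level t n (m - k)"
        unfolding band_split by auto
      then show "x \<in> \<Union> (extend_chain t n k f h ` D)"
      proof cases
        case 1
        then show ?thesis using chain_cover by (auto simp: extend_chain_def)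
      next
        case 2
        then have "f x \<in> band t n (Suc k)" using fh level_Suc_band by (auto simp: outer_pairs_def)
        then show ?thesis using chain_cover 2 by (fastforce simp: extend_chain_def)
      next
        case 3
        then have "h x \<in> band t n (Suc k)" using fh level_Suc_band by (auto simp: outer_pairs_def)
        then show ?thesis using chain_cover 3 by (fastforce simp: extend_chain_def)
      qed
    qed
    show "disjnt p q" if "p \<in> extend_chain t n k f h ` D" "q \<in> extend_chain t n k f h ` D" "p \<noteq> q" for p q
      using that extend_chain_eq[OF fh] unfolding disjnt_def by blast
    show "{} \<notin> extend_chain t n k f h ` D"
    proof
      assume "{} \<in> extend_chain t n k f h ` D"
      then obtain C where "C \<in> D" "{} = extend_chain t n k f h C" by auto
      moreover have "C \<noteq> {}" using D \<open>C \<in> D\<close> by (auto simp: partial_scds_def partition_on_def)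
      ultimately show False by (auto simp: extend_chain_def)
    qed
  qed
qed

lemma extend_restrict: "(\<lambda>C. C \<inter> band t n (Suc k)) ` extend_chain t n k f h ` D = D"
  unfolding image_image using extend_chain_band by (auto intro!: image_eqI)

lemma extend_inj:
  assumes fh: "(f, h) \<in> outer_pairs t n k D" and fh': "(f', h') \<in> outer_pairs t n k D"
    and eq: "extend_chain t n k f h ` D = extend_chain t n k f' h' ` D"
  shows "f = f' \<and> h = h'"
proof -
  have same: "extend_chain t n k f h C = extend_chain t n k f' h' C" if C: "C \<in> D" for C
  proof -
    have "extend_chain t n k f h C \<in> extend_chain t n k f' h' ` D" using eq C by auto
    then obtain C' where C': "C' \<in> D" "extend_chain t n k f h C = extend_chain t n k f' h' C'" by auto
    then have "C = C'" using extend_chain_band C by metis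
    then show ?thesis using C' by simp
  qed
  have lev: "x \<notin> level t n (m - k) \<and> x \<notin> C" if "x \<in> level t n k" "C \<in> D" for x C
    using that(1) chain_sub[OF that(2)] k by (auto simp: level_def band_def)
  have lev': "x \<notin> level t n k \<and> x \<notin> C" if "x \<in> level t n (m - k)" "C \<in> D" for x C
    using that(1) chain_sub[OF that(2)] k by (auto simp: level_def band_def)
  have "f a = f' a" if a: "a \<in> level t n k" for a
  proof -
    have fl: "f a \<in> level t n (Suc k)" "f' a \<in> level t n (Suc k)" using fh fh' a by (auto simp: outer_pairs_def)
    then obtain C where C: "C \<in> D" "f a \<in> C" using chain_cover level_Suc_band by blast
    then have "a \<in> extend_chain t n k f' h' C" using same a by (auto simp: extend_chain_def)
    then have "f' a \<in> C" using lev[OF a C(1)] by (auto simp: extend_chain_def)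
    then show ?thesis using chain_unique[OF C(1), of "f' a" "f a"] C fl by (auto simp: level_def)
  qed
  moreover have "h c = h' c" if c: "c \<in> level t n (m - k)" for c
  proof -
    have fl: "h c \<in> level t n (Suc k)" "h' c \<in> level t n (Suc k)" using fh fh' c by (auto simp: outer_pairs_def)
    then obtain C where C: "C \<in> D" "h c \<in> C" using chain_cover level_Suc_band by blast
    then have "c \<in> extend_chain t n k f' h' C" using same c by (auto simp: extend_chain_def)
    then have "h' c \<in> C" using lev'[OF c C(1)] by (auto simp: extend_chain_def)
    then show ?thesis using chain_unique[OF C(1), of "h' c" "h c"] C fl by (auto simp: level_def)
  qed
  moreover have PiE: "f \<in> level t n k \<rightarrow>\<^sub>E level t n (Suc k)" "f' \<in> level t n k \<rightarrow>\<^sub>E level t n (Suc k)"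
    "h \<in> level t n (m - k) \<rightarrow>\<^sub>E level t n (Suc k)"
    "h' \<in> level t n (m - k) \<rightarrow>\<^sub>E level t n (Suc k)"
    using fh fh' by (simp_all add: outer_pairs_def)
  ultimately show ?thesis using PiE_ext[OF PiE(1,2)] PiE_ext[OF PiE(3,4)] by simp
qed

end

text \<open>Prolongation is injective: intersecting with the smaller band recovers \<open>D\<close>,
  and the chain containing a new element determines its image under \<open>f\<close> or
  \<open>h\<close>, namely the element of that chain on level \<open>Suc k\<close>.\<close>

lemma card_partial_scds_step:
  assumes k: "2 * Suc k \<le> (t - 1) * n"
    and X: "\<And>D. D \<in> partial_scds t n (Suc k) \<Longrightarrow> X \<le> real (card (outer_pairs t n k D))"
  shows "real (card (partial_scds t n (Suc k))) * X \<le> real (card (partial_scds t n k))"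
proof -
  have fin: "finite (outer_pairs t n k D)" for D
  proof (rule finite_subset)
    show "outer_pairs t n k D \<subseteq> (level t n k \<rightarrow>\<^sub>E level t n (Suc k)) \<times> (level t n ((t - 1) * n - k) \<rightarrow>\<^sub>E level t n (Suc k))"
      by (auto simp: outer_pairs_def)
  qed (intro finite_cartesian_product finite_PiE finite_level)
  have "real (card (partial_scds t n (Suc k))) * X \<le> (\<Sum>D\<in>partial_scds t n (Suc k). real (card (outer_pairs t n k D)))"
    using X sum_mono[of "partial_scds t n (Suc k)" "\<lambda>_. X"] by simp
  also have "\<dots> = real (card (SIGMA D:partial_scds t n (Suc k). outer_pairs t n k D))"
    using fin by (subst card_SigmaI) (auto simp: finite_partial_scds)
  also have "card (SIGMA D:partial_scds t n (Suc k). outer_pairs t n k D) \<le> card (partial_scds t n k)"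
  proof (rule card_inj_on_le)
    let ?g = "\<lambda>(D, f, h). extend_chain t n k f h ` D"
    show "inj_on ?g (SIGMA D:partial_scds t n (Suc k). outer_pairs t n k D)"
    proof (rule inj_onI)
      fix p q
      assume pq: "p \<in> (SIGMA D:partial_scds t n (Suc k). outer_pairs t n k D)"
        "q \<in> (SIGMA D:partial_scds t n (Suc k). outer_pairs t n k D)" "?g p = ?g q"
      obtain D f h where p: "p = (D, f, h)" by (cases p)
      obtain D' f' h' where q: "q = (D', f', h')" by (cases q)
      have D: "D \<in> partial_scds t n (Suc k)" "D' \<in> partial_scds t n (Suc k)"
        and fh: "(f, h) \<in> outer_pairs t n k D" "(f', h') \<in> outer_pairs t n k D'"
        and eq: "extend_chain t n k f h ` D = extend_chain t n k f' h' ` D'"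
        using pq p q by auto
      have "D = (\<lambda>C. C \<inter> band t n (Suc k)) ` extend_chain t n k f h ` D" using extend_restrict[OF k D(1)] by simp
      also have "\<dots> = D'" unfolding eq by (rule extend_restrict[OF k D(2)])
      finally have "D = D'" .
      then show "p = q" using extend_inj[OF k D(1) fh(1)] fh(2) eq p q by simp
    qed
    show "?g ` (SIGMA D:partial_scds t n (Suc k). outer_pairs t n k D) \<subseteq> partial_scds t n k"
      using extend_in_partial_scds[OF k] by auto
  qed (rule finite_partial_scds)
  finally show ?thesis by simp
qed

context grid
begin

section \<open>The flow on the levels and its reflection\<close>

abbreviation flow :: "nat \<Rightarrow> (nat \<Rightarrow> nat) \<Rightarrow> nat \<Rightarrow> real" where
  "flow n a i \<equiv> sym_flow n {1..n} a i"

definition edge_weight :: "nat \<Rightarrow> (nat \<Rightarrow> nat) \<Rightarrow> (nat \<Rightarrow> nat) \<Rightarrow> real" where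
  "edge_weight n a b = (\<Sum>i\<in>{1..n}. of_bool (b = a(i := Suc (a i))) * flow n a i)"

definition complement :: "nat \<Rightarrow> (nat \<Rightarrow> nat) \<Rightarrow> (nat \<Rightarrow> nat)" where
  "complement n x = restrict (\<lambda>i. t + 1 - x i) {1..n}"

lemma int_top: "int ((t - 1) * n) = (int t - 1) * int n"
  using t2 by (simp add: of_nat_diff)

lemma hypergridD: "x \<in> hypergrid t n \<Longrightarrow> i \<in> {1..n} \<Longrightarrow> x i \<in> {1..t}"
  by (auto simp: hypergrid_def)

lemma level_rank: "x \<in> level t n k \<Longrightarrow> coord_rank {1..n} x = int k"
  using coord_rank_hypergrid by (auto simp: level_def)

lemma levelI: "x \<in> hypergrid t n \<Longrightarrow> coord_rank {1..n} x = int k \<Longrightarrow> x \<in> level t n k"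
  using coord_rank_hypergrid[of x t n] by (simp add: level_def)

lemma grid_rank_le: "x \<in> hypergrid t n \<Longrightarrow> grid_rank n x \<le> (t - 1) * n"
proof -
  assume x: "x \<in> hypergrid t n"
  have "coord_rank {1..n} x \<le> (int t - 1) * int (card {1..n})"
    using hypergridD[OF x] by (intro coord_rank_range) auto
  then have "int (grid_rank n x) \<le> int ((t - 1) * n)"
    unfolding coord_rank_hypergrid[OF x] int_top by simp
  then show ?thesis by (simp only: of_nat_le_iff)
qed

lemma card_level: "real (card (level t n k)) = level_size n (int k)"
proof -
  have "real (card (level t n k)) = (\<Sum>x\<in>hypergrid t n. of_bool (grid_rank n x = k))"
    using finite_hypergrid by (simp add: level_def of_bool_def Int_def flip: sum.inter_filter)
  also have "\<dots> = (\<Sum>x\<in>hypergrid t n. of_bool (coord_rank {1..n} x = int k))"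
    by (intro sum.cong refl) (simp only: coord_rank_hypergrid[symmetric] of_nat_eq_iff)
  also have "\<dots> = level_size n (int k)"
    using card_level_PiE[of "{1..n}" "int k"] by (simp add: hypergrid_def)
  finally show ?thesis .
qed

lemma raise_in_level:
  assumes "a \<in> level t n k" "i \<in> {1..n}" "a i < t"
  shows "a(i := Suc (a i)) \<in> level t n (Suc k)"
proof (rule levelI)
  show "a(i := Suc (a i)) \<in> hypergrid t n"
    using assms by (auto simp: level_def hypergrid_def PiE_iff extensional_def)
  have "coord_rank ({1..n} - {i}) (a(i := Suc (a i))) = coord_rank ({1..n} - {i}) a"
    by (rule coord_rank_cong) auto
  then show "coord_rank {1..n} (a(i := Suc (a i))) = int (Suc k)"
    using level_rank[OF assms(1)] coord_rank_remove[of "{1..n}" i a]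
      coord_rank_remove[of "{1..n}" i "a(i := Suc (a i))"] assms(2) by simp
qed

lemma lower_in_level:
  assumes "b \<in> level t n (Suc k)" "i \<in> {1..n}" "2 \<le> b i"
  shows "b(i := b i - 1) \<in> level t n k"
proof (rule levelI)
  have "b i \<le> t" using assms hypergridD[of b n i] by (auto simp: level_def)
  then have "b i - 1 \<le> t" by simp
  then show "b(i := b i - 1) \<in> hypergrid t n"
    using assms by (auto simp: level_def hypergrid_def PiE_iff extensional_def)
  show "coord_rank {1..n} (b(i := b i - 1)) = int k"
    using coord_rank_lower[of "{1..n}" i b] assms level_rank[OF assms(1)] by simp
qed

lemma flow_nonneg: "a \<in> hypergrid t n \<Longrightarrow> 0 \<le> flow n a i"
  using hypergridD by (intro sym_flow_nonneg) auto

lemma edge_weight_nonneg: "a \<in> hypergrid t n \<Longrightarrow> 0 \<le> edge_weight n a b"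
  unfolding edge_weight_def using flow_nonneg by (intro sum_nonneg) auto

lemma edge_weight_pos: "0 < edge_weight n a b \<Longrightarrow> grid_le n a b"
proof -
  assume "0 < edge_weight n a b"
  then obtain i where "of_bool (b = a(i := Suc (a i))) * flow n a i \<noteq> 0"
    unfolding edge_weight_def by (metis (no_types, lifting) less_irrefl sum.neutral)
  then have "b = a(i := Suc (a i))" by (auto split: if_splits)
  then show ?thesis by (simp add: grid_le_def)
qed

text \<open>Raising different coordinates gives different neighbours, and no flow leaves the grid by
  \<open>sym_flow_top\<close>. The function \<open>g\<close> is general so as to yield both row sums
  and entropies.\<close>

lemma sum_edge_weight:
  assumes a: "a \<in> level t n k" and g: "g 0 = (0::real)"
  shows "(\<Sum>b\<in>level t n (Suc k). g (edge_weight n a b)) = (\<Sum>i\<in>{1..n}. g (flow n a i))"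
proof -
  let ?I = "{i \<in> {1..n}. a i < t}" and ?U = "\<lambda>i. a(i := Suc (a i))"
  have U: "?U i = ?U j \<longleftrightarrow> i = j" for i j by (metis fun_upd_apply n_not_Suc_n)
  have zero: "flow n a i = 0" if "i \<in> {1..n}" "i \<notin> ?I" for i
    using that a hypergridD[of a n] by (intro sym_flow_top) (auto simp: level_def order_antisym)
  have w: "edge_weight n a (?U i) = flow n a i" if "i \<in> {1..n}" for i
    unfolding edge_weight_def U using that by (simp add: of_bool_def if_distrib[of "\<lambda>u. u * _"] cong: if_cong)
  have "edge_weight n a b = 0" if "b \<notin> ?U ` ?I" for b
    unfolding edge_weight_def
  proof (intro sum.neutral ballI)
    fix i assume "i \<in> {1..n}"
    then show "of_bool (b = ?U i) * flow n a i = 0"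
      using that zero[of i] by (cases "i \<in> ?I") auto
  qed
  then have "(\<Sum>b\<in>level t n (Suc k). g (edge_weight n a b)) = (\<Sum>b\<in>?U ` ?I. g (edge_weight n a b))"
    using raise_in_level[OF a] g by (intro sum.mono_neutral_right) (auto simp: finite_level)
  also have "\<dots> = (\<Sum>i\<in>?I. g (flow n a i))"
    using U by (subst sum.reindex) (auto intro!: inj_onI sum.cong simp del: fun_upd_apply simp: w)
  also have "\<dots> = (\<Sum>i\<in>{1..n}. g (flow n a i))"
    using zero g by (intro sum.mono_neutral_left) auto
  finally show ?thesis .
qed

lemma edge_weight_row:
  assumes "a \<in> level t n k" "k < (t - 1) * n"
  shows "(\<Sum>b\<in>level t n (Suc k). edge_weight n a b) = 1"
proof -
  have "int k < int ((t - 1) * n)" using assms(2) by (simp only: of_nat_less_iff)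
  then have "coord_rank {1..n} a < (int t - 1) * int n"
    unfolding level_rank[OF assms(1)] int_top .
  then have "(\<Sum>i\<in>{1..n}. flow n a i) = 1"
    using assms hypergridD[of a n] by (intro sum_sym_flow) (auto simp: level_def)
  then show ?thesis using sum_edge_weight[OF assms(1), of "\<lambda>x. x"] by simp
qed

lemma edge_weight_col:
  assumes b: "b \<in> level t n (Suc k)"
  shows "(\<Sum>a\<in>level t n k. edge_weight n a b) = level_size n (int k) / level_size n (int k + 1)"
proof -
  have single: "(\<Sum>a\<in>level t n k. of_bool (b = a(i := Suc (a i))) * flow n a i)
      = (if 2 \<le> b i then flow n (b(i := b i - 1)) i else 0)" if i: "i \<in> {1..n}" for i
  proof -
    have iff: "b = a(i := Suc (a i)) \<longleftrightarrow> 2 \<le> b i \<and> a = b(i := b i - 1)" if "a \<in> level t n k" for a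
    proof -
      have "1 \<le> a i" using that i hypergridD[of a n i] by (auto simp: level_def)
      then show ?thesis by (auto simp: fun_eq_iff)
    qed
    have "(\<Sum>a\<in>level t n k. of_bool (b = a(i := Suc (a i))) * flow n a i)
        = (\<Sum>a\<in>level t n k. if 2 \<le> b i \<and> b(i := b i - 1) = a then flow n a i else 0)"
      by (intro sum.cong refl) (auto simp: iff)
    also have "\<dots> = (if 2 \<le> b i then flow n (b(i := b i - 1)) i else 0)"
      using lower_in_level[OF b i] finite_level by (cases "2 \<le> b i") simp_all
    finally show ?thesis .
  qed
  have "(\<Sum>a\<in>level t n k. edge_weight n a b)
      = (\<Sum>i\<in>{1..n}. \<Sum>a\<in>level t n k. of_bool (b = a(i := Suc (a i))) * flow n a i)"
    unfolding edge_weight_def by (rule sum.swap)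
  also have "\<dots> = (\<Sum>i\<in>{1..n}. if 2 \<le> b i then flow n (b(i := b i - 1)) i else 0)"
    using single by (rule sum.cong[OF refl])
  also have "\<dots> = (\<Sum>i\<in>{i\<in>{1..n}. 2 \<le> b i}. flow n (b(i := b i - 1)) i)"
    by (rule sum.inter_filter[symmetric]) simp
  also have "\<dots> = level_size n (int k) / level_size n (int k + 1)"
    using b hypergridD[of b n] level_rank[OF b] by (intro sym_flow_in) (auto simp: level_def)
  finally show ?thesis .
qed

lemma complement_hypergrid: "x \<in> hypergrid t n \<Longrightarrow> complement n x \<in> hypergrid t n"
  by (force simp: complement_def hypergrid_def PiE_iff)

lemma complement_complement: "x \<in> hypergrid t n \<Longrightarrow> complement n (complement n x) = x"
  by (rule ext) (force simp: complement_def hypergrid_def PiE_iff extensional_def restrict_def)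

lemma complement_level:
  assumes "x \<in> level t n k"
  shows "complement n x \<in> level t n ((t - 1) * n - k)"
proof (rule levelI)
  have x: "x \<in> hypergrid t n" using assms by (simp add: level_def)
  then show "complement n x \<in> hypergrid t n" by (rule complement_hypergrid)
  have "coord_rank {1..n} (complement n x) = (\<Sum>i\<in>{1..n}. (int t - 1) - (int (x i) - 1))"
    unfolding coord_rank_def
  proof (intro sum.cong refl)
    fix i assume i: "i \<in> {1..n}"
    then have "x i \<le> t + 1" using hypergridD[OF x i] by auto
    then show "int (complement n x i) - 1 = (int t - 1) - (int (x i) - 1)"
      using i by (simp add: complement_def of_nat_diff)
  qed
  also have "\<dots> = int ((t - 1) * n) - int k"
    using level_rank[OF assms] unfolding int_top by (simp add: sum_subtractf coord_rank_def algebra_simps)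
  also have "\<dots> = int ((t - 1) * n - k)"
    using grid_rank_le[OF x] assms by (simp add: level_def of_nat_diff)
  finally show "coord_rank {1..n} (complement n x) = int ((t - 1) * n - k)" .
qed

lemma bij_betw_complement:
  assumes "k \<le> (t - 1) * n"
  shows "bij_betw (complement n) (level t n k) (level t n ((t - 1) * n - k))"
proof (rule bij_betwI[where g = "complement n"])
  show "complement n \<in> level t n k \<rightarrow> level t n ((t - 1) * n - k)" using complement_level by auto
  show "complement n \<in> level t n ((t - 1) * n - k) \<rightarrow> level t n k"
    using complement_level[of _ n "(t - 1) * n - k"] assms by auto
qed (auto simp: level_def complement_complement)

lemma complement_le:
  assumes "x \<in> hypergrid t n" "y \<in> hypergrid t n" "grid_le n (complement n x) (complement n y)"
  shows "grid_le n y x"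
proof -
  have "y i \<le> x i" if "i \<in> {1..n}" for i
    using assms(3) that hypergridD[OF assms(1) that] hypergridD[OF assms(2) that]
    by (force simp: grid_le_def complement_def)
  then show ?thesis by (simp add: grid_le_def)
qed

section \<open>Counting the prolongations\<close>

definition level_entropy :: "nat \<Rightarrow> nat \<Rightarrow> real" where
  "level_entropy n k = (\<Sum>a\<in>level t n k. \<Sum>i\<in>{1..n}. - (flow n a i * ln (flow n a i)))"

text \<open>The upper weight \<open>?w'\<close> is the lower one pulled back along
  \<open>complement n\<close> on the new elements and \<open>complement n \<circ> ?top\<close> on
  level \<open>Suc k\<close>. Both maps are bijections, so the upper end has the same row sums,
  column sums and entropy for every \<open>D\<close>.\<close>

lemma card_outer_pairs:
  assumes k: "2 * Suc k \<le> (t - 1) * n" and D: "D \<in> partial_scds t n (Suc k)"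
  shows "exp (2 * level_entropy n k - real (card (level t n k) + card (level t n (Suc k))))
    \<le> real (card (outer_pairs t n k D))"
proof -
  let ?m = "(t - 1) * n" and ?w = "edge_weight n" and ?top = "chain_top t n k D"
  let ?w' = "\<lambda>c b. edge_weight n (complement n c) (complement n (?top b))"
  let ?\<nu> = "level_size n (int k) / level_size n (int k + 1)"
  let ?P = "{(f, h). f \<in> level t n k \<rightarrow>\<^sub>E level t n (Suc k) \<and> h \<in> level t n (?m - k) \<rightarrow>\<^sub>E level t n (Suc k)
        \<and> inj_on f (level t n k) \<and> inj_on h (level t n (?m - k)) \<and> f ` level t n k = h ` level t n (?m - k)
        \<and> (\<forall>a\<in>level t n k. 0 < ?w a (f a)) \<and> (\<forall>c\<in>level t n (?m - k). 0 < ?w' c (h c))}"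
  have km: "k \<le> ?m" "Suc k \<le> ?m" "k < ?m" using k by auto
  have bij: "bij_betw (\<lambda>b. complement n (?top b)) (level t n (Suc k)) (level t n (Suc k))"
    using bij_betw_trans[OF bij_betw_chain_top[OF k D] bij_betw_complement[of "?m - Suc k" n]] km
    by (simp add: o_def)
  have bij': "bij_betw (complement n) (level t n (?m - k)) (level t n k)"
    using bij_betw_complement[of "?m - k" n] km by simp
  have topl: "?top b \<in> level t n (?m - Suc k)" if "b \<in> level t n (Suc k)" for b
    using chain_top[OF k D that] by blast
  have ent: "(\<Sum>a\<in>level t n k. \<Sum>b\<in>level t n (Suc k). - (?w a b * ln (?w a b))) = level_entropy n k"
    unfolding level_entropy_def by (intro sum.cong refl sum_edge_weight[where g = "\<lambda>x. - (x * ln x)"]) auto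
  have ent': "(\<Sum>c\<in>level t n (?m - k). \<Sum>b\<in>level t n (Suc k). - (?w' c b * ln (?w' c b))) = level_entropy n k"
    unfolding ent[symmetric]
    using sum.reindex_bij_betw[OF bij', of "\<lambda>a. \<Sum>b\<in>level t n (Suc k). - (?w a (complement n (?top b)) * ln (?w a (complement n (?top b))))"]
    by (simp add: sum.reindex_bij_betw[OF bij, of "\<lambda>b. - (?w _ b * ln (?w _ b))"])
  have "int (2 * Suc k) \<le> int ((t - 1) * n)" using k by (simp only: of_nat_le_iff)
  then have "level_size n (int k) \<le> level_size n (int k + 1)"
    unfolding int_top by (intro level_size_mono) auto
  then have \<nu>1: "?\<nu> \<le> 1"
    using level_size_nonneg[of n "int k + 1"] by (auto simp: divide_le_eq_1)
  have inner: "card (level t n k) = card (level t n (?m - k))"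
    using bij_betw_same_card[OF bij'] by simp
  have "exp ((\<Sum>a\<in>level t n k. \<Sum>b\<in>level t n (Suc k). - (?w a b * ln (?w a b)))
      + (\<Sum>c\<in>level t n (?m - k). \<Sum>b\<in>level t n (Suc k). - (?w' c b * ln (?w' c b)))
      - real (card (level t n k) + card (level t n (Suc k))))
    \<le> real (card ?P)"
  proof (rule card_double_matchings[where \<nu> = ?\<nu>])
    show "0 \<le> ?w a b" if "a \<in> level t n k" for a b using that edge_weight_nonneg by (auto simp: level_def)
    show "0 \<le> ?w' c b" if "c \<in> level t n (?m - k)" for c b
      using that edge_weight_nonneg complement_hypergrid by (auto simp: level_def)
    show "(\<Sum>b\<in>level t n (Suc k). ?w a b) = 1" if "a \<in> level t n k" for a using edge_weight_row[OF that km(3)] .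
    show "(\<Sum>b\<in>level t n (Suc k). ?w' c b) = 1" if "c \<in> level t n (?m - k)" for c
      using sum.reindex_bij_betw[OF bij, of "?w (complement n c)"] edge_weight_row[of "complement n c" n k] km
        bij_betw_apply[OF bij' that] by simp
    show "(\<Sum>a\<in>level t n k. ?w a b) = ?\<nu>" if "b \<in> level t n (Suc k)" for b by (rule edge_weight_col[OF that])
    show "(\<Sum>c\<in>level t n (?m - k). ?w' c b) = ?\<nu>" if "b \<in> level t n (Suc k)" for b
      using sum.reindex_bij_betw[OF bij', of "\<lambda>a. ?w a (complement n (?top b))"]
        edge_weight_col[OF bij_betw_apply[OF bij that]] by simp
    show "0 \<le> ?\<nu>" by (intro divide_nonneg_nonneg level_size_nonneg)
  qed (use \<nu>1 inner in \<open>auto simp: finite_level\<close>)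
  also have "\<dots> \<le> real (card (outer_pairs t n k D))"
  proof (intro of_nat_mono card_mono subsetI)
    show "finite (outer_pairs t n k D)"
    proof (rule finite_subset)
      show "outer_pairs t n k D \<subseteq> (level t n k \<rightarrow>\<^sub>E level t n (Suc k)) \<times> (level t n (?m - k) \<rightarrow>\<^sub>E level t n (Suc k))"
        by (auto simp: outer_pairs_def)
    qed (intro finite_cartesian_product finite_PiE finite_level)
    fix p assume p: "p \<in> ?P"
    obtain f h where fh: "p = (f, h)" by (cases p)
    have "grid_le n y c" if c: "c \<in> level t n (?m - k)" and C: "C \<in> D" "h c \<in> C" "y \<in> C" for c C y
    proof -
      have hc: "h c \<in> level t n (Suc k)" using p c fh by auto
      have "0 < ?w' c (h c)" using p c fh by blast
      then have "grid_le n (complement n c) (complement n (?top (h c)))" by (rule edge_weight_pos)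
      then have "grid_le n (?top (h c)) c"
        using complement_le[of c n "?top (h c)"] c topl[OF hc] by (simp add: level_def)
      moreover have "grid_le n y (?top (h c))" using chain_le_top[OF k D hc] C by blast
      ultimately show ?thesis using grid_le_trans by blast
    qed
    moreover have "\<forall>a\<in>level t n k. grid_le n a (f a)" using p fh edge_weight_pos by blast
    ultimately show "p \<in> outer_pairs t n k D" using p fh unfolding outer_pairs_def by blast
  qed
  finally show ?thesis unfolding ent ent' by simp
qed

section \<open>Starting at the middle level or levels\<close>

lemma middle_partial_scd:
  assumes "(t - 1) * n = 2 * k"
  shows "partial_scds t n k \<noteq> {}"
proof -
  let ?D = "(\<lambda>x. {x}) ` level t n k"
  have "symmetric_chain t n {x}" if "x \<in> level t n k" for x
    using that assms unfolding symmetric_chain_iff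
    by (auto simp: level_def grid_le_refl bij_betw_def intro!: exI[of _ k])
  moreover have "partition_on (band t n k) ?D"
    using assms by (intro partition_onI) (auto simp: level_def band_def disjnt_def)
  ultimately have "?D \<in> partial_scds t n k" by (auto simp: partial_scds_def)
  then show ?thesis by blast
qed

text \<open>The two middle levels have equal size, so the flow between them is doubly stochastic.
  The entropy bound is positive and thus yields a perfect matching, whose edges are the
  chains.\<close>

lemma middle_pair_partial_scd:
  assumes m: "(t - 1) * n = 2 * k + 1"
  shows "partial_scds t n k \<noteq> {}"
proof -
  let ?w = "edge_weight n" and ?A = "level t n k" and ?B = "level t n (Suc k)"
  have "card ?A = card ?B"
    using bij_betw_same_card[OF bij_betw_complement[of k n]] m by simp
  moreover have eq: "level_size n (int k) / level_size n (int k + 1) = 1" if "b \<in> ?B" for b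
  proof -
    have "level_size n (int k) = level_size n (int k + 1)"
      using card_level[of n k] card_level[of n "Suc k"] calculation by (simp add: add.commute)
    moreover have "0 < real (card ?B)" using that finite_level card_gt_0_iff by force
    ultimately show ?thesis using card_level[of n "Suc k"] by (simp add: add.commute)
  qed
  ultimately have "exp ((\<Sum>a\<in>?A. \<Sum>b\<in>?B. - (?w a b * ln (?w a b))) - real (card ?A))
      \<le> real (card (matchings ?A ?B (\<lambda>a b. 0 < ?w a b)))"
  proof (intro card_matchings_entropy finite_level)
    show "0 \<le> ?w a b" if "a \<in> ?A" for a b using that edge_weight_nonneg by (auto simp: level_def)
    show "(\<Sum>b\<in>?B. ?w a b) = 1" if "a \<in> ?A" for a using edge_weight_row[OF that] m by simp
    show "(\<Sum>a\<in>?A. ?w a b) = 1" if "b \<in> ?B" for b using edge_weight_col[OF that] eq[OF that] by simp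
  qed auto
  then have "0 < real (card (matchings ?A ?B (\<lambda>a b. 0 < ?w a b)))"
    by (rule less_le_trans[OF exp_gt_zero])
  then have "matchings ?A ?B (\<lambda>a b. 0 < ?w a b) \<noteq> {}" by auto
  then obtain \<sigma> where \<sigma>: "bij_betw \<sigma> ?A ?B" "\<And>a. a \<in> ?A \<Longrightarrow> 0 < ?w a (\<sigma> a)"
    by (auto simp: matchings_def)
  have \<sigma>B: "\<sigma> a \<in> ?B" if "a \<in> ?A" for a using bij_betw_apply[OF \<sigma>(1) that] .
  let ?D = "(\<lambda>a. {a, \<sigma> a}) ` ?A"
  have "symmetric_chain t n {a, \<sigma> a}" if a: "a \<in> ?A" for a
    unfolding symmetric_chain_iff
  proof (intro conjI exI[of _ k])
    have rk: "grid_rank n a = k" "grid_rank n (\<sigma> a) = Suc k" using a \<sigma>B[OF a] by (auto simp: level_def)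
    show "{a, \<sigma> a} \<subseteq> hypergrid t n" using a \<sigma>B[OF a] by (auto simp: level_def)
    show "2 * k \<le> (t - 1) * n" using m by simp
    have "{k..(t - 1) * n - k} = {k, Suc k}" using m by auto
    then show "bij_betw (grid_rank n) {a, \<sigma> a} {k..(t - 1) * n - k}"
      using rk by (auto simp: bij_betw_def)
    show "\<forall>x\<in>{a, \<sigma> a}. \<forall>y\<in>{a, \<sigma> a}. grid_rank n x \<le> grid_rank n y \<longrightarrow> grid_le n x y"
      using rk edge_weight_pos[OF \<sigma>(2)[OF a]] grid_le_refl by auto
  qed
  moreover have "partition_on (band t n k) ?D"
  proof (rule partition_onI)
    have "band t n k = ?A \<union> ?B" using m by (auto simp: band_def level_def)
    also have "?B = \<sigma> ` ?A" using \<sigma>(1) by (simp add: bij_betw_def)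
    finally show "\<Union> ?D = band t n k" by auto
    have "a \<noteq> \<sigma> a'" if "a \<in> ?A" "a' \<in> ?A" for a a' using that(1) \<sigma>B[OF that(2)] by (auto simp: level_def)
    moreover have "a = a'" if "a \<in> ?A" "a' \<in> ?A" "\<sigma> a = \<sigma> a'" for a a'
      using \<sigma>(1) that by (auto simp: bij_betw_def dest: inj_onD)
    ultimately show "disjnt p q" if "p \<in> ?D" "q \<in> ?D" "p \<noteq> q" for p q
      using that unfolding disjnt_def by blast
  qed auto
  ultimately have "?D \<in> partial_scds t n k" by (auto simp: partial_scds_def)
  then show ?thesis by blast
qed

text \<open>Starting from at least one partial decomposition around the middle, each step outwards
  contributes a factor that does not depend on the earlier choices. The band at \<open>k = 0\<close>
  is the whole grid.\<close>

theorem num_scd_entropy: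
  "exp (\<Sum>k<(t - 1) * n div 2. 2 * level_entropy n k - real (card (level t n k) + card (level t n (Suc k))))
    \<le> real (num_scd t n)"
proof -
  let ?K = "(t - 1) * n div 2"
  let ?X = "\<lambda>k. 2 * level_entropy n k - real (card (level t n k) + card (level t n (Suc k)))"
  have "exp (\<Sum>k\<in>{j..<?K}. ?X k) \<le> real (card (partial_scds t n j))" if "j \<le> ?K" for j
    using that
  proof (induction rule: inc_induct)
    case base
    have "(t - 1) * n = 2 * ?K \<or> (t - 1) * n = 2 * ?K + 1" by linarith
    then have "partial_scds t n ?K \<noteq> {}" using middle_partial_scd middle_pair_partial_scd by blast
    then have "1 \<le> card (partial_scds t n ?K)" using finite_partial_scds card_gt_0_iff by (metis Suc_le_eq One_nat_def)
    then show ?case by simp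
  next
    case (step j)
    have "Suc j \<le> ?K" using step.hyps by simp
    then have j: "2 * Suc j \<le> (t - 1) * n"
      by (subst (asm) less_eq_div_iff_mult_less_eq) (simp_all add: mult.commute)
    have "exp (\<Sum>k\<in>{j..<?K}. ?X k) = exp (\<Sum>k\<in>{Suc j..<?K}. ?X k) * exp (?X j)"
      using step by (simp add: sum.atLeast_Suc_lessThan exp_add[symmetric] add.commute)
    also have "\<dots> \<le> real (card (partial_scds t n (Suc j))) * exp (?X j)"
      using step by (intro mult_right_mono) auto
    also have "\<dots> \<le> real (card (partial_scds t n j))"
      by (intro card_partial_scds_step j card_outer_pairs)
    finally show ?case .
  qed
  then have "exp (\<Sum>k\<in>{0..<?K}. ?X k) \<le> real (card (partial_scds t n 0))" by blast
  moreover have "partial_scds t n 0 = {D. symmetric_chain_decomposition t n D}"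
  proof -
    have "band t n 0 = hypergrid t n" using grid_rank_le by (auto simp: band_def)
    then show ?thesis by (auto simp: partial_scds_def symmetric_chain_decomposition_def)
  qed
  ultimately show ?thesis by (simp add: num_scd_def atLeast0LessThan)
qed

end

section \<open>The number of decompositions\<close>

lemma sum_harmonic_le: "1 \<le> n \<Longrightarrow> (\<Sum>j<n. 1 / real (Suc j)) \<le> 1 + ln (real n)"
proof (induction n rule: nat_induct_at_least)
  case (Suc n)
  have "ln (real n / real (Suc n)) \<le> real n / real (Suc n) - 1"
    using Suc.hyps by (intro ln_le_minus_one) auto
  also have "\<dots> = - (1 / real (Suc n))" by (simp add: field_simps)
  finally have "1 / real (Suc n) \<le> ln (real (Suc n)) - ln (real n)"
    using Suc.hyps by (simp add: ln_div)
  then show ?case using Suc.IH by simp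
qed simp

lemma geometric_square_sum: "(\<Sum>l<L. (real l + 1)\<^sup>2 / 2 ^ l) \<le> 12"
proof -
  have "(\<Sum>l<L. (real l + 1)\<^sup>2 / 2 ^ l) = 12 - (2 * (real L)\<^sup>2 + 8 * real L + 12) / 2 ^ L"
  proof (induction L)
    case (Suc L)
    have "(2 * (real (Suc L))\<^sup>2 + 8 * real (Suc L) + 12) / 2 ^ Suc L
        = ((real L)\<^sup>2 + 6 * real L + 11) / 2 ^ L"
      by (simp add: power2_eq_square field_simps)
    then show ?case using Suc.IH by (simp add: power2_eq_square add_divide_distrib diff_divide_distrib algebra_simps)
  qed simp
  also have "\<dots> \<le> 12" by simp
  finally show ?thesis .
qed

context grid
begin

section \<open>Variance and anticoncentration of the rank\<close>

lemma sum_centered: "(\<Sum>v\<in>{1..t}. 2 * real v - real t - 1) = 0"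
proof -
  have "(\<Sum>v\<in>{1..m}. 2 * real v - c) = real m * (real m + 1) - c * real m" for m c
    by (induction m) (auto simp: algebra_simps)
  from this[of "real t + 1" t] show ?thesis by (simp add: algebra_simps)
qed

lemma sum_centered_square: "real t \<le> (\<Sum>v\<in>{1..t}. (2 * real v - real t - 1)\<^sup>2)"
proof -
  have "3 * (\<Sum>v\<in>{1..m}. (2 * real v - c)\<^sup>2)
      = 2 * real m * (real m + 1) * (2 * real m + 1) - 6 * c * real m * (real m + 1) + 3 * c\<^sup>2 * real m" for m c
    by (induction m) (auto simp: algebra_simps power2_eq_square)
  from this[of "real t + 1" t]
  have "3 * (\<Sum>v\<in>{1..t}. (2 * real v - real t - 1)\<^sup>2) = real t * ((real t)\<^sup>2 - 1)"
    by (simp add: algebra_simps power2_eq_square)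
  moreover have "2 * 2 \<le> real t * real t" using t2 by (intro mult_mono) auto
  then have "real t * 3 \<le> real t * ((real t)\<^sup>2 - 1)" by (intro mult_left_mono) (auto simp: power2_eq_square)
  ultimately show ?thesis by simp
qed

text \<open>Coordinates of a uniform element are independent and \<open>2 * v - t - 1\<close> has
  mean 0, so the cross terms vanish. Each coordinate contributes \<open>(t ^ 2 - 1) / 3\<close>,
  which is at least 1 for \<open>t \<ge> 2\<close>.\<close>

lemma variance_lower:
  assumes "finite S"
  shows "real (card S) * real t ^ card S \<le> (\<Sum>x\<in>S \<rightarrow>\<^sub>E {1..t}. (\<Sum>i\<in>S. 2 * real (x i) - real t - 1)\<^sup>2)"
  using assms
proof (induction S rule: finite_induct)
  case (insert l S)
  let ?a = "\<lambda>v. 2 * real v - real t - 1" and ?Y = "\<lambda>x. \<Sum>i\<in>S. 2 * real (x i) - real t - 1"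
  have split: "(\<Sum>i\<in>insert l S. ?a ((x(l := v)) i)) = ?a v + ?Y x" for x v
    using insert.hyps by (auto intro!: sum.cong)
  have "(\<Sum>x\<in>insert l S \<rightarrow>\<^sub>E {1..t}. (\<Sum>i\<in>insert l S. ?a (x i))\<^sup>2)
      = (\<Sum>v\<in>{1..t}. \<Sum>x\<in>S \<rightarrow>\<^sub>E {1..t}. (?a v + ?Y x)\<^sup>2)"
    by (subst sum_PiE_insert[OF insert.hyps(1,2)]) (simp only: split)
  also have "\<dots> = (\<Sum>v\<in>{1..t}. real t ^ card S * (?a v)\<^sup>2 + 2 * (\<Sum>x\<in>S \<rightarrow>\<^sub>E {1..t}. ?Y x) * ?a v
      + (\<Sum>x\<in>S \<rightarrow>\<^sub>E {1..t}. (?Y x)\<^sup>2))"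
  proof (rule sum.cong[OF refl])
    fix v
    have "(\<Sum>x\<in>S \<rightarrow>\<^sub>E {1..t}. (?a v + ?Y x)\<^sup>2)
        = (\<Sum>x\<in>S \<rightarrow>\<^sub>E {1..t}. (?a v)\<^sup>2 + 2 * ?a v * ?Y x + (?Y x)\<^sup>2)"
      by (simp only: power2_sum) (simp add: algebra_simps)
    also have "\<dots> = real (card (S \<rightarrow>\<^sub>E {1..t})) * (?a v)\<^sup>2 + 2 * ?a v * (\<Sum>x\<in>S \<rightarrow>\<^sub>E {1..t}. ?Y x)
        + (\<Sum>x\<in>S \<rightarrow>\<^sub>E {1..t}. (?Y x)\<^sup>2)"
      by (simp only: sum.distrib sum_constant sum_distrib_left)
    finally show "(\<Sum>x\<in>S \<rightarrow>\<^sub>E {1..t}. (?a v + ?Y x)\<^sup>2) = real t ^ card S * (?a v)\<^sup>2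
        + 2 * (\<Sum>x\<in>S \<rightarrow>\<^sub>E {1..t}. ?Y x) * ?a v + (\<Sum>x\<in>S \<rightarrow>\<^sub>E {1..t}. (?Y x)\<^sup>2)"
      using insert.hyps by (simp only: card_PiE prod_constant card_atLeastAtMost) simp
  qed
  also have "\<dots> = real t ^ card S * (\<Sum>v\<in>{1..t}. (?a v)\<^sup>2) + 2 * (\<Sum>x\<in>S \<rightarrow>\<^sub>E {1..t}. ?Y x) * (\<Sum>v\<in>{1..t}. ?a v)
      + real t * (\<Sum>x\<in>S \<rightarrow>\<^sub>E {1..t}. (?Y x)\<^sup>2)"
    by (simp only: sum.distrib sum_distrib_left[symmetric] sum_constant card_atLeastAtMost) simp
  also have "\<dots> \<ge> real t ^ card S * real t + real t * (real (card S) * real t ^ card S)"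
    unfolding sum_centered mult_zero_right add_0_right
    by (intro add_mono mult_left_mono insert.IH sum_centered_square) auto
  finally have "real t ^ card S * real t + real t * (real (card S) * real t ^ card S)
      \<le> (\<Sum>x\<in>insert l S \<rightarrow>\<^sub>E {1..t}. (\<Sum>i\<in>insert l S. ?a (x i))\<^sup>2)" .
  then show ?case using insert.hyps by (simp add: algebra_simps)
qed simp

lemma variance_level_size:
  "real n * real t ^ n \<le> (\<Sum>k\<in>{0..(int t - 1) * int n}. level_size n k * (of_int (2 * k - (int t - 1) * int n))\<^sup>2)"
proof -
  let ?M = "(int t - 1) * int n" and ?S = "{1..n}"
  let ?F = "\<lambda>k. (of_int (2 * k - ?M))\<^sup>2 :: real"
  have val: "(\<Sum>i\<in>?S. 2 * real (x i) - real t - 1) = of_int (2 * coord_rank ?S x - ?M)" for x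
    by (simp add: coord_rank_def sum_subtractf sum_distrib_left algebra_simps)
  have "real n * real t ^ n \<le> (\<Sum>x\<in>?S \<rightarrow>\<^sub>E {1..t}. ?F (coord_rank ?S x))"
    using variance_lower[of ?S] unfolding val by simp
  also have "\<dots> = (\<Sum>x\<in>?S \<rightarrow>\<^sub>E {1..t}. \<Sum>k\<in>{0..?M}. of_bool (coord_rank ?S x = k) * ?F k)"
  proof (rule sum.cong[OF refl])
    fix x assume x: "x \<in> ?S \<rightarrow>\<^sub>E {1..t}"
    have "0 \<le> coord_rank ?S x" "coord_rank ?S x \<le> (int t - 1) * int (card ?S)"
      using PiE_mem[OF x] by (intro coord_rank_range; auto)+
    then show "?F (coord_rank ?S x) = (\<Sum>k\<in>{0..?M}. of_bool (coord_rank ?S x = k) * ?F k)"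
      by (simp add: of_bool_def if_distrib[of "\<lambda>u. u * _"] cong: if_cong)
  qed
  also have "\<dots> = (\<Sum>k\<in>{0..?M}. level_size n k * ?F k)"
    using card_level_PiE[of ?S] by (subst sum.swap) (simp flip: sum_distrib_right)
  finally show ?thesis .
qed

lemma level_size_antimono:
  assumes "(int t - 1) * int n \<le> 2 * k + 1" "k \<le> k'"
  shows "level_size n k' \<le> level_size n k"
proof (cases "k = k'")
  case False
  then have "level_size n ((int t - 1) * int n - k') \<le> level_size n k"
    using assms by (intro level_size_mono) auto
  then show ?thesis by (simp only: level_size_sym)
qed simp

text \<open>A log-concave sequence with a large maximum decays geometrically, so that its variance is bounded.\<close>

lemma level_size_anticoncentration:
  assumes s: "0 < \<epsilon>" "2 / \<epsilon> \<le> real s" and n: "96 * s ^ 3 < n"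
  shows "level_size n k \<le> \<epsilon> * real t ^ n"
proof (rule ccontr)
  let ?f = "level_size n" and ?M = "(int t - 1) * int n"
  define c where "c = ?M div 2"
  have c: "2 * c \<le> ?M" "?M \<le> 2 * c + 1" "0 \<le> c"
    using t2 by (auto simp: c_def)
  have s0: "0 < s" using s by (metis divide_pos_pos less_le_trans of_nat_0_less_iff zero_less_numeral)
  assume "\<not> ?f k \<le> \<epsilon> * real t ^ n"
  moreover have "?f k \<le> ?f c"
  proof (cases "k \<le> c")
    case True
    then show ?thesis using c by (intro level_size_mono) auto
  next
    case False
    then show ?thesis using c by (intro level_size_antimono) auto
  qed
  ultimately have big: "\<epsilon> * real t ^ n < ?f c" by linarith
  have fc: "0 < ?f c" using big s by (smt (verit) mult_nonneg_nonneg zero_le_power of_nat_0_le_iff)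
  have T: "?f c \<le> real t ^ n" using sum_level_size_le[of "{c}" n] by simp
  \<comment> \<open>The \<open>s\<close> levels above \<open>c\<close> are at least as large as the
    last of them and hold at most \<open>t ^ n\<close> points together, so
    \<open>?f (c + int s)\<close> is at most \<open>t ^ n / s\<close>, hence at most
    \<open>\<epsilon> / 2 * t ^ n\<close>.\<close>
  have half: "?f (c + int s) \<le> ?f c / 2"
  proof -
    have "(\<Sum>i\<in>{1..s}. ?f (c + int s)) \<le> (\<Sum>i\<in>{1..s}. ?f (c + int i))"
      using c by (intro sum_mono level_size_antimono) auto
    also have "\<dots> = (\<Sum>k\<in>(\<lambda>i. c + int i) ` {1..s}. ?f k)"
      by (subst sum.reindex) (auto intro: inj_onI)
    also have "\<dots> \<le> real t ^ n" by (intro sum_level_size_le) auto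
    finally have "real s * ?f (c + int s) \<le> real t ^ n" by simp
    moreover have "2 \<le> real s * \<epsilon>" using s by (simp add: field_simps)
    then have "2 * ?f (c + int s) \<le> real s * \<epsilon> * ?f (c + int s)"
      using level_size_nonneg by (rule mult_right_mono)
    moreover have "\<epsilon> * (real s * ?f (c + int s)) \<le> \<epsilon> * real t ^ n"
      using calculation(1) s(1) by (intro mult_left_mono) auto
    ultimately have "2 * ?f (c + int s) \<le> \<epsilon> * real t ^ n"
      by (simp only: mult.commute mult.left_commute)
    then show ?thesis using big by simp
  qed
  have geo: "?f (c + int (l * s)) \<le> ?f c / 2 ^ l" for l
  proof (induction l)
    case (Suc l)
    have "?f c * ?f (c + int (Suc l * s)) \<le> ?f (c + int (l * s)) * ?f (c + int s)"
      by (intro log_concaveD[OF log_concave_level_size]) (auto simp: algebra_simps)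
    also have "\<dots> \<le> (?f c / 2 ^ l) * (?f c / 2)"
      using Suc.IH half fc by (intro mult_mono level_size_nonneg) auto
    also have "\<dots> = ?f c * (?f c / 2 ^ Suc l)" by simp
    finally show ?case using fc by (simp only: mult_le_cancel_left_pos)
  qed simp
  define h where "h k = ?f k * (of_int (2 * k - ?M))\<^sup>2" for k
  have h0: "0 \<le> h k" for k unfolding h_def by (intro mult_nonneg_nonneg level_size_nonneg) auto
  have hsym: "h (?M - k) = h k" for k
    unfolding h_def level_size_sym by (simp add: power2_commute algebra_simps)
  define L where "L = nat ?M + 1"
  \<comment> \<open>Block \<open>l\<close> has \<open>s\<close> levels of size at most
    \<open>?f c / 2 ^ l\<close> at doubled distance at most \<open>2 * (l + 1) * s\<close> from the
    middle. The series over \<open>l\<close> is bounded by 12, so one side gives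
    \<open>48 * s ^ 3\<close> and both give the 96 of the hypothesis.\<close>
  have block: "(\<Sum>i\<in>{l * s..<l * s + s}. h (c + int i)) \<le> 4 * real s ^ 3 * ?f c * ((real l + 1)\<^sup>2 / 2 ^ l)" for l
  proof -
    have "h (c + int i) \<le> ?f c / 2 ^ l * (2 * ((real l + 1) * real s))\<^sup>2" if i: "i \<in> {l * s..<l * s + s}" for i
      unfolding h_def
    proof (rule mult_mono)
      define z where "z = int (l * s)"
      have z: "0 \<le> z" "z \<le> int i"
        unfolding z_def using i by (simp_all only: of_nat_le_iff atLeastLessThan_iff of_nat_0_le_iff)
      have "?f (c + int i) \<le> ?f (c + int (l * s))"
        unfolding z_def[symmetric] using c z by (intro level_size_antimono) auto
      then show "?f (c + int i) \<le> ?f c / 2 ^ l" using geo[of l] by linarith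
      have "Suc i \<le> (l + 1) * s" using i by simp
      then have "real (Suc i) \<le> real ((l + 1) * s)" by (simp only: of_nat_le_iff)
      then have "real i + 1 \<le> (real l + 1) * real s" by (simp add: algebra_simps)
      moreover have "\<bar>2 * (c + int i) - ?M\<bar> \<le> 2 * (int i + 1)" using c by auto
      then have "real_of_int \<bar>2 * (c + int i) - ?M\<bar> \<le> real_of_int (2 * (int i + 1))" by (simp only: of_int_le_iff)
      ultimately have "\<bar>real_of_int (2 * (c + int i) - ?M)\<bar> \<le> 2 * ((real l + 1) * real s)"
        by (simp only: of_int_abs) simp
      then show "(real_of_int (2 * (c + int i) - ?M))\<^sup>2 \<le> (2 * ((real l + 1) * real s))\<^sup>2"
        by (rule abs_le_square_iff[THEN iffD1, OF order_trans]) simp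
    qed (use fc in auto)
    then have "(\<Sum>i\<in>{l * s..<l * s + s}. h (c + int i)) \<le> (\<Sum>i\<in>{l * s..<l * s + s}. ?f c / 2 ^ l * (2 * ((real l + 1) * real s))\<^sup>2)"
      by (rule sum_mono)
    also have "\<dots> = 4 * real s ^ 3 * ?f c * ((real l + 1)\<^sup>2 / 2 ^ l)"
      by (simp add: power2_eq_square power3_eq_cube)
    finally show ?thesis .
  qed
  have "(\<Sum>k\<in>{c..?M}. h k) \<le> (\<Sum>k\<in>(\<lambda>i. c + int i) ` {..<L * s}. h k)"
  proof (intro sum_mono2 subsetI)
    fix k assume k: "k \<in> {c..?M}"
    have "nat (k - c) \<le> nat ?M" using k c by (intro nat_mono) auto
    then have "nat (k - c) < L * 1" unfolding L_def by simp
    also have "L * 1 \<le> L * s" using s0 by (intro mult_le_mono2) simp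
    finally have "nat (k - c) < L * s" .
    then show "k \<in> (\<lambda>i. c + int i) ` {..<L * s}" using k by (intro image_eqI[of _ _ "nat (k - c)"]) auto
  qed (auto simp: h0)
  also have "\<dots> = (\<Sum>i<L * s. h (c + int i))"
    by (subst sum.reindex) (auto intro: inj_onI)
  also have "\<dots> = (\<Sum>l<L. \<Sum>i\<in>{l * s..<l * s + s}. h (c + int i))"
    by (rule sum.nat_group[symmetric])
  also have "\<dots> \<le> (\<Sum>l<L. 4 * real s ^ 3 * ?f c * ((real l + 1)\<^sup>2 / 2 ^ l))"
    by (intro sum_mono block)
  also have "\<dots> = 4 * real s ^ 3 * ?f c * (\<Sum>l<L. (real l + 1)\<^sup>2 / 2 ^ l)"
    by (simp only: sum_distrib_left)
  also have "\<dots> \<le> 4 * real s ^ 3 * ?f c * 12"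
    using fc by (intro mult_left_mono geometric_square_sum) auto
  finally have upper: "(\<Sum>k\<in>{c..?M}. h k) \<le> 48 * real s ^ 3 * ?f c" by simp
  have "(\<Sum>k\<in>{0..c}. h k) = (\<Sum>k\<in>{?M - c..?M}. h k)"
    by (rule sum.reindex_bij_witness[of _ "\<lambda>k. ?M - k" "\<lambda>k. ?M - k"]) (auto simp: hsym)
  also have "\<dots> \<le> (\<Sum>k\<in>{c..?M}. h k)"
    using c by (intro sum_mono2) (auto simp: h0)
  finally have lower: "(\<Sum>k\<in>{0..c}. h k) \<le> (\<Sum>k\<in>{c..?M}. h k)" .
  have "(\<Sum>k\<in>{0..?M}. h k) \<le> (\<Sum>k\<in>{0..c} \<union> {c..?M}. h k)"
    by (intro sum_mono2) (auto simp: h0)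
  also have "\<dots> \<le> (\<Sum>k\<in>{0..c}. h k) + (\<Sum>k\<in>{c..?M}. h k)"
    by (subst sum_Un) (auto intro!: sum_nonneg simp: h0)
  finally have "(\<Sum>k\<in>{0..?M}. h k) \<le> 96 * real s ^ 3 * ?f c" using upper lower by simp
  moreover have "real n * real t ^ n \<le> (\<Sum>k\<in>{0..?M}. h k)"
    using variance_level_size[of n] by (simp add: h_def)
  moreover have "96 * real s ^ 3 * ?f c \<le> 96 * real s ^ 3 * real t ^ n"
    by (intro mult_left_mono T) auto
  ultimately have "real n * real t ^ n \<le> (96 * real s ^ 3) * real t ^ n" by linarith
  then have "real n \<le> 96 * real s ^ 3" using t2 by simp
  moreover have "real (96 * s ^ 3) < real n" using n by (simp only: of_nat_less_iff)
  ultimately show False by simp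
qed

section \<open>Assembling the bound\<close>

lemma sum_card_level: "(\<Sum>k\<le>(t - 1) * n. real (card (level t n k))) = real t ^ n"
proof -
  have "hypergrid t n = (\<Union>k\<le>(t - 1) * n. level t n k)"
    using grid_rank_le by (auto simp: level_def)
  then have "card (hypergrid t n) = (\<Sum>k\<le>(t - 1) * n. card (level t n k))"
    using finite_level by (simp only:) (subst card_UN_disjoint, auto simp: level_def)
  moreover have "card (hypergrid t n) = t ^ n" by (simp add: hypergrid_def card_PiE)
  ultimately show ?thesis by (metis of_nat_power of_nat_sum)
qed

text \<open>Reflection doubles the lower levels. What remains are one or two middle levels,
  according to the parity of the top rank.\<close>

lemma sum_lower_levels:
  assumes "\<And>k. level_size n k \<le> \<eta> * real t ^ n"
  shows "(1 - 2 * \<eta>) * real t ^ n \<le> 2 * (\<Sum>k<(t - 1) * n div 2. real (card (level t n k)))"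
proof -
  define m where m: "m = (t - 1) * n"
  let ?m = m and ?c = "\<lambda>k. real (card (level t n k))"
  let ?K = "?m div 2"
  have sym: "?c (?m - k) = ?c k" if "k \<le> ?m" for k
    using bij_betw_same_card[OF bij_betw_complement[of k n]] that unfolding m by simp
  have K: "?m = 2 * ?K \<or> ?m = 2 * ?K + 1" by linarith
  have small: "?c k \<le> \<eta> * real t ^ n" for k unfolding card_level by (rule assms)
  have \<eta>0: "0 \<le> \<eta> * real t ^ n" using small[of 0] by (meson of_nat_0_le_iff order_trans)
  have "{..?m} = {..<?K} \<union> {?K..?m - ?K} \<union> {?m - ?K<..?m}" using K by auto
  then have "real t ^ n = (\<Sum>k\<in>{..<?K} \<union> {?K..?m - ?K} \<union> {?m - ?K<..?m}. ?c k)"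
    using sum_card_level[of n] unfolding m[symmetric] by (simp only:)
  also have "\<dots> = (\<Sum>k<?K. ?c k) + (\<Sum>k\<in>{?K..?m - ?K}. ?c k) + (\<Sum>k\<in>{?m - ?K<..?m}. ?c k)"
    using K by (subst sum.union_disjoint; (subst sum.union_disjoint)?; auto)
  also have "(\<Sum>k\<in>{?m - ?K<..?m}. ?c k) = (\<Sum>k<?K. ?c k)"
    by (rule sum.reindex_bij_witness[of _ "\<lambda>k. ?m - k" "\<lambda>k. ?m - k"]) (use sym K in auto)
  also have "(\<Sum>k\<in>{?K..?m - ?K}. ?c k) \<le> (\<Sum>k\<in>{?K..?m - ?K}. \<eta> * real t ^ n)"
    by (intro sum_mono small)
  also have "(\<Sum>k\<in>{?K..?m - ?K}. \<eta> * real t ^ n) = real (card {?K..?m - ?K}) * (\<eta> * real t ^ n)" by simp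
  also have "\<dots> \<le> 2 * (\<eta> * real t ^ n)"
    using K \<eta>0 by (intro mult_right_mono) auto
  finally show ?thesis unfolding m[symmetric] by (simp add: algebra_simps)
qed

text \<open>The loss of \<open>8 * \<eta>\<close> is made up of \<open>\<eta>\<close> from
  \<open>ln (1 / \<delta>)\<close>, \<open>2 * \<eta>\<close> from the middle levels,
  \<open>4 * \<eta>\<close> from the flow error, which enters twice at each of the two ends, and
  \<open>\<eta>\<close> to absorb the \<open>2 * t ^ n\<close> lost in the matching bound, since
  \<open>2 \<le> \<eta> * ln n\<close>.\<close>

lemma num_scd_lower_bound:
  assumes n: "2 \<le> n" and \<eta>: "0 < \<eta>" "\<eta> \<le> 1 / 8" and s: "2 / \<eta> \<le> real s" "96 * s ^ 3 < n"
    and j0: "48 \<le> j0" "28 * (14 / 15) ^ j0 \<le> \<eta>"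
    and big: "2 * (real j0 + 2 * window_const ^ 3 * (1 + ln (real n))) \<le> real n powr \<eta>"
    and ln: "2 \<le> \<eta> * ln (real n)"
  shows "real n powr ((1 - 8 * \<eta>) * real (t ^ n)) \<le> real (num_scd t n)"
proof -
  let ?m = "(t - 1) * n" and ?c = "\<lambda>k. real (card (level t n k))"
  let ?K = "?m div 2" and ?E = "\<lambda>x. \<Sum>i\<in>{1..n}. flow_err j0 n {1..n} x i"
  define \<Lambda> where "\<Lambda> = ln (real n)"
  define \<delta> where "\<delta> = real n powr (\<eta> - 1)"
  have n0: "0 < real n" using n by simp
  have \<Lambda>: "0 < \<Lambda>" using n by (simp add: \<Lambda>_def)
  have \<delta>: "0 < \<delta>" "\<delta> \<le> 1" using n \<eta> by (auto simp: \<delta>_def powr_le_one_le ln_ge_zero powr_def mult_nonpos_nonneg)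
  have ln\<delta>: "ln (1 / \<delta>) = (1 - \<eta>) * \<Lambda>"
    using n by (simp add: \<delta>_def \<Lambda>_def ln_div ln_powr algebra_simps)
  have "(\<Sum>j<n. stage_bound j0 j) \<le> (\<Sum>j<n. of_bool (j < j0) + 2 * window_const ^ 3 * (1 / real (Suc j)))"
    using window_const_pos by (intro sum_mono) (auto simp: stage_bound_def)
  also have "\<dots> = (\<Sum>j<n. of_bool (j < j0)) + 2 * window_const ^ 3 * (\<Sum>j<n. 1 / real (Suc j))"
    by (simp add: sum.distrib sum_distrib_left)
  also have "(\<Sum>j<n. of_bool (j < j0)) \<le> real j0"
  proof -
    have "(\<Sum>j<n. of_bool (j < j0)) = real (card ({..<n} \<inter> {j. j < j0}))" by (simp add: of_bool_def sum.If_cases)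
    also have "\<dots> \<le> real (card {..<j0})" by (intro of_nat_mono card_mono) auto
    finally show ?thesis by simp
  qed
  also have "2 * window_const ^ 3 * (\<Sum>j<n. 1 / real (Suc j)) \<le> 2 * window_const ^ 3 * (1 + ln (real n))"
    using n window_const_pos by (intro mult_left_mono sum_harmonic_le) auto
  finally have "2 * (\<Sum>j<n. stage_bound j0 j) \<le> real n powr \<eta>" using big by simp
  then have "2 * ((\<Sum>j<n. stage_bound j0 j) / real n) \<le> real n powr \<eta> / real n"
    using n0 by (simp add: divide_right_mono)
  also have "\<dots> = \<delta>" using n0 by (simp add: \<delta>_def powr_diff)
  finally have stage: "2 * ((\<Sum>j<n. stage_bound j0 j) / real n) \<le> \<delta>" .
  have E0: "0 \<le> ?E x" for x by (intro sum_nonneg flow_err_nonneg)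
  have row: "(1 - \<eta>) * \<Lambda> * (1 - 2 * ?E a) \<le> (\<Sum>i\<in>{1..n}. - (flow n a i * ln (flow n a i)))"
    if a: "a \<in> level t n k" and k: "k < ?K" for a k
  proof -
    have "k < ?m" using k by linarith
    then have "int k < int ?m" by (simp only: of_nat_less_iff)
    then have "coord_rank {1..n} a < (int t - 1) * int n" unfolding level_rank[OF a] int_top .
    then show ?thesis
      unfolding ln\<delta>[symmetric] using a hypergridD[of a n] \<delta> stage j0
      by (intro sym_flow_entropy) (auto simp: level_def)
  qed
  have err: "(\<Sum>k<?K. \<Sum>a\<in>level t n k. ?E a) \<le> \<eta> * real t ^ n"
  proof -
    have "(\<Sum>k<?K. \<Sum>a\<in>level t n k. ?E a) = (\<Sum>a\<in>(\<Union>k<?K. level t n k). ?E a)"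
      using finite_level by (intro sum.UNION_disjoint[symmetric]) (auto simp: level_def)
    also have "\<dots> \<le> (\<Sum>a\<in>{1..n} \<rightarrow>\<^sub>E {1..t}. ?E a)"
      using E0 finite_hypergrid[of t n] by (intro sum_mono2) (auto simp: level_def hypergrid_def)
    also have "\<dots> \<le> real t ^ n * (\<Sum>j\<in>{j0..<n}. 2 * (14 / 15) ^ Suc j)"
      using sum_flow_err[of "{1..n}" n j0] by simp
    \<comment> \<open>A geometric series with ratio \<open>14/15\<close>: the full tail is
      \<open>2 * 15 * (14/15) ^ Suc j0\<close>, which equals
      \<open>28 * (14/15) ^ j0\<close>.\<close>
    also have "(\<Sum>j\<in>{j0..<n}. 2 * (14 / 15) ^ Suc j) \<le> (28 * (14 / 15) ^ j0 :: real)"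
    proof (cases "j0 \<le> n")
      case True
      have "(\<Sum>j\<in>{j0..<n}. 2 * (14 / 15) ^ Suc j) = (28 * ((14 / 15) ^ j0 - (14 / 15) ^ n) :: real)"
        using True by (induction n rule: dec_induct) (auto simp: algebra_simps)
      then show ?thesis by simp
    qed simp
    then have "real t ^ n * (\<Sum>j\<in>{j0..<n}. 2 * (14 / 15) ^ Suc j) \<le> real t ^ n * \<eta>"
      using j0 by (intro mult_left_mono) auto
    finally show ?thesis by (simp add: mult.commute)
  qed
  have lower: "(1 - 2 * \<eta>) * real t ^ n \<le> 2 * (\<Sum>k<?K. ?c k)"
    using s \<eta> by (intro sum_lower_levels level_size_anticoncentration) auto
  have mass: "(\<Sum>k<?K. ?c k + ?c (Suc k)) \<le> 2 * real t ^ n"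
  proof -
    have "(\<Sum>k<?K. ?c k) \<le> real t ^ n"
      unfolding sum_card_level[symmetric] by (intro sum_mono2) auto
    moreover have "(\<Sum>k<?K. ?c (Suc k)) = (\<Sum>k\<in>Suc ` {..<?K}. ?c k)" by (simp add: sum.reindex)
    moreover have "(\<Sum>k\<in>Suc ` {..<?K}. ?c k) \<le> real t ^ n"
      unfolding sum_card_level[symmetric] by (intro sum_mono2) auto
    ultimately show ?thesis by (simp add: sum.distrib)
  qed
  have "(1 - \<eta>) * \<Lambda> * ((\<Sum>k<?K. ?c k) - 2 * (\<Sum>k<?K. \<Sum>a\<in>level t n k. ?E a))
      = (\<Sum>k<?K. \<Sum>a\<in>level t n k. (1 - \<eta>) * \<Lambda> * (1 - 2 * ?E a))"
    by (simp only: sum_distrib_left[symmetric] sum_subtractf sum_constant mult_1_right)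
  also have "\<dots> \<le> (\<Sum>k<?K. level_entropy n k)"
    unfolding level_entropy_def by (intro sum_mono row) auto
  finally have ent: "(1 - \<eta>) * \<Lambda> * ((\<Sum>k<?K. ?c k) - 2 * (\<Sum>k<?K. \<Sum>a\<in>level t n k. ?E a)) \<le> (\<Sum>k<?K. level_entropy n k)" .
  have "(1 - \<eta>) * \<Lambda> * ((1 - 6 * \<eta>) * real t ^ n)
      \<le> (1 - \<eta>) * \<Lambda> * (2 * ((\<Sum>k<?K. ?c k) - 2 * (\<Sum>k<?K. \<Sum>a\<in>level t n k. ?E a)))"
    using \<Lambda> \<eta> lower err by (intro mult_left_mono) (auto simp: algebra_simps)
  then have "(1 - \<eta>) * \<Lambda> * ((1 - 6 * \<eta>) * real t ^ n) \<le> 2 * (\<Sum>k<?K. level_entropy n k)"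
    using ent by linarith
  then have "(1 - \<eta>) * \<Lambda> * ((1 - 6 * \<eta>) * real t ^ n) - 2 * real t ^ n
      \<le> (\<Sum>k<?K. 2 * level_entropy n k - real (card (level t n k) + card (level t n (Suc k))))"
    using mass by (simp add: sum_subtractf sum_distrib_left)
  moreover have "(1 - 8 * \<eta>) * real t ^ n * \<Lambda> \<le> (1 - \<eta>) * \<Lambda> * ((1 - 6 * \<eta>) * real t ^ n) - 2 * real t ^ n"
  proof -
    have "(1 - 8 * \<eta>) * \<Lambda> \<le> (1 - \<eta>) * (1 - 6 * \<eta>) * \<Lambda> - 2"
    proof -
      have "0 \<le> 6 * \<eta> * \<eta> * \<Lambda>" using \<Lambda> \<eta> by simp
      moreover have "2 \<le> \<eta> * \<Lambda>" using ln by (simp add: \<Lambda>_def)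
      ultimately show ?thesis by (simp add: algebra_simps)
    qed
    then have "(1 - 8 * \<eta>) * \<Lambda> * real t ^ n \<le> ((1 - \<eta>) * (1 - 6 * \<eta>) * \<Lambda> - 2) * real t ^ n"
      by (rule mult_right_mono) simp
    then show ?thesis by (simp add: algebra_simps)
  qed
  ultimately have "(1 - 8 * \<eta>) * real t ^ n * \<Lambda>
      \<le> (\<Sum>k<?K. 2 * level_entropy n k - real (card (level t n k) + card (level t n (Suc k))))"
    by linarith
  then have "exp ((1 - 8 * \<eta>) * real t ^ n * \<Lambda>) \<le> real (num_scd t n)"
    using num_scd_entropy[of n] by (meson exp_le_cancel_iff order_trans)
  then show ?thesis using n0 by (simp add: powr_def \<Lambda>_def)
qed

end

theorem theorem1p2:
  fixes \<epsilon> :: real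
  assumes "\<epsilon> > 0"
  shows "\<exists>n0::nat. \<forall>n>n0. \<forall>t::nat. t \<ge> 2 \<longrightarrow>
           real (num_scd t n) \<ge> real n powr ((1 - \<epsilon>) * real (t ^ n))"
proof -
  \<comment> \<open>One eighth of \<open>\<epsilon>\<close> because the loss is
    \<open>8 * \<eta>\<close>; the cap covers large \<open>\<epsilon>\<close>.\<close>
  define \<eta> where "\<eta> = min (\<epsilon> / 8) (1 / 8)"
  have \<eta>: "0 < \<eta>" "\<eta> \<le> 1 / 8" "8 * \<eta> \<le> \<epsilon>" using assms by (auto simp: \<eta>_def)
  obtain s where s: "2 / \<eta> \<le> real s" using real_arch_simple by blast
  define A where "A = 2 * window_const ^ 3"
  have "0 < A" using window_const_pos by (simp add: A_def)
  have "(\<lambda>j. 28 * (14 / 15) ^ j :: real) \<longlonglongrightarrow> 28 * 0"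
    by (intro tendsto_intros LIMSEQ_power_zero) auto
  from order_tendstoD(2)[OF this, of \<eta>] have "eventually (\<lambda>j. 28 * (14 / 15) ^ j < \<eta>) sequentially"
    using \<eta>(1) by simp
  then obtain j1 where j1: "\<And>j. j1 \<le> j \<Longrightarrow> 28 * (14 / 15) ^ j < \<eta>"
    by (auto simp: eventually_sequentially)
  define j0 where "j0 = max j1 48"
  have j0: "48 \<le> j0" "28 * (14 / 15) ^ j0 \<le> \<eta>" using j1[of j0] by (auto simp: j0_def)
  have "eventually (\<lambda>n. 2 * (real j0 + A * (1 + ln (real n))) \<le> real n powr \<eta>) sequentially"
    using \<open>0 < \<eta>\<close> \<open>0 < A\<close> by real_asymp
  moreover have "eventually (\<lambda>n. 2 \<le> \<eta> * ln (real n)) sequentially"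
    using \<open>0 < \<eta>\<close> by real_asymp
  ultimately have "eventually (\<lambda>n. 2 * (real j0 + A * (1 + ln (real n))) \<le> real n powr \<eta> \<and> 2 \<le> \<eta> * ln (real n)) sequentially"
    by (rule eventually_conj)
  then obtain n1 where n1: "\<And>n. n1 \<le> n \<Longrightarrow> 2 * (real j0 + A * (1 + ln (real n))) \<le> real n powr \<eta> \<and> 2 \<le> \<eta> * ln (real n)"
    by (auto simp: eventually_sequentially)
  \<comment> \<open>All ingredients depend on \<open>\<epsilon>\<close> only, which makes the
    threshold uniform in \<open>t\<close>.\<close>
  define n0 where "n0 = max (max n1 (96 * s ^ 3)) 2"
  have "real n powr ((1 - \<epsilon>) * real (t ^ n)) \<le> real (num_scd t n)" if n: "n0 < n" and t: "2 \<le> t" for n t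
  proof -
    interpret grid t using t by unfold_locales
    have nn: "2 \<le> n" "96 * s ^ 3 < n" "n1 \<le> n" using n by (auto simp: n0_def)
    have "real n powr ((1 - \<epsilon>) * real (t ^ n)) \<le> real n powr ((1 - 8 * \<eta>) * real (t ^ n))"
      using nn \<eta>(3) by (intro powr_mono mult_right_mono) auto
    also have "\<dots> \<le> real (num_scd t n)"
      using n1[OF nn(3)] unfolding A_def
      by (intro num_scd_lower_bound[OF nn(1) \<eta>(1,2) s nn(2) j0]) simp_all
    finally show ?thesis .
  qed
  then show ?thesis by blast
qed

end
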